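(* Let $\Omega'$ be a bounded open connected set of $\mathbb{R}^2$. Let $k>0$ satisfy $k^2\le\lambda_{1,2}(\Omega')$ and let $d\in S^2$ be fixed. Then an obstacle $D\subset\mathbb{R}^3$ with $\overline D\subset\mathbb{R}\times\Omega'$ is uniquely determined by its far-field pattern $F_D(\,\cdot\,,d;k)$; that is, if $D_1$ and $D_2$ are two obstacles in $\mathbb{R}^3$ with $\overline{D_1}\subset\mathbb{R}\times\Omega'$ and $\overline{D_2}\subset\mathbb{R}\times\Omega'$, and $F_{D_1}(\varphi,d;k)=F_{D_2}(\varphi,d;k)$ for all $\varphi\in S^2$, then $D_1=D_2$.
   Context: For a bounded connected open set $U\subset\mathbb{R}^2$, $\lambda_{1,2}(U)$ denotes the first Dirichlet eigenvalue of $-\triangle$ (the two-dimensional Laplacian) in $U$ (no boundary regularity is assumed; the Dirichlet condition is understood in the sense of $H^1_0(U)$). An obstacle is a (nonempty) bounded domain $D\subset\mathbb{R}^3$ (open and connected) with $C^2$ boundary such that $\mathbb{R}^3\setminus\overline D$ is connected. For $k>0$ and $d\in S^2$ (the unit sphere in $\mathbb{R}^3$), the total wave field outside the sound-soft obstacle $D$ is the (unique, classical, complex-valued, continuous up to $\partial D$) function $u(x;d,k)=e^{ikx\cdot d}+w(x)$ satisfying $$\triangle u+k^2u=0\ \text{in}\ \mathbb{R}^3\setminus\overline D,\qquad u=0\ \text{on}\ \partial D,$$ and the Sommerfeld radiation condition $$\lim_{r\to\infty}r\left(\frac{\partial w}{\partial r}-ikw\right)=0,\qquad r=|x|$$ (uniformly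 in all directions $x/|x|$). The scattered wave $w=u-e^{ikx\cdot d}$ has the asymptotic behaviour $$w(r\varphi)=\frac{e^{ikr}}{r}F_D(\varphi,d;k)+O\left(\frac{1}{r^{2}}\right),\quad r\to\infty,$$ uniformly for $\varphi\in S^2$; the coefficient $F_D(\varphi,d;k)$ is called the far-field pattern of $D$. *)

theory Defs
  imports "HOL-Analysis.Analysis" "HOL-Library.Landau_Symbols"
begin

text \<open>Meaningful for open \<open>S\<close>, where the derivatives at the points of \<open>S\<close> do not depend on
  the values of \<open>f\<close> outside \<open>S\<close>.\<close>

primrec Ck_on :: "nat \<Rightarrow> 'a::euclidean_space set \<Rightarrow> ('a \<Rightarrow> 'b::real_normed_vector) \<Rightarrow> bool" where
  "Ck_on 0 S f \<longleftrightarrow> continuous_on S f"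
| "Ck_on (Suc m) S f \<longleftrightarrow>
     (\<forall>x\<in>S. f differentiable (at x)) \<and>
     (\<forall>v. Ck_on m S (\<lambda>x. frechet_derivative f (at x) v))"

definition laplacian :: "('a::euclidean_space \<Rightarrow> 'b::real_normed_vector) \<Rightarrow> 'a \<Rightarrow> 'b" where
  "laplacian f x =
     (\<Sum>b\<in>Basis. frechet_derivative (\<lambda>y. frechet_derivative f (at y) b) (at x) b)"

definition grad :: "('a::euclidean_space \<Rightarrow> real) \<Rightarrow> 'a \<Rightarrow> 'a" where
  "grad f x = (\<Sum>b\<in>Basis. frechet_derivative f (at x) b *\<^sub>R b)"


subsection \<open>The first Dirichlet eigenvalue\<close>

definition test_function :: "'a::euclidean_space set \<Rightarrow> ('a \<Rightarrow> real) \<Rightarrow> bool" where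
  "test_function U f \<longleftrightarrow>
     (\<forall>m. Ck_on m UNIV f) \<and> compact (closure {x. f x \<noteq> 0}) \<and> closure {x. f x \<noteq> 0} \<subseteq> U"

text \<open>\<open>in_H10 U u g\<close>: the function \<open>u\<close> lies in $H^1_0(U)$, the closure of the test functions in
  the $H^1(U)$ norm, and \<open>g\<close> is its weak gradient. Square integrability of \<open>u\<close> and \<open>g\<close> over \<open>U\<close>
  follows from the convergence. Only the values on \<open>U\<close>, up to null sets, matter; every
  class has Borel representatives on the whole space.\<close>

definition in_H10 ::
  "'a::euclidean_space set \<Rightarrow> ('a \<Rightarrow> real) \<Rightarrow> ('a \<Rightarrow> 'a) \<Rightarrow> bool" where
  "in_H10 U u g \<longleftrightarrow>
     u \<in> borel_measurable borel \<and> g \<in> borel_measurable borel \<and>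
     (\<exists>f :: nat \<Rightarrow> 'a \<Rightarrow> real. (\<forall>n. test_function U (f n)) \<and>
        (\<lambda>n. \<integral>\<^sup>+x\<in>U. ennreal ((f n x - u x)\<^sup>2) \<partial>lborel) \<longlonglongrightarrow> 0 \<and>
        (\<lambda>n. \<integral>\<^sup>+x\<in>U. ennreal ((norm (grad (f n) x - g x))\<^sup>2) \<partial>lborel) \<longlonglongrightarrow> 0)"

definition dirichlet_eigenvalue :: "'a::euclidean_space set \<Rightarrow> real \<Rightarrow> bool" where
  "dirichlet_eigenvalue U \<mu> \<longleftrightarrow>
     (\<exists>u g. in_H10 U u g \<and> \<not> (AE x in lborel. x \<in> U \<longrightarrow> u x = 0) \<and>
        (\<forall>f. test_function U f \<longrightarrow>
           (LINT x:U|lborel. g x \<bullet> grad f x) = \<mu> * (LINT x:U|lborel. u x * f x)))"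

text \<open>For a nonempty bounded open set the infimum is attained.\<close>

definition first_dirichlet_eigenvalue :: "'a::euclidean_space set \<Rightarrow> real" where
  "first_dirichlet_eigenvalue U = Inf {\<mu>. dirichlet_eigenvalue U \<mu>}"


subsection \<open>Obstacles\<close>

text \<open>Near each boundary point, in suitable Cartesian coordinates, \<open>D\<close> is the region strictly
  above the graph of a $C^2$ function.\<close>

definition C2_boundary :: "(real^3) set \<Rightarrow> bool" where
  "C2_boundary D \<longleftrightarrow>
     (\<forall>p\<in>frontier D. \<exists>r>0. \<exists>(T :: real^3 \<Rightarrow> real^3) (\<gamma> :: real^2 \<Rightarrow> real).
        orthogonal_transformation T \<and> Ck_on 2 UNIV \<gamma> \<and>
        D \<inter> ball p r = {x \<in> ball p r. T x $ 3 > \<gamma> (vector [T x $ 1, T x $ 2])})"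

definition obstacle :: "(real^3) set \<Rightarrow> bool" where
  "obstacle D \<longleftrightarrow>
     D \<noteq> {} \<and> bounded D \<and> open D \<and> connected D \<and> C2_boundary D \<and> connected (- closure D)"

definition cylinder :: "(real^2) set \<Rightarrow> (real^3) set" where
  "cylinder U = {x. vector [x $ 2, x $ 3] \<in> U}"


subsection \<open>Scattering\<close>

definition plane_wave :: "real^3 \<Rightarrow> real \<Rightarrow> real^3 \<Rightarrow> complex" where
  "plane_wave d k x = exp (\<i> * of_real (k * (x \<bullet> d)))"

text \<open>Limits and Landau symbols along \<open>at_infinity\<close> are uniform in the direction
  \<open>sgn x = x /\<^sub>R norm x\<close>.\<close>

definition sommerfeld_radiating :: "real \<Rightarrow> (real^3 \<Rightarrow> complex) \<Rightarrow> bool" where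
  "sommerfeld_radiating k w \<longleftrightarrow>
     ((\<lambda>x. of_real (norm x) *
        (frechet_derivative w (at x) (sgn x) - \<i> * of_real k * w x)) \<longlongrightarrow> 0) at_infinity"

text \<open>The values of \<open>u\<close> inside \<open>D\<close> are irrelevant.\<close>

definition total_field ::
  "(real^3) set \<Rightarrow> real^3 \<Rightarrow> real \<Rightarrow> (real^3 \<Rightarrow> complex) \<Rightarrow> bool" where
  "total_field D d k u \<longleftrightarrow>
     Ck_on 2 (- closure D) u \<and> continuous_on (- D) u \<and>
     (\<forall>x\<in>- closure D. laplacian u x + of_real (k\<^sup>2) * u x = 0) \<and>
     (\<forall>x\<in>frontier D. u x = 0) \<and>
     sommerfeld_radiating k (\<lambda>x. u x - plane_wave d k x)"

text \<open>\<open>F\<close> (on the unit sphere) is the far-field pattern $F_D(\cdot, d; k)$. This is a relation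
  because \<open>F\<close> is a function on the whole space whose values off the sphere are arbitrary;
  for an obstacle \<open>D\<close> and \<open>k > 0\<close> the total field outside \<open>D\<close>, and hence \<open>F\<close> on the sphere, exists
  and is unique.\<close>

definition far_field_pattern ::
  "(real^3) set \<Rightarrow> real^3 \<Rightarrow> real \<Rightarrow> (real^3 \<Rightarrow> complex) \<Rightarrow> bool" where
  "far_field_pattern D d k F \<longleftrightarrow>
     (\<exists>u. total_field D d k u \<and>
        (\<lambda>x. (u x - plane_wave d k x)
              - exp (\<i> * of_real (k * norm x)) / of_real (norm x) * F (sgn x))
          \<in> O[at_infinity](\<lambda>x. of_real (1 / (norm x)\<^sup>2)))"

end

theory Submission
  imports Defs "HOL-Complex_Analysis.Great_Picard"
begin

text \<open>
  Let $u_1$ and $u_2$ be the total fields, $C$ the union of the closures of the two obstacles and $G$ the unbounded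
  component of the complement of $C$. Equality of the far-field patterns makes $w = u_1 - u_2$ a solution of the
  Helmholtz equation off $C$ of order $|x|^{-2}$ at infinity. Such a solution vanishes near infinity (\<open>Rellich\<close>) and
  therefore in $G$ (\<open>Helmholtz_unique_continuation\<close>).

  Suppose that the exterior of $D_1$ is not contained in $G$. Its part $V$ off the closure of $G$ is then nonempty, and it
  lies in the cylinder, since a line parallel to the axis that misses the cylinder belongs to $G$. A frontier point of
  $V$ lies on the frontier of $D_1$, where $u_1 = 0$, or on the frontiers of both $G$ and $D_2$, where
  $u_1 = u_2 = 0$. So $u_1$ solves the homogeneous Dirichlet problem in the bounded set $V$. The only solution is zero:
  the energy identity reads $\int |\nabla u|^2 = k^2 \int |u|^2$, where the derivatives across the axis alone contribute at least
  $\lambda_{1,2} \int |u|^2 \ge k^2 \int |u|^2$, and the derivative along the axis contributes a positive amount in addition, by the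
  Poincare inequality (\<open>Helmholtz_solution_nonpositive\<close>, applied to the real and imaginary parts and their negatives).
  By unique continuation $u_1$ vanishes in the whole exterior of $D_1$, which is impossible since the plane wave does
  not decay (\<open>total_field_nonzero\<close>). Thus the exterior of each obstacle lies in $G$ (\<open>complement_subset_outside\<close>), the
  two closures are equal, and an obstacle is the interior of its closure.

  Rellich's lemma and unique continuation are both proved by testing the equation with products of $(a \cdot x)^m$ and
  radial functions. Such a test function turns the equation into an ordinary differential equation in $s = |x|^2$ whose
  solutions are explicit (\<open>spherical_wave\<close>). Induction on $m$ shows that all moments of $w$ of this form vanish
  (\<open>radial_moments_vanish\<close>), and these moments determine $w$ (\<open>zero_if_radial_moments_vanish\<close>).

  The eigenvalue enters through the inequality $\lambda_1 \int f^2 \le \int |\nabla f|^2$. It requires that the infimum of the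
  Rayleigh quotient is attained by an eigenfunction in $H^1_0$ (\<open>dirichlet_eigenvalue_le_Rayleigh_quotient\<close>), which
  rests on the compactness of the embedding into the square integrable functions (\<open>compact_embedding\<close>). No regularity of
  the frontier of $V$ is available, so the energy argument is carried out for $u$ truncated at a small positive height,
  which has compact support in $V$ (\<open>truncated_energy_estimate\<close>).
\<close>

section \<open>Integration by parts for compactly supported functions\<close>

lemma integrable_continuous_compact_support:
  fixes f :: "'a::euclidean_space \<Rightarrow> 'b::{banach, second_countable_topology}"
  assumes "continuous_on UNIV f" "compact K" "\<And>x. x \<notin> K \<Longrightarrow> f x = 0"
  shows "integrable lborel f"
proof -
  have "integrable lborel (\<lambda>x. indicator K x *\<^sub>R f x)"
    by (rule borel_integrable_compact[OF assms(2)]) (use assms(1) continuous_on_subset in blast)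
  also have "(\<lambda>x. indicator K x *\<^sub>R f x) = f"
    using assms(3) by (auto simp: indicator_def)
  finally show ?thesis .
qed

lemma integral_translation:
  fixes f :: "'a::euclidean_space \<Rightarrow> 'b::{banach, second_countable_topology}"
  assumes "f \<in> borel_measurable borel"
  shows "(LINT x|lborel. f (x + h)) = (LINT x|lborel. f x)"
proof -
  have "(LINT x|lborel. f x) = integral\<^sup>L (distr lborel borel ((+) h)) f"
    by (simp add: lborel_distr_plus)
  also have "\<dots> = (LINT x|lborel. f (h + x))"
    by (rule integral_distr) (use assms in auto)
  finally show ?thesis by (simp add: add.commute)
qed

text \<open>The difference quotients $(H(x + tv) - H(x))/t$ have integral zero by translation invariance.
  They are dominated because $H$ is Lipschitz in the direction \<open>v\<close>, so their limit has integral zero too.\<close>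

lemma set_integral_derivative_compact_support:
  fixes H :: "'a::euclidean_space \<Rightarrow> 'b::{banach, second_countable_topology}"
  assumes G: "open G" and K: "compact K" "K \<subseteq> G" and H0: "\<And>x. x \<notin> K \<Longrightarrow> H x = 0"
    and dH: "\<And>x. x \<in> G \<Longrightarrow> (H has_derivative H' x) (at x)"
    and cont: "continuous_on G (\<lambda>x. H' x v)"
  shows "(LINT x:K|lborel. H' x v) = 0"
proof -
  define d where "d = (\<lambda>x. if x \<in> K then H' x v else 0)"
  have oK: "open (- K)" using K by (simp add: compact_imp_closed open_Compl)
  have zero: "(H has_derivative (\<lambda>_. 0)) (at x)" if "x \<notin> K" for x
    by (rule has_derivative_transform_within_open[of "\<lambda>_. 0" _ _ _ "- K"]) (use that H0 oK in auto)
  have der: "\<exists>L. (H has_derivative L) (at x) \<and> L v = d x" for x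
  proof (cases "x \<in> K")
    case True then show ?thesis using dH K by (auto simp: d_def)
  next
    case False then show ?thesis using zero[OF False] by (auto simp: d_def)
  qed
  have contH: "continuous_on UNIV H"
    using der by (metis UNIV_I continuous_at_imp_continuous_on has_derivative_continuous)
  have Hm: "H \<in> borel_measurable borel" using contH by (rule borel_measurable_continuous_onI)
  have vd: "((\<lambda>t. H (x + t *\<^sub>R v)) has_vector_derivative d (x + t *\<^sub>R v)) (at t)" for x t
  proof -
    obtain L where L: "(H has_derivative L) (at (x + t *\<^sub>R v))" "L v = d (x + t *\<^sub>R v)"
      using der by blast
    have "((\<lambda>t. x + t *\<^sub>R v) has_derivative (\<lambda>h. h *\<^sub>R v)) (at t)"
      by (auto intro!: derivative_eq_intros)
    from has_derivative_compose[OF this L(1)]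
    show ?thesis unfolding has_vector_derivative_def L(2)[symmetric]
      by (simp add: linear_cmul[OF has_derivative_linear[OF L(1)]])
  qed
  have "compact ((\<lambda>x. H' x v) ` K)"
    by (rule compact_continuous_image[OF continuous_on_subset[OF cont K(2)] K(1)])
  then obtain B where B: "B > 0" "\<And>x. x \<in> K \<Longrightarrow> norm (H' x v) \<le> B"
    using compact_imp_bounded bounded_pos by (metis (no_types, lifting) imageI)
  have dB: "norm (d x) \<le> B" for x using B by (auto simp: d_def)
  obtain R where R: "\<And>x. x \<in> K \<Longrightarrow> norm x \<le> R"
    using K(1) compact_imp_bounded bounded_iff by metis
  have lip: "norm (H (x + t *\<^sub>R v) - H x) \<le> B * \<bar>t\<bar>" for x t
  proof -
    have "norm (H (x + t *\<^sub>R v) - H (x + 0 *\<^sub>R v)) \<le> B * norm (t - 0)"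
    proof (rule differentiable_bound[of UNIV])
      fix s show "((\<lambda>t. H (x + t *\<^sub>R v)) has_derivative (\<lambda>h. h *\<^sub>R d (x + s *\<^sub>R v))) (at s within UNIV)"
        using vd[of x s] by (simp add: has_vector_derivative_def)
      show "onorm (\<lambda>h. h *\<^sub>R d (x + s *\<^sub>R v)) \<le> B"
        by (rule onorm_le) (use mult_left_mono[OF dB[of "x + s *\<^sub>R v"] abs_ge_zero] in \<open>simp add: mult.commute\<close>)
    qed auto
    then show ?thesis by simp
  qed
  define e where "e = (\<lambda>n. 1 / real (Suc n))"
  have e: "e n > 0" "e n \<le> 1" for n by (auto simp: e_def)
  have e0: "filterlim e (at 0) sequentially"
  proof (rule filterlim_atI)
    show "e \<longlonglongrightarrow> 0" unfolding e_def by (rule lim_1_over_n[THEN LIMSEQ_Suc])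
  qed (use e(1) less_imp_neq in \<open>fastforce intro: always_eventually\<close>)
  define s where "s = (\<lambda>n x. (1 / e n) *\<^sub>R (H (x + e n *\<^sub>R v) - H x))"
  have sm: "s n \<in> borel_measurable lborel" for n
    unfolding s_def using Hm by measurable
  have lim: "(\<lambda>n. s n x) \<longlonglongrightarrow> d x" for x
  proof -
    have "((\<lambda>h. (1 / h) *\<^sub>R (H (x + h *\<^sub>R v) - H x)) \<longlongrightarrow> d x) (at 0)"
    proof -
      have "((\<lambda>h. norm (H (x + (0 + h) *\<^sub>R v) - H (x + 0 *\<^sub>R v) - h *\<^sub>R d (x + 0 *\<^sub>R v)) / norm h) \<longlongrightarrow> 0) (at 0)"
        using vd[of x 0] unfolding has_vector_derivative_def has_derivative_at by blast
      then have "((\<lambda>h. norm ((1 / h) *\<^sub>R (H (x + h *\<^sub>R v) - H x) - d x)) \<longlongrightarrow> 0) (at 0)"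
      proof (rule Lim_transform_eventually)
        show "\<forall>\<^sub>F h in at 0. norm (H (x + (0 + h) *\<^sub>R v) - H (x + 0 *\<^sub>R v) - h *\<^sub>R d (x + 0 *\<^sub>R v)) / norm h
          = norm ((1 / h) *\<^sub>R (H (x + h *\<^sub>R v) - H x) - d x)"
        proof (rule eventually_at_filter[THEN iffD2], rule always_eventually, safe)
          fix h :: real assume "h \<noteq> 0"
          have "norm ((1 / h) *\<^sub>R (H (x + h *\<^sub>R v) - H x) - d x)
            = norm ((1 / h) *\<^sub>R (H (x + h *\<^sub>R v) - H x - h *\<^sub>R d x))"
            using \<open>h \<noteq> 0\<close> by (simp add: algebra_simps)
          then show "norm (H (x + (0 + h) *\<^sub>R v) - H (x + 0 *\<^sub>R v) - h *\<^sub>R d (x + 0 *\<^sub>R v)) / norm h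
          = norm ((1 / h) *\<^sub>R (H (x + h *\<^sub>R v) - H x) - d x)" by simp
        qed
      qed
      then show ?thesis using tendsto_norm_zero_iff LIM_zero_iff by blast
    qed
    from filterlim_compose[OF this e0] show ?thesis by (simp add: s_def)
  qed
  have dm: "d \<in> borel_measurable lborel"
    by (rule borel_measurable_LIMSEQ_metric[OF sm lim])
  have "(\<lambda>n. integral\<^sup>L lborel (s n)) \<longlonglongrightarrow> integral\<^sup>L lborel d"
  proof (rule integral_dominated_convergence[where w="\<lambda>x. indicator (cball 0 (R + norm v)) x *\<^sub>R B"])
    show "integrable lborel (\<lambda>x::'a. indicator (cball 0 (R + norm v)) x *\<^sub>R B)"
      by (rule borel_integrable_compact) auto
    fix n
    have "norm (s n x) \<le> indicator (cball 0 (R + norm v)) x *\<^sub>R B" for x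
    proof (cases "norm x \<le> R + norm v")
      case True
      have "norm (s n x) \<le> (1 / e n) * (B * e n)"
        unfolding s_def norm_scaleR using lip[of x "e n"] e(1)[of n] by (intro mult_mono) auto
      then show ?thesis using True e(1)[of n] by simp
    next
      case False
      have "norm x \<le> norm (x + e n *\<^sub>R v) + norm (e n *\<^sub>R v)"
        by (metis add_diff_cancel_right' norm_triangle_ineq4)
      also have "norm (e n *\<^sub>R v) \<le> 1 * norm v"
        using e[of n] by (simp add: mult_left_le_one_le)
      finally have "\<not> norm (x + e n *\<^sub>R v) \<le> R" using False by auto
      then have "x + e n *\<^sub>R v \<notin> K" "x \<notin> K" using R False norm_ge_zero[of v] by fastforce+
      then show ?thesis using H0 False B by (simp add: s_def)
    qed
    then show "AE x in lborel. norm (s n x) \<le> indicator (cball 0 (R + norm v)) x *\<^sub>R B" by simp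
  qed (use sm dm lim in auto)
  moreover have "integral\<^sup>L lborel (s n) = 0" for n
  proof -
    have int: "integrable lborel H"
      by (rule integrable_continuous_compact_support[OF contH K(1) H0])
    have "integrable lborel (\<lambda>x. H (x + e n *\<^sub>R v))"
    proof (rule integrable_continuous_compact_support[where K="(\<lambda>x. x - e n *\<^sub>R v) ` K"])
      show "continuous_on UNIV (\<lambda>x. H (x + e n *\<^sub>R v))"
        by (rule continuous_on_compose2[OF contH]) (auto intro!: continuous_intros)
      show "compact ((\<lambda>x. x - e n *\<^sub>R v) ` K)" by (rule compact_continuous_image[OF _ K(1)]) (auto intro!: continuous_intros)
    qed (use H0 in \<open>force simp: image_iff algebra_simps\<close>)
    then show ?thesis unfolding s_def using int integral_translation[OF Hm, of "e n *\<^sub>R v"] by simp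
  qed
  ultimately have "integral\<^sup>L lborel d = 0" by (simp add: LIMSEQ_const_iff)
  moreover have "(\<lambda>x. indicator K x *\<^sub>R H' x v) = d" by (auto simp: d_def indicator_def)
  ultimately show ?thesis by (simp add: set_lebesgue_integral_def)
qed

section \<open>Radial solutions of the Helmholtz equation\<close>

text \<open>With $s = |x|^2$ this is the \<open>m\<close>-th derivative in \<open>s\<close> of the outgoing spherical wave
  $e^{ik|x|}/|x|$. The recursion is the radial equation $4 s g'' + (4m + 6) g' + k^2 g = 0$ of the \<open>m\<close>-th
  function $g$, solved for $g''$.\<close>

fun spherical_wave :: "real \<Rightarrow> nat \<Rightarrow> real \<Rightarrow> complex" where
  "spherical_wave k 0 s = exp (\<i> * of_real k * of_real (sqrt s)) / of_real (sqrt s)"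
| "spherical_wave k (Suc 0) s = exp (\<i> * of_real k * of_real (sqrt s)) *
     (\<i> * of_real k / (2 * of_real (sqrt s)^2) - 1 / (2 * of_real (sqrt s)^3))"
| "spherical_wave k (Suc (Suc m)) s =
     - ((4 * of_nat m + 6) * spherical_wave k (Suc m) s + of_real (k\<^sup>2) * spherical_wave k m s) / (4 * of_real s)"

lemma has_vector_derivative_of_sqrt:
  assumes "s > 0" "(E has_field_derivative E') (at (complex_of_real (sqrt s)))"
  shows "((\<lambda>s. E (complex_of_real (sqrt s))) has_vector_derivative of_real (1 / (2 * sqrt s)) * E') (at s)"
proof -
  have "((\<lambda>s. complex_of_real (sqrt s)) has_vector_derivative of_real (1 / (2 * sqrt s))) (at s)"
    by (rule has_vector_derivative_of_real)
       (use assms(1) in \<open>auto intro!: derivative_eq_intros simp: field_simps has_real_derivative_iff_has_vector_derivative[symmetric]\<close>)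
  from field_vector_diff_chain_at[OF this assms(2)] show ?thesis by (simp add: o_def)
qed

text \<open>Differentiating the radial equation of order \<open>m\<close> gives the one of order \<open>Suc m\<close>, so only
  the first two functions need a computation.\<close>

lemma spherical_wave_deriv:
  assumes "s > 0"
  shows "(spherical_wave k m has_vector_derivative spherical_wave k (Suc m) s) (at s)"
  using assms
proof (induction k m s rule: spherical_wave.induct)
  case (1 k s)
  have z: "complex_of_real (sqrt s) \<noteq> 0" using 1 by simp
  have E: "((\<lambda>z. exp (\<i> * of_real k * z) / z) has_field_derivative
     (exp (\<i> * of_real k * z) * (\<i> * of_real k) * z - exp (\<i> * of_real k * z)) / (z * z)) (at z)" if "z \<noteq> 0" for z
    using that by (auto intro!: derivative_eq_intros)
  have eq: "spherical_wave k 0 = (\<lambda>x. exp (\<i> * complex_of_real k * complex_of_real (sqrt x)) / complex_of_real (sqrt x))"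
    by (auto simp: fun_eq_iff)
  show ?case unfolding eq
    by (rule has_vector_derivative_eq_rhs[OF has_vector_derivative_of_sqrt[OF 1 E[OF z]]])
       (use z in \<open>simp add: field_simps power2_eq_square power3_eq_cube\<close>)
next
  case (2 k s)
  define z0 where "z0 = complex_of_real (sqrt s)"
  have z: "z0 \<noteq> 0" using 2 by (simp add: z0_def)
  have s: "complex_of_real s = z0 * z0" using 2 by (simp add: z0_def flip: of_real_mult)
  have E: "((\<lambda>z. exp (\<i> * of_real k * z) * (\<i> * of_real k / (2 * z^2) - 1 / (2 * z^3))) has_field_derivative
     (exp (\<i> * of_real k * z) * (\<i> * of_real k) * (\<i> * of_real k / (2 * z^2) - 1 / (2 * z^3))
     + exp (\<i> * of_real k * z) * (- \<i> * of_real k / z^3 + 3 / (2 * z^4)))) (at z)" if "z \<noteq> 0" for z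
  proof -
    have "((\<lambda>z. \<i> * of_real k / 2 * inverse z ^ 2 - inverse z ^ 3 / 2) has_field_derivative
        (- \<i> * of_real k / z^3 + 3 / (2 * z^4))) (at z)"
      using that by (auto intro!: derivative_eq_intros simp: field_simps power2_eq_square power3_eq_cube power4_eq_xxxx)
    then have d: "((\<lambda>z. \<i> * of_real k / (2 * z^2) - 1 / (2 * z^3)) has_field_derivative
        (- \<i> * of_real k / z^3 + 3 / (2 * z^4))) (at z)"
      by (simp add: field_simps)
    have "((\<lambda>z. exp (\<i> * of_real k * z)) has_field_derivative exp (\<i> * of_real k * z) * (\<i> * of_real k)) (at z)"
      by (auto intro!: derivative_eq_intros)
    from DERIV_mult'[OF this d] show ?thesis by (simp add: add.commute)
  qed
  have eq: "spherical_wave k (Suc 0) = (\<lambda>x. exp (\<i> * complex_of_real k * complex_of_real (sqrt x)) *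
      (\<i> * complex_of_real k / (2 * (complex_of_real (sqrt x))\<^sup>2) - 1 / (2 * complex_of_real (sqrt x) ^ 3)))"
    by (auto simp: fun_eq_iff)
  have r: "complex_of_real (1 / (2 * sqrt s)) = 1 / (2 * z0)" by (simp add: z0_def)
  show ?case unfolding eq
    apply (rule has_vector_derivative_eq_rhs[OF has_vector_derivative_of_sqrt[OF 2 E[OF z[unfolded z0_def]]]])
    unfolding spherical_wave.simps s r z0_def[symmetric]
    using z by (simp add: field_simps power2_eq_square power3_eq_cube power4_eq_xxxx)
next
  case (3 k m s)
  note IH = "3.IH"(1)[OF "3.prems"] "3.IH"(2)[OF "3.prems"]
  have inv: "((\<lambda>s. inverse (4 * complex_of_real s)) has_vector_derivative - (4 / (4 * of_real s)^2)) (at s)"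
  proof -
    have q: "((\<lambda>s. complex_of_real s) has_vector_derivative 1) (at s)"
      using has_vector_derivative_of_real[of "\<lambda>x. x" 1 "at s"] has_vector_derivative_id by simp
    have E: "((\<lambda>z. inverse (4 * z)) has_field_derivative - (4 / (4 * of_real s)^2)) (at (complex_of_real s))"
      using 3 by (auto intro!: derivative_eq_intros simp: field_simps power2_eq_square)
    from field_vector_diff_chain_at[OF q E] show ?thesis by (simp add: o_def)
  qed
  have eq: "spherical_wave k (Suc (Suc m)) = (\<lambda>s. ((- (4 * of_nat m + 6)) * spherical_wave k (Suc m) s
     + (- of_real (k\<^sup>2)) * spherical_wave k m s) * inverse (4 * complex_of_real s))"
    by (auto simp: fun_eq_iff field_simps)
  show ?case unfolding eq
    by (rule has_vector_derivative_eq_rhs[OF has_vector_derivative_mult[OF has_vector_derivative_add[OF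
        has_vector_derivative_mult_right[OF IH(1)] has_vector_derivative_mult_right[OF IH(2)]] inv]])
       (use 3 in \<open>simp add: field_simps power2_eq_square\<close>)
qed

text \<open>A derivative in \<open>s\<close> gains the factor $s^{-1/2}$ that it produces on $e^{ik\sqrt s}$.\<close>

lemma spherical_wave_bound:
  obtains C where "C > 0" "\<And>s. s \<ge> 1 \<Longrightarrow> norm (spherical_wave k m s) \<le> C * (1 / sqrt s) ^ (m + 1)"
proof -
  have "\<exists>C>0. \<forall>s\<ge>1. norm (spherical_wave k m s) \<le> C * (1 / sqrt s) ^ (m + 1)"
  proof (induction m rule: induct_nat_012)
    case 0
    show ?case by (intro exI[of _ 1]) (auto simp: norm_divide norm_mult)
  next
    case 1
    show ?case
    proof (intro exI[of _ "\<bar>k\<bar> + 1"] conjI allI impI)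
      fix s :: real assume s: "s \<ge> 1"
      define z where "z = sqrt s"
      have z: "z \<ge> 1" using s by (simp add: z_def)
      have "norm (spherical_wave k 1 s) = norm (\<i> * of_real k / (2 * of_real z^2) - 1 / (2 * of_real z^3))"
        by (simp add: norm_mult z_def norm_divide)
      also have "\<dots> \<le> \<bar>k\<bar> / (2 * z^2) + 1 / (2 * z^3)"
        by (rule order_trans[OF norm_triangle_ineq4]) (use z in \<open>simp add: norm_mult norm_divide norm_power\<close>)
      also have "\<dots> \<le> \<bar>k\<bar> / z^2 + 1 / z^2"
        using z by (intro add_mono divide_left_mono) (auto simp: power2_eq_square power3_eq_cube mult_le_cancel_left1 intro: order_trans[of _ "z*z"])
      also have "\<dots> = (\<bar>k\<bar> + 1) * (1 / z) ^ (1 + 1)"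
        by (simp add: power2_eq_square add_divide_distrib)
      finally show "norm (spherical_wave k (Suc 0) s) \<le> (\<bar>k\<bar> + 1) * (1 / sqrt s) ^ (Suc 0 + 1)"
        by (simp only: z_def One_nat_def)
    qed auto
  next
    case (ge2 n)
    then obtain C1 C2 where C: "C1 > 0" "C2 > 0"
      "\<And>s. s \<ge> 1 \<Longrightarrow> norm (spherical_wave k n s) \<le> C1 * (1 / sqrt s) ^ (n + 1)"
      "\<And>s. s \<ge> 1 \<Longrightarrow> norm (spherical_wave k (Suc n) s) \<le> C2 * (1 / sqrt s) ^ (n + 2)"
      by auto
    show ?case
    proof (intro exI[of _ "((4 * real n + 6) * C2 + k\<^sup>2 * C1)"] conjI allI impI)
      show "(4 * real n + 6) * C2 + k\<^sup>2 * C1 > 0" using C by (intro add_pos_nonneg) auto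
      fix s :: real assume s: "s \<ge> 1"
      define z where "z = sqrt s"
      have z: "z \<ge> 1" "s = z * z" using s by (simp_all add: z_def)
      have "norm (spherical_wave k (Suc (Suc n)) s) =
         norm ((4 * of_nat n + 6) * spherical_wave k (Suc n) s + of_real (k\<^sup>2) * spherical_wave k n s) / (4 * s)"
        using s by (simp only: spherical_wave.simps norm_minus_cancel norm_divide norm_mult norm_of_real norm_numeral abs_of_pos)
      also have "\<dots> \<le> ((4 * real n + 6) * norm (spherical_wave k (Suc n) s) + k\<^sup>2 * norm (spherical_wave k n s)) / (4 * s)"
      proof -
        have "norm (4 * of_nat n + 6 :: complex) = 4 * real n + 6"
          using norm_of_nat[of "4 * n + 6", where 'a=complex] by simp
        then show ?thesis using s
          by (intro divide_right_mono order_trans[OF norm_triangle_ineq]) (auto simp: norm_mult norm_power)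
      qed
      also have "\<dots> \<le> ((4 * real n + 6) * (C2 * (1 / z) ^ (n + 2)) + k\<^sup>2 * (C1 * (1 / z) ^ (n + 1))) / s"
        using C(3,4)[OF s] s by (intro frac_le add_mono mult_left_mono) (auto simp: z_def intro!: add_nonneg_nonneg mult_nonneg_nonneg divide_nonneg_nonneg less_imp_le[OF C(1)] less_imp_le[OF C(2)])
      also have "\<dots> \<le> ((4 * real n + 6) * (C2 * (1 / z) ^ (n + 1)) + k\<^sup>2 * (C1 * (1 / z) ^ (n + 1))) / s"
        using z C s by (intro divide_right_mono add_mono mult_left_mono power_decreasing) simp_all
      also have "\<dots> = ((4 * real n + 6) * C2 + k\<^sup>2 * C1) * (1 / z) ^ (Suc (Suc n) + 1)"
        using z by (simp add: field_simps)
      finally show "norm (spherical_wave k (Suc (Suc n)) s) \<le> ((4 * real n + 6) * C2 + k\<^sup>2 * C1) * (1 / sqrt s) ^ (Suc (Suc n) + 1)"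
        by (simp add: z_def)
    qed
  qed
  then show ?thesis using that by blast
qed

text \<open>By the recursion the Wronskian of order \<open>Suc m\<close> is $k^2/(4s)$ times the one of order \<open>m\<close>.
  This reduces the claim to $e^{ikr}/r$ with $r = \sqrt s$, where the Wronskian is $ik/r^3$.\<close>

lemma spherical_wave_wronskian:
  assumes "k > 0" "s > 0"
  shows "cnj (spherical_wave k m s) * spherical_wave k (Suc m) s
    - spherical_wave k m s * cnj (spherical_wave k (Suc m) s) \<noteq> 0"
proof (induction m)
  case 0
  define z where "z = complex_of_real (sqrt s)"
  have z: "z \<noteq> 0" "cnj z = z" using assms by (auto simp: z_def)
  have e: "cnj (exp (\<i> * of_real k * z)) * exp (\<i> * of_real k * z) = 1"
    by (simp add: exp_cnj z_def mult_exp_exp)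
  have "cnj (spherical_wave k 0 s) * spherical_wave k (Suc 0) s
    - spherical_wave k 0 s * cnj (spherical_wave k (Suc 0) s)
    = (cnj (exp (\<i> * of_real k * z)) * exp (\<i> * of_real k * z)) * (\<i> * of_real k / z ^ 3)"
    unfolding spherical_wave.simps z_def[symmetric]
    using z by (simp add: field_simps power2_eq_square power3_eq_cube)
  then show ?case unfolding e using assms z by simp
next
  case (Suc m)
  let ?w = "cnj (spherical_wave k m s) * spherical_wave k (Suc m) s
    - spherical_wave k m s * cnj (spherical_wave k (Suc m) s)"
  have "cnj (spherical_wave k (Suc m) s) * spherical_wave k (Suc (Suc m)) s
    - spherical_wave k (Suc m) s * cnj (spherical_wave k (Suc (Suc m)) s) = of_real (k\<^sup>2 / (4 * s)) * ?w"
    using assms by (simp add: field_simps)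
  then show ?case using Suc assms by simp
qed

lemma antiderivative_compact_support:
  fixes \<eta> :: "real \<Rightarrow> 'b::banach"
  assumes cont: "continuous_on UNIV \<eta>" and supp: "\<And>s. s \<notin> {l..u} \<Longrightarrow> \<eta> s = 0"
  obtains \<alpha> where "\<And>s. (\<alpha> has_vector_derivative \<eta> s) (at s)" "\<And>s. s \<le> l \<Longrightarrow> \<alpha> s = 0"
    "\<And>s. s \<ge> u \<Longrightarrow> \<alpha> s = \<alpha> u"
proof
  define \<alpha> where "\<alpha> = (\<lambda>s. integral {l - 1..s} \<eta>)"
  show *: "\<alpha> s = 0" if "s \<le> l" for s
  proof -
    have "integral {l - 1..s} \<eta> = integral {l - 1..s} (\<lambda>_. 0)"
    proof (rule integral_spike[of "{l}"])
      fix x assume "x \<in> {l - 1..s} - {l}"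
      then show "0 = \<eta> x" using supp[of x] that by auto
    qed auto
    then show ?thesis by (simp add: \<alpha>_def)
  qed
  show der: "(\<alpha> has_vector_derivative \<eta> s) (at s)" for s
  proof (cases "s < l")
    case True
    have "((\<lambda>_. 0) has_vector_derivative 0) (at s)" by simp
    then have "(\<alpha> has_vector_derivative 0) (at s)"
      by (rule has_vector_derivative_transform_within_open[of _ _ _ "{..<l}"]) (use * True in auto)
    then show ?thesis using supp[of s] True by simp
  next
    case False
    have "((\<lambda>u. integral {l - 1..u} \<eta>) has_vector_derivative \<eta> s) (at s within {l - 1..s + 1})"
      by (rule integral_has_vector_derivative) (use cont continuous_on_subset False in \<open>blast, auto\<close>)
    then show ?thesis unfolding \<alpha>_def using False at_within_interior[of s "{l - 1..s + 1}"]
      by (simp add: interior_atLeastAtMost_real)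
  qed
  show "\<alpha> s = \<alpha> u" if "s \<ge> u" for s
  proof -
    have "(\<eta> has_integral \<alpha> s - \<alpha> u) {u..s}"
      by (rule fundamental_theorem_of_calculus[OF that])
         (use der has_vector_derivative_at_within in blast)
    moreover have "(\<eta> has_integral 0) {u..s}"
      by (rule has_integral_spike[where S = "{u}" and f = "\<lambda>_. 0"]) (use supp in auto)
    ultimately have "\<alpha> s - \<alpha> u = 0" by (rule has_integral_unique)
    then show ?thesis by simp
  qed
qed

text \<open>The fundamental system is \<open>spherical_wave k m\<close> and its complex conjugate. The coefficient
  functions \<open>\<alpha>\<close> and \<open>\<beta>\<close> are arbitrary antiderivatives; the constants of integration decide on which side
  of the support of \<open>\<psi>\<close> the solution vanishes.\<close>

lemma variation_of_parameters:
  fixes \<psi> \<alpha> \<beta> :: "real \<Rightarrow> complex" and m :: nat and k :: real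
  defines "g \<equiv> spherical_wave k m" and "g' \<equiv> spherical_wave k (Suc m)"
  defines "W \<equiv> \<lambda>s. cnj (g s) * g' s - g s * cnj (g' s)"
  assumes k: "k > 0" and cont: "continuous_on UNIV \<psi>"
    and \<alpha>: "\<And>s. s > 0 \<Longrightarrow> (\<alpha> has_vector_derivative \<psi> s * cnj (g s) / (4 * of_real s * W s)) (at s)"
    and \<beta>: "\<And>s. s > 0 \<Longrightarrow> (\<beta> has_vector_derivative \<psi> s * g s / (4 * of_real s * W s)) (at s)"
  obtains f2 where
    "\<And>s. s > 0 \<Longrightarrow> ((\<lambda>s. \<alpha> s * g s - \<beta> s * cnj (g s)) has_vector_derivative (\<alpha> s * g' s - \<beta> s * cnj (g' s))) (at s)"
    "\<And>s. s > 0 \<Longrightarrow> ((\<lambda>s. \<alpha> s * g' s - \<beta> s * cnj (g' s)) has_vector_derivative f2 s) (at s)"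
    "continuous_on {0<..} f2"
    "\<And>s. s > 0 \<Longrightarrow> 4 * of_real s * f2 s + (4 * of_nat m + 6) * (\<alpha> s * g' s - \<beta> s * cnj (g' s))
        + of_real (k\<^sup>2) * (\<alpha> s * g s - \<beta> s * cnj (g s)) = \<psi> s"
proof
  define f where "f = (\<lambda>s. \<alpha> s * g s - \<beta> s * cnj (g s))"
  define f1 where "f1 = (\<lambda>s. \<alpha> s * g' s - \<beta> s * cnj (g' s))"
  define f2 where "f2 = (\<lambda>s. (\<psi> s - (4 * of_nat m + 6) * f1 s - of_real (k\<^sup>2) * f s) / (4 * of_real s))"
  have W: "W s \<noteq> 0" if "s > 0" for s
    unfolding W_def g_def g'_def by (rule spherical_wave_wronskian[OF k that])
  define g2 where "g2 = spherical_wave k (Suc (Suc m))"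
  have g: "(g has_vector_derivative g' s) (at s)" "(g' has_vector_derivative g2 s) (at s)" if "s > 0" for s
    unfolding g_def g'_def g2_def by (rule spherical_wave_deriv[OF that])+
  note cg = g[THEN has_vector_derivative_cnj]
  have g2: "g2 s = - ((4 * of_nat m + 6) * g' s + of_real (k\<^sup>2) * g s) / (4 * of_real s)" for s
    by (simp add: g_def g'_def g2_def)
  have cg2: "cnj (g2 s) = - ((4 * of_nat m + 6) * cnj (g' s) + of_real (k\<^sup>2) * cnj (g s)) / (4 * of_real s)" for s
    unfolding g2 by simp
  show 1: "(f has_vector_derivative f1 s) (at s)" if s: "s > 0" for s
    unfolding f_def
    by (rule has_vector_derivative_eq_rhs[OF has_vector_derivative_diff[OF
         has_vector_derivative_mult[OF \<alpha>[OF s] g(1)[OF s]] has_vector_derivative_mult[OF \<beta>[OF s] cg(1)[OF s]]]])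
       (simp add: f1_def field_simps)
  show 2: "(f1 has_vector_derivative f2 s) (at s)" if s: "s > 0" for s
  proof -
    define Ws where "Ws = W s"
    have Ws: "Ws \<noteq> 0" using W[OF s] by (simp add: Ws_def)
    have "\<alpha> s * g2 s + \<psi> s * cnj (g s) / (4 * of_real s * Ws) * g' s -
      (\<beta> s * cnj (g2 s) + \<psi> s * g s / (4 * of_real s * Ws) * cnj (g' s))
      = (\<psi> s / (4 * of_real s)) * ((cnj (g s) * g' s - g s * cnj (g' s)) / Ws) + \<alpha> s * g2 s - \<beta> s * cnj (g2 s)"
      using s Ws by (simp add: field_simps)
    also have "(cnj (g s) * g' s - g s * cnj (g' s)) / Ws = 1" using Ws by (simp add: Ws_def W_def)
    also have "(\<psi> s / (4 * of_real s)) * 1 + \<alpha> s * g2 s - \<beta> s * cnj (g2 s) = f2 s"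
      unfolding g2 cg2 f2_def f1_def f_def using s by (simp add: field_simps)
    finally show ?thesis
      unfolding f1_def Ws_def
      by (intro has_vector_derivative_eq_rhs[OF has_vector_derivative_diff[OF
         has_vector_derivative_mult[OF \<alpha>[OF s] g(2)[OF s]] has_vector_derivative_mult[OF \<beta>[OF s] cg(2)[OF s]]]])
  qed
  show "continuous_on {0<..} f2"
  proof -
    have "continuous_on {0<..} f" "continuous_on {0<..} f1"
      using 1 2 by (meson continuous_at_imp_continuous_on greaterThan_iff has_vector_derivative_continuous)+
    then show ?thesis unfolding f2_def
      by (intro continuous_intros continuous_on_subset[OF cont]) auto
  qed
  show "4 * of_real s * f2 s + (4 * of_nat m + 6) * f1 s + of_real (k\<^sup>2) * f s = \<psi> s" if "s > 0" for s
    unfolding f2_def using that by (simp add: field_simps)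
qed

text \<open>Coefficient functions that vanish to the left of the support of \<open>\<psi>\<close> give a solution that vanishes
  there and is a free spherical wave on the right; this one serves near infinity. Coefficient functions that
  vanish to the right give a solution that vanishes there; this one serves in a ball.\<close>

lemma radial_equation_solution:
  fixes \<psi> :: "real \<Rightarrow> complex" and m :: nat
  assumes k: "k > 0" and cont: "continuous_on UNIV \<psi>" and l: "l > 0"
    and "\<forall>s. s \<notin> {l..u} \<longrightarrow> \<psi> s = 0"
  shows radial_equation_solution_left: "\<exists>f f1 f2 A B.
      (\<forall>s>0. (f has_vector_derivative f1 s) (at s)) \<and>
      (\<forall>s>0. (f1 has_vector_derivative f2 s) (at s)) \<and> continuous_on {0<..} f2 \<and>
      (\<forall>s>0. 4 * of_real s * f2 s + (4 * of_nat m + 6) * f1 s + of_real (k\<^sup>2) * f s = \<psi> s) \<and>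
      (\<forall>s\<le>l. f s = 0 \<and> f1 s = 0) \<and>
      (\<forall>s\<ge>u. f s = A * spherical_wave k m s - B * cnj (spherical_wave k m s) \<and>
        f1 s = A * spherical_wave k (Suc m) s - B * cnj (spherical_wave k (Suc m) s))"
    and radial_equation_solution_right: "\<exists>f f1 f2.
      (\<forall>s>0. (f has_vector_derivative f1 s) (at s)) \<and>
      (\<forall>s>0. (f1 has_vector_derivative f2 s) (at s)) \<and> continuous_on {0<..} f2 \<and>
      (\<forall>s>0. 4 * of_real s * f2 s + (4 * of_nat m + 6) * f1 s + of_real (k\<^sup>2) * f s = \<psi> s) \<and>
      (\<forall>s\<ge>u. f s = 0 \<and> f1 s = 0)"
proof -
  have supp: "\<And>s. s \<notin> {l..u} \<Longrightarrow> \<psi> s = 0" using assms(4) by blast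
  define g where "g = spherical_wave k m"
  define g' where "g' = spherical_wave k (Suc m)"
  define W where "W = (\<lambda>s. cnj (g s) * g' s - g s * cnj (g' s))"
  have cg: "continuous_on {0<..} g" "continuous_on {0<..} g'"
    unfolding g_def g'_def using spherical_wave_deriv
    by (meson continuous_at_imp_continuous_on greaterThan_iff has_vector_derivative_continuous)+
  have W: "W s \<noteq> 0" if "s > 0" for s
    unfolding W_def g_def g'_def by (rule spherical_wave_wronskian[OF k that])
  have cW: "continuous_on {0<..} W" unfolding W_def by (intro continuous_intros cg)
  have ext: "continuous_on UNIV (\<lambda>s. \<psi> s * h s / (4 * of_real s * W s))" if h: "continuous_on {0<..} h" for h
  proof -
    have "continuous_on ({0<..} \<union> {..<l}) (\<lambda>s. \<psi> s * h s / (4 * of_real s * W s))"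
    proof (rule continuous_on_open_Un)
      show "continuous_on {0<..} (\<lambda>s. \<psi> s * h s / (4 * of_real s * W s))"
        using W by (intro continuous_intros h cW continuous_on_subset[OF cont]) auto
      show "continuous_on {..<l} (\<lambda>s. \<psi> s * h s / (4 * of_real s * W s))"
        by (rule continuous_on_eq[of _ "\<lambda>_. 0"]) (use supp in auto)
    qed auto
    moreover have "{0<..} \<union> {..<l} = UNIV" using l by auto
    ultimately show ?thesis by simp
  qed
  obtain \<alpha> where \<alpha>: "\<And>s. (\<alpha> has_vector_derivative \<psi> s * cnj (g s) / (4 * of_real s * W s)) (at s)"
     "\<And>s. s \<le> l \<Longrightarrow> \<alpha> s = 0" "\<And>s. s \<ge> u \<Longrightarrow> \<alpha> s = \<alpha> u"
    by (rule antiderivative_compact_support[OF ext[of "\<lambda>s. cnj (g s)"], of l u]) (use supp cg in \<open>auto intro!: continuous_intros\<close>)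
  obtain \<beta> where \<beta>: "\<And>s. (\<beta> has_vector_derivative \<psi> s * g s / (4 * of_real s * W s)) (at s)"
     "\<And>s. s \<le> l \<Longrightarrow> \<beta> s = 0" "\<And>s. s \<ge> u \<Longrightarrow> \<beta> s = \<beta> u"
    by (rule antiderivative_compact_support[OF ext[of g], of l u]) (use supp cg in auto)
  define \<alpha>' where "\<alpha>' = (\<lambda>s. \<alpha> s - \<alpha> u)"
  define \<beta>' where "\<beta>' = (\<lambda>s. \<beta> s - \<beta> u)"
  have \<alpha>': "(\<alpha>' has_vector_derivative \<psi> s * cnj (g s) / (4 * of_real s * W s)) (at s)" for s
    unfolding \<alpha>'_def using has_vector_derivative_diff[OF \<alpha>(1) has_vector_derivative_const] by simp
  have \<beta>': "(\<beta>' has_vector_derivative \<psi> s * g s / (4 * of_real s * W s)) (at s)" for s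
    unfolding \<beta>'_def using has_vector_derivative_diff[OF \<beta>(1) has_vector_derivative_const] by simp
  note gen = variation_of_parameters[OF k cont, of _ m, folded g_def g'_def]
  obtain f2 where f2: "\<And>s. s > 0 \<Longrightarrow> ((\<lambda>s. \<alpha> s * g s - \<beta> s * cnj (g s)) has_vector_derivative (\<alpha> s * g' s - \<beta> s * cnj (g' s))) (at s)"
    "\<And>s. s > 0 \<Longrightarrow> ((\<lambda>s. \<alpha> s * g' s - \<beta> s * cnj (g' s)) has_vector_derivative f2 s) (at s)"
    "continuous_on {0<..} f2"
    "\<And>s. s > 0 \<Longrightarrow> 4 * of_real s * f2 s + (4 * of_nat m + 6) * (\<alpha> s * g' s - \<beta> s * cnj (g' s))
        + of_real (k\<^sup>2) * (\<alpha> s * g s - \<beta> s * cnj (g s)) = \<psi> s"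
    using gen[OF \<alpha>(1)[unfolded W_def] \<beta>(1)[unfolded W_def]] by blast
  obtain F2 where F2: "\<And>s. s > 0 \<Longrightarrow> ((\<lambda>s. \<alpha>' s * g s - \<beta>' s * cnj (g s)) has_vector_derivative (\<alpha>' s * g' s - \<beta>' s * cnj (g' s))) (at s)"
    "\<And>s. s > 0 \<Longrightarrow> ((\<lambda>s. \<alpha>' s * g' s - \<beta>' s * cnj (g' s)) has_vector_derivative F2 s) (at s)"
    "continuous_on {0<..} F2"
    "\<And>s. s > 0 \<Longrightarrow> 4 * of_real s * F2 s + (4 * of_nat m + 6) * (\<alpha>' s * g' s - \<beta>' s * cnj (g' s))
        + of_real (k\<^sup>2) * (\<alpha>' s * g s - \<beta>' s * cnj (g s)) = \<psi> s"
    using gen[OF \<alpha>'[unfolded W_def] \<beta>'[unfolded W_def]] by blast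
  have tail: "\<alpha>' s = 0" "\<beta>' s = 0" if "s \<ge> u" for s
    using \<alpha>(3)[OF that] \<beta>(3)[OF that] by (auto simp: \<alpha>'_def \<beta>'_def)
  show "\<exists>f f1 f2 A B.
      (\<forall>s>0. (f has_vector_derivative f1 s) (at s)) \<and>
      (\<forall>s>0. (f1 has_vector_derivative f2 s) (at s)) \<and> continuous_on {0<..} f2 \<and>
      (\<forall>s>0. 4 * of_real s * f2 s + (4 * of_nat m + 6) * f1 s + of_real (k\<^sup>2) * f s = \<psi> s) \<and>
      (\<forall>s\<le>l. f s = 0 \<and> f1 s = 0) \<and>
      (\<forall>s\<ge>u. f s = A * spherical_wave k m s - B * cnj (spherical_wave k m s) \<and>
        f1 s = A * spherical_wave k (Suc m) s - B * cnj (spherical_wave k (Suc m) s))"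
  proof (intro exI conjI allI impI)
    fix s assume "s \<le> l"
    then show "\<alpha> s * g s - \<beta> s * cnj (g s) = 0" "\<alpha> s * g' s - \<beta> s * cnj (g' s) = 0"
      using \<alpha>(2) \<beta>(2) by simp_all
  next
    fix s assume "s \<ge> u"
    then show "\<alpha> s * g s - \<beta> s * cnj (g s) = \<alpha> u * spherical_wave k m s - \<beta> u * cnj (spherical_wave k m s)"
      "\<alpha> s * g' s - \<beta> s * cnj (g' s) = \<alpha> u * spherical_wave k (Suc m) s - \<beta> u * cnj (spherical_wave k (Suc m) s)"
      using \<alpha>(3)[of s] \<beta>(3)[of s] by (simp_all only: g_def g'_def)
  qed (rule f2; assumption)+
  show "\<exists>f f1 f2.
      (\<forall>s>0. (f has_vector_derivative f1 s) (at s)) \<and>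
      (\<forall>s>0. (f1 has_vector_derivative f2 s) (at s)) \<and> continuous_on {0<..} f2 \<and>
      (\<forall>s>0. 4 * of_real s * f2 s + (4 * of_nat m + 6) * f1 s + of_real (k\<^sup>2) * f s = \<psi> s) \<and>
      (\<forall>s\<ge>u. f s = 0 \<and> f1 s = 0)"
  proof (intro exI conjI allI impI)
    fix s assume "s \<ge> u"
    then show "\<alpha>' s * g s - \<beta>' s * cnj (g s) = 0" "\<alpha>' s * g' s - \<beta>' s * cnj (g' s) = 0"
      using tail[of s] by simp_all
  qed (rule F2; assumption)+
qed

lemma has_real_derivative_positive_part_power:
  fixes t :: real and n :: nat
  shows "((\<lambda>t. max 0 t ^ (n + 2)) has_real_derivative real (n + 2) * max 0 t ^ (n + 1)) (at t)"
proof (cases "t = 0")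
  case True
  have "((\<lambda>h. max 0 h ^ (n + 2) / h) \<longlongrightarrow> 0) (at (0::real))"
  proof (rule Lim_null_comparison)
    show "\<forall>\<^sub>F h in at 0. norm (max 0 h ^ (n + 2) / h) \<le> \<bar>h\<bar> ^ (n + 1)"
    proof (rule eventually_at_filter[THEN iffD2], rule always_eventually, safe)
      fix h :: real assume "h \<noteq> 0"
      then show "norm (max 0 h ^ (n + 2) / h) \<le> \<bar>h\<bar> ^ (n + 1)"
      proof (cases "h > 0")
        case False
        then have "max 0 h ^ (n + 2) / h = 0" by simp
        then show ?thesis by (metis abs_ge_zero norm_zero zero_le_power)
      qed simp
    qed
    show "((\<lambda>h. \<bar>h\<bar> ^ (n + 1)) \<longlongrightarrow> 0) (at (0::real))"
      by (rule tendsto_eq_intros | simp)+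
  qed
  then show ?thesis unfolding True DERIV_def by simp
next
  case False
  then consider "t > 0" | "t < 0" by linarith
  then show ?thesis
  proof cases
    case 1
    have "((\<lambda>t. t ^ (n + 2)) has_real_derivative real (n + 2) * t ^ (n + 1)) (at t)"
      using DERIV_pow[of "n + 2" t UNIV] by simp
    then have "((\<lambda>t. max 0 t ^ (n + 2)) has_real_derivative real (n + 2) * t ^ (n + 1)) (at t)"
      by (rule has_field_derivative_transform_within_open[of _ _ _ "{0<..}"]) (use 1 in auto)
    then show ?thesis using 1 by simp
  next
    case 2
    have "((\<lambda>t. 0) has_real_derivative 0) (at t)" by simp
    then have "((\<lambda>t. max 0 t ^ (n + 2)) has_real_derivative 0) (at t)"
      by (rule has_field_derivative_transform_within_open[of _ _ _ "{..<0}"]) (use 2 in auto)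
    then show ?thesis using 2 by simp
  qed
qed

text \<open>The third difference of $t_+^3/6$, where $t_+$ is the positive part, is a spline of this kind. Its
  derivatives are the third differences of $t_+^2/2$ and of $t_+$.\<close>

lemma C2_cutoff:
  obtains \<theta> \<theta>1 \<theta>2 :: "real \<Rightarrow> real" and B where
    "\<And>t. (\<theta> has_real_derivative \<theta>1 t) (at t)" "\<And>t. (\<theta>1 has_real_derivative \<theta>2 t) (at t)"
    "continuous_on UNIV \<theta>2" "\<And>t. t \<le> 0 \<Longrightarrow> \<theta> t = 0" "\<And>t. t \<ge> 3 \<Longrightarrow> \<theta> t = 1"
    "\<And>t. t \<notin> {0..3} \<Longrightarrow> \<theta>1 t = 0" "\<And>t. t \<notin> {0..3} \<Longrightarrow> \<theta>2 t = 0"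
    "\<And>t. \<bar>\<theta>1 t\<bar> \<le> B" "\<And>t. \<bar>\<theta>2 t\<bar> \<le> B"
proof -
  define p where "p = (\<lambda>n (t::real). max 0 t ^ n)"
  define D where "D = (\<lambda>n t. p n t - 3 * p n (t - 1) + 3 * p n (t - 2) - p n (t - 3))"
  have p: "(p (n + 2) has_real_derivative real (n + 2) * p (n + 1) t) (at t)" for n :: nat and t :: real
    unfolding p_def using has_real_derivative_positive_part_power[where n = n and t = t] by simp
  have pc: "((\<lambda>t. p (n + 2) (t - c)) has_real_derivative real (n + 2) * p (n + 1) (t - c)) (at t)" for n :: nat and t c :: real
  proof -
    have "((\<lambda>t. t - c) has_real_derivative 1) (at t)" by (auto intro!: derivative_eq_intros)
    from DERIV_chain2[OF p this, of n] show ?thesis by simp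
  qed
  have D: "(D (n + 2) has_real_derivative real (n + 2) * D (n + 1) t) (at t)" for n :: nat and t :: real
    unfolding D_def by (rule derivative_eq_intros p pc refl)+ (simp add: algebra_simps)
  have cD: "continuous_on UNIV (D n)" for n unfolding D_def p_def by (intro continuous_intros)
  have D0: "D (n + 1) t = 0" if "t \<le> 0" for n t using that by (simp add: D_def p_def)
  have D3: "D 3 t = 6" "D 2 t = 0" "D 1 t = 0" if "t \<ge> 3" for t
    using that by (simp_all add: D_def p_def power3_eq_cube power2_eq_square algebra_simps)
  have z: "D 2 t = 0" "D 1 t = 0" if "t \<notin> {0..3}" for t
    using that D0[of t 0] D0[of t 1] D3[of t] by (force simp: numeral_2_eq_2)+
  have bdd: "\<exists>B. \<forall>t. \<bar>D n t\<bar> \<le> B" if "\<And>t. t \<notin> {0..3} \<Longrightarrow> D n t = 0" for n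
  proof -
    have "compact (D n ` {0..3})"
      by (rule compact_continuous_image[OF continuous_on_subset[OF cD]]) auto
    then obtain B where "B > 0" "\<And>t. t \<in> {0..3} \<Longrightarrow> \<bar>D n t\<bar> \<le> B"
      using compact_imp_bounded bounded_pos by (metis imageI real_norm_def)
    then show ?thesis using that by (metis abs_zero less_imp_le)
  qed
  obtain B1 B2 where B: "\<And>t. \<bar>D 2 t\<bar> \<le> B1" "\<And>t. \<bar>D 1 t\<bar> \<le> B2"
    using bdd[OF z(1)] bdd[OF z(2)] by blast
  show ?thesis
  proof (rule that[of "\<lambda>t. D 3 t / 6" "\<lambda>t. D 2 t / 2" "\<lambda>t. D 1 t" "max B1 B2"])
    fix t
    show "((\<lambda>t. D 3 t / 6) has_real_derivative D 2 t / 2) (at t)"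
      using DERIV_cdivide[OF D[of 1 t], of 6] by (simp add: numeral_eq_Suc)
    show "((\<lambda>t. D 2 t / 2) has_real_derivative D 1 t) (at t)"
      using DERIV_cdivide[OF D[of 0 t], of 2] by (simp add: numeral_eq_Suc)
    show "\<bar>D 2 t / 2\<bar> \<le> max B1 B2" "\<bar>D 1 t\<bar> \<le> max B1 B2"
      using B(1)[of t] B(2)[of t] by (auto simp: le_max_iff_disj)
  next
    fix t :: real assume "t \<le> 0"
    then show "D 3 t / 6 = 0" using D0[of t 2] by (simp add: numeral_eq_Suc)
  qed (use cD z D3 in auto)
qed

section \<open>The weak equation and moments over spherical shells\<close>

lemma Ck_on_2:
  assumes "Ck_on 2 G w" "x \<in> G"
  shows "(w has_derivative frechet_derivative w (at x)) (at x)"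
    "((\<lambda>y. frechet_derivative w (at y) b) has_derivative
        frechet_derivative (\<lambda>y. frechet_derivative w (at y) b) (at x)) (at x)"
  using assms by (auto simp: numeral_2_eq_2 frechet_derivative_works)

lemma Ck_on_2_continuous:
  assumes "Ck_on 2 G w"
  shows "continuous_on G w" "continuous_on G (\<lambda>x. frechet_derivative w (at x) b)"
    "continuous_on G (\<lambda>x. frechet_derivative (\<lambda>y. frechet_derivative w (at y) b) (at x) v)"
proof -
  show "continuous_on G w" "continuous_on G (\<lambda>x. frechet_derivative w (at x) b)"
    using Ck_on_2[OF assms] by (meson continuous_at_imp_continuous_on has_derivative_continuous)+
  show "continuous_on G (\<lambda>x. frechet_derivative (\<lambda>y. frechet_derivative w (at y) b) (at x) v)"
    using assms by (simp add: numeral_2_eq_2)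
qed

text \<open>Green's identity, one coordinate at a time: the derivative of
  $\Phi\,\partial_b w - w\,\partial_b \Phi$ in the direction \<open>b\<close> integrates to zero.\<close>

lemma Helmholtz_weak:
  fixes w \<Phi> :: "'a::euclidean_space \<Rightarrow> complex"
  assumes G: "open G" "Ck_on 2 G w" and eq: "\<And>x. x \<in> G \<Longrightarrow> laplacian w x + c * w x = 0"
    and K: "compact K" "K \<subseteq> G"
    and \<Phi>: "\<And>x. x \<in> G \<Longrightarrow> (\<Phi> has_derivative \<Phi>1 x) (at x)"
      "\<And>x b. x \<in> G \<Longrightarrow> b \<in> Basis \<Longrightarrow> ((\<lambda>x. \<Phi>1 x b) has_derivative \<Phi>2 b x) (at x)"
      "\<And>b. b \<in> Basis \<Longrightarrow> continuous_on G (\<lambda>x. \<Phi>2 b x b)"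
    and supp: "\<And>x. x \<notin> K \<Longrightarrow> \<Phi> x = 0" "\<And>x b. x \<notin> K \<Longrightarrow> b \<in> Basis \<Longrightarrow> \<Phi>1 x b = 0"
  shows "(LINT x:K|lborel. w x * ((\<Sum>b\<in>Basis. \<Phi>2 b x b) + c * \<Phi> x)) = 0"
proof -
  define dw where "dw = (\<lambda>x. frechet_derivative w (at x))"
  define ddw where "ddw = (\<lambda>b x. frechet_derivative (\<lambda>y. dw y b) (at x))"
  have dw: "(w has_derivative dw x) (at x)" "((\<lambda>y. dw y b) has_derivative ddw b x) (at x)" if "x \<in> G" for x b
    using Ck_on_2[OF G(2) that] by (simp_all add: dw_def ddw_def)
  have cw: "continuous_on G w" "continuous_on G (\<lambda>x. dw x b)" "continuous_on G (\<lambda>x. ddw b x v)" for b v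
    using Ck_on_2_continuous[OF G(2)] by (simp_all add: dw_def ddw_def)
  have c\<Phi>: "continuous_on G \<Phi>" using \<Phi>(1) by (meson continuous_at_imp_continuous_on has_derivative_continuous)
  have c\<Phi>1: "continuous_on G (\<lambda>x. \<Phi>1 x b)" if "b \<in> Basis" for b
    using \<Phi>(2)[OF _ that] by (meson continuous_at_imp_continuous_on has_derivative_continuous)
  define I where "I = (\<lambda>b x. ddw b x b * \<Phi> x - w x * \<Phi>2 b x b)"
  have cI: "continuous_on G (I b)" if "b \<in> Basis" for b
    unfolding I_def by (intro continuous_intros cw c\<Phi> \<Phi>(3)[OF that])
  have int: "set_integrable lborel K (I b)" if "b \<in> Basis" for b
    unfolding set_integrable_def by (rule borel_integrable_compact[OF K(1) continuous_on_subset[OF cI[OF that] K(2)]])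
  have zero: "(LINT x:K|lborel. I b x) = 0" if b: "b \<in> Basis" for b
  proof -
    define H' where "H' = (\<lambda>x v. ddw b x v * \<Phi> x + dw x b * \<Phi>1 x v - (dw x v * \<Phi>1 x b + w x * \<Phi>2 b x v))"
    have eqH: "(\<lambda>x. H' x b) = I b" by (auto simp: H'_def I_def algebra_simps)
    have "(LINT x:K|lborel. H' x b) = 0"
    proof (rule set_integral_derivative_compact_support[OF G(1) K])
      show "dw x b * \<Phi> x - w x * \<Phi>1 x b = 0" if "x \<notin> K" for x using supp[OF that] b by simp
      show "((\<lambda>x. dw x b * \<Phi> x - w x * \<Phi>1 x b) has_derivative H' x) (at x)" if x: "x \<in> G" for x
        unfolding H'_def using dw[OF x] \<Phi>(1)[OF x] \<Phi>(2)[OF x b]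
        by (auto intro!: derivative_eq_intros simp: fun_eq_iff algebra_simps)
      show "continuous_on G (\<lambda>x. H' x b)" unfolding eqH by (rule cI[OF b])
    qed
    then show ?thesis by (simp add: eqH)
  qed
  have "(LINT x:K|lborel. w x * ((\<Sum>b\<in>Basis. \<Phi>2 b x b) + c * \<Phi> x)) = (LINT x:K|lborel. - (\<Sum>b\<in>Basis. I b x))"
  proof (rule set_lebesgue_integral_cong)
    show "\<forall>x. x \<in> K \<longrightarrow> w x * ((\<Sum>b\<in>Basis. \<Phi>2 b x b) + c * \<Phi> x) = - (\<Sum>b\<in>Basis. I b x)"
    proof safe
      fix x assume "x \<in> K"
      then have "x \<in> G" using K by auto
      have lap: "(\<Sum>b\<in>Basis. ddw b x b) = - c * w x"
        using eq[OF \<open>x \<in> G\<close>] by (simp add: laplacian_def ddw_def dw_def add_eq_0_iff)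
      have T: "(\<Sum>b\<in>Basis. I b x) = (\<Sum>b\<in>Basis. ddw b x b) * \<Phi> x - w x * (\<Sum>b\<in>Basis. \<Phi>2 b x b)"
        by (simp add: I_def sum_subtractf sum_distrib_left sum_distrib_right)
      show "w x * ((\<Sum>b\<in>Basis. \<Phi>2 b x b) + c * \<Phi> x) = - (\<Sum>b\<in>Basis. I b x)"
        unfolding T lap by (simp add: algebra_simps)
    qed
  qed (use K in \<open>simp add: borel_compact\<close>)
  also have "\<dots> = - (\<Sum>b\<in>Basis. LINT x:K|lborel. I b x)"
  proof -
    have "(\<lambda>x. indicat_real K x *\<^sub>R - (\<Sum>b\<in>Basis. I b x)) = (\<lambda>x. - (\<Sum>b\<in>Basis. indicat_real K x *\<^sub>R I b x))"
      by (simp only: scaleR_sum_right scaleR_minus_right)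
    moreover have "(LINT x|lborel. (\<Sum>b\<in>Basis. indicat_real K x *\<^sub>R I b x)) = (\<Sum>b\<in>Basis. LINT x|lborel. indicat_real K x *\<^sub>R I b x)"
      by (rule Bochner_Integration.integral_sum) (rule int[unfolded set_integrable_def])
    ultimately show ?thesis unfolding set_lebesgue_integral_def by (simp only: integral_minus)
  qed
  finally show ?thesis using zero by simp
qed

lemma compact_shell:
  fixes c :: "'a::euclidean_space"
  shows "compact {x. (x - c) \<bullet> (x - c) \<in> {l..u}}" (is "compact ?K")
proof -
  have "closed ?K"
    by (simp only: atLeastAtMost_iff) (intro closed_Collect_conj closed_Collect_le continuous_intros)
  moreover have "?K \<subseteq> cball c (sqrt u)"
  proof
    fix x assume "x \<in> ?K"
    then have "(norm (x - c))\<^sup>2 \<le> u" by (simp add: power2_norm_eq_inner)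
    then show "x \<in> cball c (sqrt u)"
      by (simp add: dist_norm norm_minus_commute real_le_rsqrt)
  qed
  ultimately show ?thesis
    using compact_eq_bounded_closed bounded_subset bounded_cball by blast
qed

text \<open>The function $\Phi = P^m F(S)$ with $P = a \cdot (x - c)$ and $S = |x - c|^2$ satisfies, in dimension $n$,
  $\triangle\Phi = m(m-1)|a|^2 P^{m-2} F(S) + P^m (4 S F''(S) + (4m + 2n) F'(S))$. For $m < 2$ the factor
  $m(m-1)$ annihilates the term with the truncated exponent \<open>m - 2\<close>.\<close>

lemma radial_moment_identity:
  fixes w :: "'a::euclidean_space \<Rightarrow> complex" and F :: "real \<Rightarrow> complex" and a c :: 'a
  assumes G: "open G" "Ck_on 2 G w" and eq: "\<And>x. x \<in> G \<Longrightarrow> laplacian w x + \<kappa> * w x = 0"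
    and F: "\<And>s. (F has_vector_derivative F1 s) (at s)" "\<And>s. (F1 has_vector_derivative F2 s) (at s)"
      "continuous_on UNIV F2"
    and supp: "\<And>s. s \<notin> {l..u} \<Longrightarrow> F s = 0" "\<And>s. s \<notin> {l..u} \<Longrightarrow> F1 s = 0"
    and K: "K = {x. (x - c) \<bullet> (x - c) \<in> {l..u}}" "K \<subseteq> G"
  defines "S \<equiv> \<lambda>x. (x - c) \<bullet> (x - c)" and "P \<equiv> \<lambda>x. a \<bullet> (x - c)"
  shows "(LINT x:K|lborel. w x * (of_real (real (m * (m - 1)) * (a \<bullet> a) * P x ^ (m - 2)) * F (S x) +
    of_real (P x ^ m) * (4 * of_real (S x) * F2 (S x) + of_nat (4 * m + 2 * DIM('a)) * F1 (S x) + \<kappa> * F (S x)))) = 0"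
proof -
  have compK: "compact K" unfolding K(1) by (rule compact_shell)
  have FS: "((\<lambda>x. F (S x)) has_derivative (\<lambda>v. (2 * ((x - c) \<bullet> v)) *\<^sub>R F1 (S x))) (at x)"
    "((\<lambda>x. F1 (S x)) has_derivative (\<lambda>v. (2 * ((x - c) \<bullet> v)) *\<^sub>R F2 (S x))) (at x)" for x
  proof -
    have d: "(S has_derivative (\<lambda>v. 2 * ((x - c) \<bullet> v))) (at x)"
      unfolding S_def by (auto intro!: derivative_eq_intros simp: inner_commute)
    show "((\<lambda>x. F (S x)) has_derivative (\<lambda>v. (2 * ((x - c) \<bullet> v)) *\<^sub>R F1 (S x))) (at x)"
      using has_derivative_compose[OF d F(1)[of "S x", unfolded has_vector_derivative_def]] by simp
    show "((\<lambda>x. F1 (S x)) has_derivative (\<lambda>v. (2 * ((x - c) \<bullet> v)) *\<^sub>R F2 (S x))) (at x)"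
      using has_derivative_compose[OF d F(2)[of "S x", unfolded has_vector_derivative_def]] by simp
  qed
  have dP: "(P has_derivative (\<bullet>) a) (at x)" for x
    unfolding P_def by (rule derivative_eq_intros refl | simp)+
  define \<Phi> where "\<Phi> = (\<lambda>x. (P x ^ m) *\<^sub>R F (S x))"
  define \<Phi>1 where "\<Phi>1 = (\<lambda>x v. (real m * P x ^ (m - 1) * (a \<bullet> v)) *\<^sub>R F (S x)
     + (P x ^ m * (2 * ((x - c) \<bullet> v))) *\<^sub>R F1 (S x))"
  define \<Phi>2 where "\<Phi>2 = (\<lambda>b x v. (real m * (real (m - 1) * P x ^ (m - 1 - 1) * (a \<bullet> v)) * (a \<bullet> b)) *\<^sub>R F (S x)
     + (real m * P x ^ (m - 1) * (a \<bullet> b)) *\<^sub>R ((2 * ((x - c) \<bullet> v)) *\<^sub>R F1 (S x))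
     + ((real m * P x ^ (m - 1) * (a \<bullet> v)) * (2 * ((x - c) \<bullet> b)) + P x ^ m * (2 * (v \<bullet> b))) *\<^sub>R F1 (S x)
     + (P x ^ m * (2 * ((x - c) \<bullet> b))) *\<^sub>R ((2 * ((x - c) \<bullet> v)) *\<^sub>R F2 (S x)))"
  have "(LINT x:K|lborel. w x * ((\<Sum>b\<in>Basis. \<Phi>2 b x b) + \<kappa> * \<Phi> x)) = 0"
  proof -
    have 1: "(\<Phi> has_derivative \<Phi>1 x) (at x)" for x
      unfolding \<Phi>_def \<Phi>1_def by (auto intro!: derivative_eq_intros dP FS simp: fun_eq_iff algebra_simps)
    have 2: "((\<lambda>x. \<Phi>1 x b) has_derivative \<Phi>2 b x) (at x)" for x b
      unfolding \<Phi>1_def \<Phi>2_def by (auto intro!: derivative_eq_intros dP FS simp: fun_eq_iff algebra_simps)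
    have cF: "continuous_on UNIV F" "continuous_on UNIV F1"
      using F(1,2) by (meson continuous_at_imp_continuous_on has_vector_derivative_continuous)+
    have cS: "continuous_on G S" unfolding S_def by (intro continuous_intros)
    have cP: "continuous_on G P" unfolding P_def by (intro continuous_intros)
    have 3: "continuous_on G (\<lambda>x. \<Phi>2 b x b)" for b
      unfolding \<Phi>2_def
      by (intro continuous_intros cP continuous_on_compose2[OF cF(1) cS] continuous_on_compose2[OF cF(2) cS] continuous_on_compose2[OF F(3) cS] subset_UNIV)
    have 4: "\<Phi> x = 0" "\<Phi>1 x b = 0" if "x \<notin> K" for x b
    proof -
      have "S x \<notin> {l..u}" using that unfolding K(1) S_def by simp
      then show "\<Phi> x = 0" "\<Phi>1 x b = 0" using supp by (simp_all add: \<Phi>_def \<Phi>1_def)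
    qed
    show ?thesis by (rule Helmholtz_weak[OF G eq compK K(2) 1 2 3 4])
  qed
  moreover have "(\<Sum>b\<in>Basis. \<Phi>2 b x b) + \<kappa> * \<Phi> x =
     of_real (real (m * (m - 1)) * (a \<bullet> a) * P x ^ (m - 2)) * F (S x) +
    of_real (P x ^ m) * (4 * of_real (S x) * F2 (S x) + of_nat (4 * m + 2 * DIM('a)) * F1 (S x) + \<kappa> * F (S x))" for x
  proof -
    have s1: "(\<Sum>b\<in>Basis. (a \<bullet> b) * (a \<bullet> b)) = a \<bullet> a" "(\<Sum>b\<in>Basis. (a \<bullet> b) * ((x - c) \<bullet> b)) = P x"
      "(\<Sum>b\<in>Basis. ((x - c) \<bullet> b) * ((x - c) \<bullet> b)) = S x"
      unfolding S_def P_def by (simp_all only: euclidean_inner[symmetric])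
    have s2: "(\<Sum>b\<in>(Basis::'a set). b \<bullet> b) = real DIM('a)" by simp
    have "(\<Sum>b\<in>Basis. \<Phi>2 b x b) =
       (\<Sum>b\<in>Basis. (real m * real (m - 1) * P x ^ (m - 1 - 1) * ((a \<bullet> b) * (a \<bullet> b))) *\<^sub>R F (S x)
       + (4 * real m * P x ^ (m - 1) * ((a \<bullet> b) * ((x - c) \<bullet> b))) *\<^sub>R F1 (S x)
       + (2 * P x ^ m * (b \<bullet> b)) *\<^sub>R F1 (S x)
       + (4 * P x ^ m * (((x - c) \<bullet> b) * ((x - c) \<bullet> b))) *\<^sub>R F2 (S x))"
      unfolding \<Phi>2_def by (rule sum.cong) (simp_all add: algebra_simps flip: scaleR_add_left)
    also have "\<dots> = (real m * real (m - 1) * P x ^ (m - 1 - 1) * (a \<bullet> a)) *\<^sub>R F (S x)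
       + (4 * real m * P x ^ (m - 1) * P x) *\<^sub>R F1 (S x)
       + (2 * P x ^ m * real DIM('a)) *\<^sub>R F1 (S x)
       + (4 * P x ^ m * S x) *\<^sub>R F2 (S x)"
      by (simp only: sum.distrib scaleR_sum_left[symmetric] sum_distrib_left[symmetric] s1 s2)
    also have "(4 * real m * P x ^ (m - 1) * P x) = 4 * real m * P x ^ m"
      by (cases m) auto
    finally show ?thesis
      unfolding \<Phi>_def scaleR_conv_of_real diff_diff_left one_add_one by (cases m) (simp_all add: algebra_simps)
  qed
  ultimately show ?thesis by simp
qed

text \<open>These moments take the place of the expansion of \<open>w\<close> in spherical harmonics on the spheres around
  \<open>c\<close>.\<close>

definition radial_moment :: "('a::euclidean_space \<Rightarrow> complex) \<Rightarrow> 'a \<Rightarrow> 'a \<Rightarrow> nat \<Rightarrow> (real \<Rightarrow> complex) \<Rightarrow> complex" where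
  "radial_moment w c a m \<psi> =
     (LINT x|lborel. w x * of_real ((a \<bullet> (x - c)) ^ m) * \<psi> ((x - c) \<bullet> (x - c)))"

lemma integrable_on_shell:
  fixes w :: "'a::euclidean_space \<Rightarrow> complex"
  assumes "continuous_on G w" "continuous_on UNIV h" "continuous_on UNIV \<psi>"
    and "\<And>s. s \<notin> {l..u} \<Longrightarrow> \<psi> s = 0" and "\<And>x. (x - c) \<bullet> (x - c) \<in> {l..u} \<Longrightarrow> x \<in> G"
  shows "integrable lborel (\<lambda>x. w x * h x * \<psi> ((x - c) \<bullet> (x - c)))"
proof -
  let ?K = "{x. (x - c) \<bullet> (x - c) \<in> {l..u}}"
  let ?f = "\<lambda>x. w x * h x * \<psi> ((x - c) \<bullet> (x - c))"
  have "continuous_on ?K ?f"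
    by (intro continuous_intros continuous_on_subset[OF assms(1)] continuous_on_subset[OF assms(2)]
        continuous_on_compose2[OF assms(3)]) (use assms(5) in auto)
  then have "integrable lborel (\<lambda>x. indicator ?K x *\<^sub>R ?f x)"
    by (rule borel_integrable_compact[OF compact_shell])
  also have "(\<lambda>x. indicator ?K x *\<^sub>R ?f x) = ?f"
    using assms(4) by (auto simp: indicator_def fun_eq_iff)
  finally show ?thesis .
qed

lemma radial_moment_recursion:
  fixes w :: "'a::euclidean_space \<Rightarrow> complex"
  assumes G: "open G" "Ck_on 2 G w" and eq: "\<And>x. x \<in> G \<Longrightarrow> laplacian w x + \<kappa> * w x = 0"
    and F: "\<And>s. (F has_vector_derivative F1 s) (at s)" "\<And>s. (F1 has_vector_derivative F2 s) (at s)"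
      "continuous_on UNIV F2"
    and supp: "\<And>s. s \<notin> {l..u} \<Longrightarrow> F s = 0" "\<And>s. s \<notin> {l..u} \<Longrightarrow> F1 s = 0"
    and K: "\<And>x. (x - c) \<bullet> (x - c) \<in> {l..u} \<Longrightarrow> x \<in> G"
  shows "of_real (real (m * (m - 1)) * (a \<bullet> a)) * radial_moment w c a (m - 2) F +
    radial_moment w c a m (\<lambda>s. 4 * of_real s * F2 s + of_nat (4 * m + 2 * DIM('a)) * F1 s + \<kappa> * F s) = 0"
proof -
  have supp2: "F2 s = 0" if "s \<notin> {l..u}" for s
  proof -
    have op: "open (- {l..u})" by (rule open_Compl) simp
    have "((\<lambda>_. 0) has_vector_derivative 0) (at s)" by simp
    then have "(F1 has_vector_derivative 0) (at s)"
      by (rule has_vector_derivative_transform_within_open[OF _ op]) (use supp that in auto)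
    then show ?thesis using F(2) vector_derivative_unique_at by blast
  qed
  define S where "S = (\<lambda>x. (x - c) \<bullet> (x - c))"
  define P where "P = (\<lambda>x. a \<bullet> (x - c))"
  define L where "L = (\<lambda>s. 4 * of_real s * F2 s + of_nat (4 * m + 2 * DIM('a)) * F1 s + \<kappa> * F s)"
  have cF: "continuous_on UNIV F" "continuous_on UNIV F1"
    using F(1,2) by (meson continuous_at_imp_continuous_on has_vector_derivative_continuous)+
  have cL: "continuous_on UNIV L" unfolding L_def by (intro continuous_intros cF F(3))
  have L0: "L s = 0" if "s \<notin> {l..u}" for s using that supp supp2 by (simp add: L_def)
  have cP: "continuous_on UNIV (\<lambda>x. complex_of_real (P x ^ n))" for n unfolding P_def by (intro continuous_intros)
  have cw: "continuous_on G w" by (rule Ck_on_2_continuous[OF G(2)])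
  have i1: "integrable lborel (\<lambda>x. w x * of_real (P x ^ n) * F (S x))" for n
    unfolding S_def by (rule integrable_on_shell[OF cw cP cF(1) supp(1) K])
  have i2: "integrable lborel (\<lambda>x. w x * of_real (P x ^ n) * L (S x))" for n
    unfolding S_def by (rule integrable_on_shell[OF cw cP cL L0 K])
  let ?K = "{x. (x - c) \<bullet> (x - c) \<in> {l..u}}"
  have "(LINT x:?K|lborel. w x * (of_real (real (m * (m - 1)) * (a \<bullet> a) * P x ^ (m - 2)) * F (S x) +
    of_real (P x ^ m) * L (S x))) = 0"
    unfolding P_def S_def L_def
    by (rule radial_moment_identity[OF G eq F supp, where K = ?K]) (use K in auto)
  also have "(LINT x:?K|lborel. w x * (of_real (real (m * (m - 1)) * (a \<bullet> a) * P x ^ (m - 2)) * F (S x) +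
    of_real (P x ^ m) * L (S x))) = (LINT x|lborel. of_real (real (m * (m - 1)) * (a \<bullet> a)) * (w x * of_real (P x ^ (m - 2)) * F (S x))
      + w x * of_real (P x ^ m) * L (S x))"
    unfolding set_lebesgue_integral_def
  proof (rule Bochner_Integration.integral_cong)
    fix x :: 'a
    show "indicator ?K x *\<^sub>R (w x * (of_real (real (m * (m - 1)) * (a \<bullet> a) * P x ^ (m - 2)) * F (S x) +
      of_real (P x ^ m) * L (S x))) = of_real (real (m * (m - 1)) * (a \<bullet> a)) * (w x * of_real (P x ^ (m - 2)) * F (S x))
      + w x * of_real (P x ^ m) * L (S x)"
    proof (cases "x \<in> ?K")
      case True then show ?thesis by (simp add: algebra_simps)
    next
      case False
      then have "F (S x) = 0" "L (S x) = 0" using supp(1)[of "S x"] L0[of "S x"] by (auto simp: S_def)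
      then show ?thesis by simp
    qed
  qed simp
  also have "\<dots> = of_real (real (m * (m - 1)) * (a \<bullet> a)) * radial_moment w c a (m - 2) F + radial_moment w c a m L"
    unfolding radial_moment_def using i1 i2 by (simp add: P_def S_def)
  finally show ?thesis unfolding L_def .
qed

text \<open>If a compactly supported \<open>F\<close> solves the radial equation of order \<open>m\<close> with right-hand side
  \<open>\<psi>\<close>, up to an error of small moment, then \<open>radial_moment_recursion\<close> expresses the moment of \<open>\<psi>\<close> by a moment of
  order \<open>m - 2\<close>, which vanishes by induction. Rellich's lemma and unique continuation differ only in how they
  provide \<open>solve\<close>. The coefficient $4m + 6$ is $4m + 2n$ in dimension $n = 3$.\<close>

lemma radial_moments_vanish:
  fixes w :: "real^3 \<Rightarrow> complex"
  assumes G: "open G" "Ck_on 2 G w" and eq: "\<And>x. x \<in> G \<Longrightarrow> laplacian w x + of_real (k\<^sup>2) * w x = 0"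
    and I: "\<And>x. (x - c) \<bullet> (x - c) \<in> I \<Longrightarrow> x \<in> G"
    and solve: "\<And>m l u \<psi> e. {l..u} \<subseteq> I \<Longrightarrow> continuous_on UNIV \<psi> \<Longrightarrow> (\<forall>s. s \<notin> {l..u} \<longrightarrow> \<psi> s = 0) \<Longrightarrow> e > 0 \<Longrightarrow>
      \<exists>F F1 F2 l' u'. {l'..u'} \<subseteq> I \<and> (\<forall>s. (F has_vector_derivative F1 s) (at s)) \<and> (\<forall>s. (F1 has_vector_derivative F2 s) (at s)) \<and>
        continuous_on UNIV F2 \<and> (\<forall>s. s \<notin> {l'..u'} \<longrightarrow> F s = 0 \<and> F1 s = 0 \<and> F2 s = 0) \<and>
        norm (radial_moment w c a m (\<lambda>s. 4 * of_real s * F2 s + (4 * of_nat m + 6) * F1 s + of_real (k\<^sup>2) * F s - \<psi> s)) < e"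
    and \<psi>: "{l..u} \<subseteq> I" "continuous_on UNIV \<psi>" "\<And>s. s \<notin> {l..u} \<Longrightarrow> \<psi> s = 0"
  shows "radial_moment w c a m \<psi> = 0"
  using \<psi>
proof (induction m arbitrary: \<psi> l u rule: less_induct)
  case (less m)
  have cw: "continuous_on G w" by (rule Ck_on_2_continuous[OF G(2)])
  have cP: "continuous_on UNIV (\<lambda>x. complex_of_real ((a \<bullet> (x - c)) ^ n))" for n by (intro continuous_intros)
  have "norm (radial_moment w c a m \<psi>) < e" if "e > 0" for e
  proof -
    have \<psi>0: "\<forall>s. s \<notin> {l..u} \<longrightarrow> \<psi> s = 0" using less.prems(3) by blast
    from solve[OF less.prems(1,2) \<psi>0 \<open>e > 0\<close>, of m] obtain F F1 F2 l' u' where l': "{l'..u'} \<subseteq> I"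
      and dF: "\<forall>s. (F has_vector_derivative F1 s) (at s)" "\<forall>s. (F1 has_vector_derivative F2 s) (at s)"
      and cF2: "continuous_on UNIV F2" and s0: "\<forall>s. s \<notin> {l'..u'} \<longrightarrow> F s = 0 \<and> F1 s = 0 \<and> F2 s = 0"
      and small: "norm (radial_moment w c a m (\<lambda>s. 4 * of_real s * F2 s + (4 * of_nat m + 6) * F1 s + of_real (k\<^sup>2) * F s - \<psi> s)) < e"
      by (elim exE conjE)
    note F = dF[rule_format] cF2
    have supp: "\<And>s. s \<notin> {l'..u'} \<Longrightarrow> F s = 0" "\<And>s. s \<notin> {l'..u'} \<Longrightarrow> F1 s = 0" "\<And>s. s \<notin> {l'..u'} \<Longrightarrow> F2 s = 0"
      using s0 by blast+
    have cF: "continuous_on UNIV F" "continuous_on UNIV F1"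
      using F(1,2) by (meson continuous_at_imp_continuous_on has_vector_derivative_continuous)+
    define L where "L = (\<lambda>s. 4 * of_real s * F2 s + (4 * of_nat m + 6) * F1 s + of_real (k\<^sup>2) * F s)"
    have cL: "continuous_on UNIV L" unfolding L_def by (intro continuous_intros cF F(3))
    have L0: "L s = 0" if "s \<notin> {l'..u'}" for s using that supp by (simp add: L_def)
    have "of_real (real (m * (m - 1)) * (a \<bullet> a)) * radial_moment w c a (m - 2) F +
      radial_moment w c a m (\<lambda>s. 4 * of_real s * F2 s + of_nat (4 * m + 2 * DIM(real^3)) * F1 s + of_real (k\<^sup>2) * F s) = 0"
      by (rule radial_moment_recursion[OF G eq F supp(1,2)]) (use I l' in auto)
    moreover have "real (m * (m - 1)) = 0 \<or> radial_moment w c a (m - 2) F = 0"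
    proof (cases "m < 2")
      case True then show ?thesis by (auto simp: less_2_cases_iff)
    next
      case False
      then have "radial_moment w c a (m - 2) F = 0" by (intro less.IH[OF _ l' cF(1) supp(1)]) auto
      then show ?thesis ..
    qed
    ultimately have "radial_moment w c a m L = 0" by (auto simp: L_def)
    moreover have "radial_moment w c a m (\<lambda>s. L s - \<psi> s) = radial_moment w c a m L - radial_moment w c a m \<psi>"
      unfolding radial_moment_def right_diff_distrib
      by (rule Bochner_Integration.integral_diff)
         (rule integrable_on_shell[OF cw cP cL L0 I] integrable_on_shell[OF cw cP less.prems(2,3) I]; use l' less.prems(1) in blast)+
    ultimately show ?thesis using small by (simp add: L_def)
  qed
  then show ?case by (metis less_irrefl zero_less_norm_iff)
qed

section \<open>Functions determined by their moments\<close>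

text \<open>These functions form an algebra, since $e^{a \cdot x} e^{b \cdot x} = e^{(a + b) \cdot x}$, and they
  separate points.\<close>

inductive exponential_sum :: "('a::euclidean_space \<Rightarrow> real) \<Rightarrow> bool" where
  exp: "exponential_sum (\<lambda>x. r * exp (a \<bullet> x))"
| add: "exponential_sum f \<Longrightarrow> exponential_sum g \<Longrightarrow> exponential_sum (\<lambda>x. f x + g x)"

lemma exponential_sum_mult:
  assumes "exponential_sum f" "exponential_sum g"
  shows "exponential_sum (\<lambda>x. f x * g x)"
  using assms(1)
proof induction
  case (exp r a)
  from assms(2) show ?case
  proof induction
    case (exp r' b)
    have "(\<lambda>x. r * exp (a \<bullet> x) * (r' * exp (b \<bullet> x))) = (\<lambda>x. (r * r') * exp ((a + b) \<bullet> x))"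
      by (simp add: fun_eq_iff inner_add_left exp_add)
    then show ?case using exponential_sum.exp[of "r * r'" "a + b"] by simp
  next
    case (add f g)
    then show ?case using exponential_sum.add[OF add.IH] by (simp add: ring_distribs)
  qed
next
  case (add f1 f2)
  then show ?case using exponential_sum.add[OF add.IH] by (simp add: ring_distribs)
qed

lemma exponential_sum_continuous: "exponential_sum f \<Longrightarrow> continuous_on S f"
  by (induction rule: exponential_sum.induct) (auto intro!: continuous_intros)

lemma integral_continuous_eq_0:
  fixes f :: "'a::euclidean_space \<Rightarrow> real"
  assumes cont: "continuous_on UNIV f" and nn: "\<And>x. f x \<ge> 0" and int: "integrable lborel f" "integral\<^sup>L lborel f = 0"
  shows "f x = 0"
proof -
  let ?U = "{x. f x \<noteq> 0}"
  have AE: "AE x in lborel. x \<notin> ?U" using integral_nonneg_eq_0_iff_AE[OF int(1)] nn int(2) by auto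
  have U: "open ?U" by (intro open_Collect_neq cont continuous_on_const)
  then have "?U \<in> null_sets lborel" using AE by (subst AE_iff_null_sets) auto
  then have "negligible ?U" unfolding negligible_iff_null_sets by (rule null_sets_completionI)
  then show ?thesis using open_not_negligible[OF U] by blast
qed

text \<open>The moments against powers of a linear form sum up to the integral against its exponential. Sums of
  such exponentials approximate \<open>v\<close> uniformly on \<open>K\<close> by the Stone--Weierstrass theorem, so \<open>v\<close> is orthogonal to
  itself.\<close>

lemma zero_if_moments_vanish_real:
  fixes v :: "'a::euclidean_space \<Rightarrow> real"
  assumes cont: "continuous_on UNIV v" and K: "compact K" and supp: "\<And>x. x \<notin> K \<Longrightarrow> v x = 0"
    and mom: "\<And>a m. (LINT x|lborel. v x * (a \<bullet> (x - c)) ^ m) = 0"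
  shows "v x = 0"
proof -
  have int: "integrable lborel (\<lambda>x. v x * h x)" if "continuous_on UNIV h" for h
    by (rule integrable_continuous_compact_support[OF _ K]) (use cont that supp in \<open>auto intro!: continuous_intros\<close>)
  have exps: "(LINT x|lborel. v x * exp (a \<bullet> (x - c))) = 0" for a
  proof -
    define s where "s = (\<lambda>N x. \<Sum>m<N. v x * ((a \<bullet> (x - c)) ^ m / fact m))"
    have "(\<lambda>N. LINT x|lborel. s N x) \<longlonglongrightarrow> (LINT x|lborel. v x * exp (a \<bullet> (x - c)))"
    proof (rule integral_dominated_convergence[where w = "\<lambda>x. \<bar>v x * exp \<bar>a \<bullet> (x - c)\<bar>\<bar>"])
      show "integrable lborel (\<lambda>x. \<bar>v x * exp \<bar>a \<bullet> (x - c)\<bar>\<bar>)"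
        by (intro integrable_abs int continuous_intros)
      have cs: "continuous_on UNIV (s N)" for N unfolding s_def by (intro continuous_intros cont) auto
      show "s N \<in> borel_measurable lborel" for N using borel_measurable_continuous_onI[OF cs] by simp
      show "(\<lambda>x. v x * exp (a \<bullet> (x - c))) \<in> borel_measurable lborel"
        by (rule borel_measurable_integrable[OF int]) (intro continuous_intros)
      show "AE x in lborel. (\<lambda>N. s N x) \<longlonglongrightarrow> v x * exp (a \<bullet> (x - c))"
      proof (rule AE_I2)
        fix x
        have "(\<lambda>m. (a \<bullet> (x - c)) ^ m / fact m) sums exp (a \<bullet> (x - c))"
          using exp_converges[of "a \<bullet> (x - c)"] by (simp add: field_simps)
        from sums_mult[OF this, of "v x"] show "(\<lambda>N. s N x) \<longlonglongrightarrow> v x * exp (a \<bullet> (x - c))"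
          by (simp add: sums_def s_def)
      qed
      fix N
      show "AE x in lborel. norm (s N x) \<le> \<bar>v x * exp \<bar>a \<bullet> (x - c)\<bar>\<bar>"
      proof (rule AE_I2)
        fix x
        define t where "t = a \<bullet> (x - c)"
        have e: "(\<lambda>m. \<bar>t\<bar> ^ m / fact m) sums exp \<bar>t\<bar>"
          using exp_converges[of "\<bar>t\<bar>"] by (simp add: field_simps)
        have "\<bar>\<Sum>m<N. t ^ m / fact m\<bar> \<le> (\<Sum>m<N. \<bar>t\<bar> ^ m / fact m)"
          by (rule order_trans[OF sum_abs]) (simp add: power_abs)
        also have "\<dots> \<le> exp \<bar>t\<bar>" using sum_le_suminf[OF sums_summable[OF e], of "{..<N}"] sums_unique[OF e] by simp
        finally have "\<bar>v x\<bar> * \<bar>\<Sum>m<N. t ^ m / fact m\<bar> \<le> \<bar>v x\<bar> * exp \<bar>t\<bar>" by (rule mult_left_mono) simp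
        moreover have "s N x = v x * (\<Sum>m<N. t ^ m / fact m)"
          by (simp add: s_def t_def sum_distrib_left)
        ultimately show "norm (s N x) \<le> \<bar>v x * exp \<bar>a \<bullet> (x - c)\<bar>\<bar>"
          by (simp add: t_def abs_mult)
      qed
    qed
    moreover have "(LINT x|lborel. s N x) = 0" for N
    proof -
      have "(LINT x|lborel. s N x) = (\<Sum>m<N. (LINT x|lborel. v x * ((a \<bullet> (x - c)) ^ m / fact m)))"
        unfolding s_def by (intro Bochner_Integration.integral_sum int continuous_intros) auto
      moreover have "(LINT x|lborel. v x * ((a \<bullet> (x - c)) ^ m / fact m)) = 0" for m
        using mom[of a m] by simp
      ultimately show ?thesis by simp
    qed
    ultimately show ?thesis by (simp add: LIMSEQ_const_iff)
  qed
  have sums: "(LINT x|lborel. v x * h x) = 0" if "exponential_sum h" for h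
    using that
  proof induction
    case (exp r a)
    have "(\<lambda>x. v x * (r * exp (a \<bullet> x))) = (\<lambda>x. (r * exp (a \<bullet> c)) * (v x * exp (a \<bullet> (x - c))))"
      by (simp add: fun_eq_iff inner_diff_right exp_diff)
    then show ?case using exps[of a] by simp
  next
    case (add f g)
    then show ?case using int[OF exponential_sum_continuous[OF add.hyps(1)]] int[OF exponential_sum_continuous[OF add.hyps(2)]]
      by (simp add: ring_distribs)
  qed
  have iv: "integrable lborel (\<lambda>x. \<bar>v x\<bar>)" using int[of "\<lambda>_. 1"] by simp
  define J where "J = (LINT x|lborel. \<bar>v x\<bar>)"
  have J: "J \<ge> 0" by (simp add: J_def)
  have small: "(LINT x|lborel. v x * v x) \<le> e * J" if "e > 0" for e
  proof -
    have "\<exists>h. exponential_sum h \<and> (\<forall>x\<in>K. \<bar>v x - h x\<bar> < e)"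
    proof (rule Stone_Weierstrass_HOL[OF K])
      show "exponential_sum (\<lambda>x. r)" for r using exponential_sum.exp[of r 0] by simp
      show "\<exists>f. exponential_sum f \<and> f x \<noteq> f y" if "x \<in> K \<and> y \<in> K \<and> x \<noteq> y" for x y
      proof -
        have "(x - y) \<bullet> (x - y) \<noteq> 0" using that by simp
        then have "(x - y) \<bullet> x \<noteq> (x - y) \<bullet> y" by (simp add: inner_diff_right)
        then show ?thesis using exponential_sum.exp[of 1 "x - y"] by (intro exI[of _ "\<lambda>z. 1 * exp ((x - y) \<bullet> z)"]) simp
      qed
    qed (use cont continuous_on_subset exponential_sum_continuous exponential_sum.add exponential_sum_mult \<open>e > 0\<close> in auto)
    then obtain h where h: "exponential_sum h" "\<And>x. x \<in> K \<Longrightarrow> \<bar>v x - h x\<bar> < e" by blast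
    have ch: "continuous_on UNIV h" by (rule exponential_sum_continuous[OF h(1)])
    have "(LINT x|lborel. v x * v x) = (LINT x|lborel. v x * (v x - h x))"
      using sums[OF h(1)] int[OF ch] int[OF cont] by (simp add: right_diff_distrib)
    also have "\<dots> \<le> (LINT x|lborel. e * \<bar>v x\<bar>)"
    proof (rule integral_mono)
      show "integrable lborel (\<lambda>x. v x * (v x - h x))" by (intro int continuous_intros cont ch)
      show "integrable lborel (\<lambda>x. e * \<bar>v x\<bar>)" using iv by simp
      fix x
      show "v x * (v x - h x) \<le> e * \<bar>v x\<bar>"
      proof (cases "x \<in> K")
        case True
        have "v x * (v x - h x) \<le> \<bar>v x\<bar> * \<bar>v x - h x\<bar>" by (metis abs_ge_self abs_mult)
        also have "\<dots> \<le> \<bar>v x\<bar> * e" using h(2)[OF True] by (intro mult_left_mono) auto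
        finally show ?thesis by (simp add: mult.commute)
      qed (simp add: supp)
    qed
    finally show ?thesis by (simp add: J_def)
  qed
  have "(LINT x|lborel. v x * v x) \<le> 0"
  proof (rule field_le_epsilon)
    fix e :: real assume "e > 0"
    have "e / (J + 1) * J \<le> e" using \<open>e > 0\<close> J by (simp add: field_simps)
    then show "(LINT x|lborel. v x * v x) \<le> 0 + e" using small[of "e / (J + 1)"] \<open>e > 0\<close> J by simp
  qed
  then have "(LINT x|lborel. v x * v x) = 0" by (intro antisym integral_nonneg) auto
  then have "v x * v x = 0"
    by (intro integral_continuous_eq_0[of "\<lambda>x. v x * v x"] int continuous_intros cont) auto
  then show ?thesis by simp
qed

lemma zero_if_moments_vanish:
  fixes v :: "'a::euclidean_space \<Rightarrow> complex"
  assumes cont: "continuous_on UNIV v" and K: "compact K" and supp: "\<And>x. x \<notin> K \<Longrightarrow> v x = 0"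
    and mom: "\<And>a m. (LINT x|lborel. v x * of_real ((a \<bullet> (x - c)) ^ m)) = 0"
  shows "v x = 0"
proof -
  have int: "integrable lborel (\<lambda>x. v x * of_real ((a \<bullet> (x - c)) ^ m))" for a m
    by (rule integrable_continuous_compact_support[OF _ K]) (use cont supp in \<open>auto intro!: continuous_intros\<close>)
  have "Re (v x) = 0"
  proof (rule zero_if_moments_vanish_real[OF _ K])
    show "(LINT x|lborel. Re (v x) * (a \<bullet> (x - c)) ^ m) = 0" for a m
      using integral_Re[OF int[of a m]] mom[of a m] by simp
  qed (use cont supp in \<open>auto intro!: continuous_intros\<close>)
  moreover have "Im (v x) = 0"
  proof (rule zero_if_moments_vanish_real[OF _ K])
    show "(LINT x|lborel. Im (v x) * (a \<bullet> (x - c)) ^ m) = 0" for a m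
      using integral_Im[OF int[of a m]] mom[of a m] by simp
  qed (use cont supp in \<open>auto intro!: continuous_intros\<close>)
  ultimately show ?thesis by (simp add: complex_eq_iff)
qed

text \<open>The product of \<open>w\<close> with a tent function of $|x - c|^2$ has compact support, and its moments are
  radial moments of \<open>w\<close>.\<close>

lemma zero_if_radial_moments_vanish:
  fixes w :: "'a::euclidean_space \<Rightarrow> complex"
  assumes G: "open G" "continuous_on G w" and I: "open I" "\<And>x. (x - c) \<bullet> (x - c) \<in> I \<Longrightarrow> x \<in> G"
    and mom: "\<And>a m l u \<psi>. {l..u} \<subseteq> I \<Longrightarrow> continuous_on UNIV \<psi> \<Longrightarrow> (\<And>s. s \<notin> {l..u} \<Longrightarrow> \<psi> s = 0) \<Longrightarrow> radial_moment w c a m \<psi> = 0"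
    and x: "(x - c) \<bullet> (x - c) \<in> I"
  shows "w x = 0"
proof -
  define s0 where "s0 = (x - c) \<bullet> (x - c)"
  obtain d where d: "d > 0" "cball s0 d \<subseteq> I" using I(1) x open_contains_cball unfolding s0_def by blast
  define \<psi> where "\<psi> = (\<lambda>s. complex_of_real (max 0 (d - \<bar>s - s0\<bar>)))"
  have c\<psi>: "continuous_on UNIV \<psi>" unfolding \<psi>_def by (intro continuous_intros)
  have I': "{s0 - d..s0 + d} \<subseteq> I" using d(2) by (auto simp: subset_iff dist_real_def abs_le_iff)
  have supp: "\<psi> s = 0" if "s \<notin> {s0 - d..s0 + d}" for s using that by (auto simp: \<psi>_def)
  define K where "K = {x. (x - c) \<bullet> (x - c) \<in> {s0 - d..s0 + d}}"
  have K: "compact K" "K \<subseteq> G" using compact_shell I' I(2) by (auto simp: K_def)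
  define v where "v = (\<lambda>x. w x * \<psi> ((x - c) \<bullet> (x - c)))"
  have v0: "v x = 0" if "x \<notin> K" for x using that supp[of "(x - c) \<bullet> (x - c)"] by (simp add: v_def K_def)
  have "continuous_on (G \<union> - K) v"
  proof (rule continuous_on_open_Un[OF G(1)])
    show "open (- K)" using K(1) by (simp add: compact_imp_closed open_Compl)
    show "continuous_on G v" unfolding v_def
      by (intro continuous_intros G continuous_on_compose2[OF c\<psi>]) auto
    show "continuous_on (- K) v" by (rule continuous_on_eq[of _ "\<lambda>_. 0"]) (use v0 in auto)
  qed
  moreover have "G \<union> - K = UNIV" using K by auto
  ultimately have cv: "continuous_on UNIV v" by simp
  have "v x = 0"
  proof (rule zero_if_moments_vanish[OF cv K(1) v0])
    fix a m
    show "(LINT x|lborel. v x * of_real ((a \<bullet> (x - c)) ^ m)) = 0"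
      using mom[OF I' c\<psi> supp, of a m] by (simp add: radial_moment_def v_def mult_ac)
  qed
  then show ?thesis using d(1) by (simp add: v_def \<psi>_def s0_def)
qed

section \<open>Unique continuation and Rellich's lemma\<close>

text \<open>A radial solution is only given for $s > 0$. The product with a cutoff extends by zero to all real
  arguments if the cutoff or the solution vanishes near zero; both cases occur below.\<close>

lemma cutoff_product:
  fixes f f1 f2 :: "real \<Rightarrow> complex" and \<eta> \<eta>1 \<eta>2 :: "real \<Rightarrow> real"
  assumes f: "\<And>s. s > 0 \<Longrightarrow> (f has_vector_derivative f1 s) (at s)"
      "\<And>s. s > 0 \<Longrightarrow> (f1 has_vector_derivative f2 s) (at s)" "continuous_on {0<..} f2"
    and \<eta>: "\<And>s. (\<eta> has_real_derivative \<eta>1 s) (at s)" "\<And>s. (\<eta>1 has_real_derivative \<eta>2 s) (at s)"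
      "continuous_on UNIV \<eta>2"
    and b: "b > 0" "\<And>s. s \<le> b \<Longrightarrow> \<eta> s = 0 \<and> \<eta>1 s = 0 \<and> \<eta>2 s = 0 \<or> f s = 0 \<and> f1 s = 0 \<and> f2 s = 0"
  defines "F \<equiv> \<lambda>s. of_real (\<eta> s) * f s" and "F1 \<equiv> \<lambda>s. of_real (\<eta>1 s) * f s + of_real (\<eta> s) * f1 s"
    and "F2 \<equiv> \<lambda>s. of_real (\<eta>2 s) * f s + 2 * of_real (\<eta>1 s) * f1 s + of_real (\<eta> s) * f2 s"
  shows "(F has_vector_derivative F1 s) (at s)" "(F1 has_vector_derivative F2 s) (at s)" "continuous_on UNIV F2"
proof -
  have z: "F s = 0" "F1 s = 0" "F2 s = 0" if "s \<le> b" for s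
    using b(2)[OF that] by (auto simp: F_def F1_def F2_def)
  have \<eta>': "((\<lambda>s. complex_of_real (\<eta> s)) has_vector_derivative of_real (\<eta>1 s)) (at s)"
    "((\<lambda>s. complex_of_real (\<eta>1 s)) has_vector_derivative of_real (\<eta>2 s)) (at s)" for s
    using \<eta>(1,2)[of s] by (auto intro!: has_vector_derivative_of_real simp: has_real_derivative_iff_has_vector_derivative)
  have near: "(g has_vector_derivative 0) (at s)" if "s < b" "\<And>s. s \<le> b \<Longrightarrow> g s = 0" for g :: "real \<Rightarrow> complex" and s
  proof -
    have "((\<lambda>_. 0) has_vector_derivative 0) (at s)" by simp
    then show ?thesis
      by (rule has_vector_derivative_transform_within_open[OF _ open_lessThan[of b]]) (use that in auto)
  qed
  show "(F has_vector_derivative F1 s) (at s)"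
  proof (cases "s < b")
    case True then show ?thesis using near[of s F] z by simp
  next
    case False
    then have "s > 0" using b(1) by simp
    show ?thesis unfolding F_def F1_def
      by (rule has_vector_derivative_eq_rhs[OF has_vector_derivative_mult[OF \<eta>'(1) f(1)[OF \<open>s > 0\<close>]]]) simp
  qed
  show "(F1 has_vector_derivative F2 s) (at s)"
  proof (cases "s < b")
    case True then show ?thesis using near[of s F1] z by simp
  next
    case False
    then have "s > 0" using b(1) by simp
    show ?thesis unfolding F1_def F2_def
      by (rule has_vector_derivative_eq_rhs[OF has_vector_derivative_add[OF
            has_vector_derivative_mult[OF \<eta>'(2) f(1)[OF \<open>s > 0\<close>]] has_vector_derivative_mult[OF \<eta>'(1) f(2)[OF \<open>s > 0\<close>]]]]) simp
  qed
  have "continuous_on ({0<..} \<union> {..<b}) F2"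
  proof (rule continuous_on_open_Un)
    have "continuous_on {0<..} f" "continuous_on {0<..} f1"
      using f(1,2) by (meson continuous_at_imp_continuous_on greaterThan_iff has_vector_derivative_continuous)+
    moreover have "continuous_on UNIV \<eta>" "continuous_on UNIV \<eta>1"
      using \<eta>(1,2) by (meson DERIV_isCont continuous_at_imp_continuous_on)+
    ultimately show "continuous_on {0<..} F2" unfolding F2_def
      by (intro continuous_intros f(3) continuous_on_subset[OF \<eta>(3)]) (auto intro: continuous_on_subset)
    show "continuous_on {..<b} F2" by (rule continuous_on_eq[of _ "\<lambda>_. 0"]) (use z in auto)
  qed auto
  moreover have "{0<..} \<union> {..<b} = UNIV" using b(1) by auto
  ultimately show "continuous_on UNIV F2" by simp
qed

lemma DERIV_affine:
  fixes f :: "real \<Rightarrow> real"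
  assumes "\<And>t. (f has_real_derivative f' t) (at t)"
  shows "((\<lambda>s. c * f (p * s + q)) has_real_derivative c * (p * f' (p * s + q))) (at s)"
proof -
  have "((\<lambda>s. p * s + q) has_real_derivative p) (at s)"
    by (rule derivative_eq_intros refl | simp)+
  from DERIV_cmult[OF DERIV_chain2[OF assms this], of c] show ?thesis by (simp add: mult.commute)
qed

text \<open>The solution of the radial equation that vanishes beyond the support of \<open>\<psi>\<close> is cut off near $s = 0$.
  The cutoff disturbs the equation only where \<open>w\<close> vanishes, so the moments of the error are exactly zero.\<close>

lemma Helmholtz_zero_on_ball:
  fixes w :: "real^3 \<Rightarrow> complex"
  assumes k: "k > 0" and C2: "Ck_on 2 (ball c \<rho>) w"
    and eq: "\<And>x. x \<in> ball c \<rho> \<Longrightarrow> laplacian w x + of_real (k\<^sup>2) * w x = 0"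
    and \<epsilon>: "\<epsilon> > 0" "\<And>x. x \<in> ball c \<epsilon> \<Longrightarrow> w x = 0" and x: "x \<in> ball c \<rho>"
  shows "w x = 0"
proof -
  define I where "I = {0<..<\<rho>\<^sup>2}"
  have \<rho>: "\<rho> > 0" using x by (metis ball_empty empty_iff not_le)
  have I: "x \<in> ball c \<rho>" if "(x - c) \<bullet> (x - c) \<in> I" for x
  proof -
    have "(norm (x - c))\<^sup>2 < \<rho>\<^sup>2" using that by (simp add: I_def power2_norm_eq_inner)
    then show ?thesis using \<rho> by (simp add: dist_norm norm_minus_commute power2_less_imp_less)
  qed
  obtain \<theta> \<theta>1 \<theta>2 :: "real \<Rightarrow> real" and B where \<theta>:
    "\<And>t. (\<theta> has_real_derivative \<theta>1 t) (at t)" "\<And>t. (\<theta>1 has_real_derivative \<theta>2 t) (at t)"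
    "continuous_on UNIV \<theta>2" "\<And>t. t \<le> 0 \<Longrightarrow> \<theta> t = 0" "\<And>t. t \<ge> 3 \<Longrightarrow> \<theta> t = 1"
    "\<And>t. t \<notin> {0..3} \<Longrightarrow> \<theta>1 t = 0" "\<And>t. t \<notin> {0..3} \<Longrightarrow> \<theta>2 t = 0"
    using C2_cutoff by metis
  define \<delta> where "\<delta> = min (\<epsilon>\<^sup>2) (\<rho>\<^sup>2) / 2"
  have \<delta>: "\<delta> > 0" "\<delta> < \<epsilon>\<^sup>2" "\<delta> < \<rho>\<^sup>2"
  proof -
    have "min (\<epsilon>\<^sup>2) (\<rho>\<^sup>2) > 0" using \<epsilon>(1) \<rho> by simp
    then show "\<delta> > 0" "\<delta> < \<epsilon>\<^sup>2" "\<delta> < \<rho>\<^sup>2"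
      using min.cobounded1[of "\<epsilon>\<^sup>2" "\<rho>\<^sup>2"] min.cobounded2[of "\<epsilon>\<^sup>2" "\<rho>\<^sup>2"]
      unfolding \<delta>_def by linarith+
  qed
  (* The cutoff rises from 0 at s = \<delta> / 2 to 1 at s = \<delta>, inside the region where w vanishes. *)
  define \<eta> where "\<eta> = (\<lambda>s. \<theta> (6 / \<delta> * s - 3))"
  define \<eta>1 where "\<eta>1 = (\<lambda>s. 6 / \<delta> * \<theta>1 (6 / \<delta> * s - 3))"
  define \<eta>2 where "\<eta>2 = (\<lambda>s. 6 / \<delta> * (6 / \<delta> * \<theta>2 (6 / \<delta> * s - 3)))"
  have \<eta>: "(\<eta> has_real_derivative \<eta>1 s) (at s)" "(\<eta>1 has_real_derivative \<eta>2 s) (at s)" for s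
    unfolding \<eta>_def \<eta>1_def \<eta>2_def
    using DERIV_affine[OF \<theta>(1), of 1 "6 / \<delta>" "- 3" s] DERIV_affine[OF \<theta>(2), of "6 / \<delta>" "6 / \<delta>" "- 3" s] by simp_all
  have c\<eta>: "continuous_on UNIV \<eta>2" unfolding \<eta>2_def
    by (intro continuous_intros continuous_on_compose2[OF \<theta>(3)]) auto
  have lo: "\<eta> s = 0 \<and> \<eta>1 s = 0 \<and> \<eta>2 s = 0" if "s \<le> \<delta> / 3" for s
  proof -
    have "6 / \<delta> * s \<le> 2" using that \<delta>(1) by (simp add: field_simps)
    then show ?thesis using \<theta>(4,6,7) by (simp add: \<eta>_def \<eta>1_def \<eta>2_def)
  qed
  have hi: "\<eta> s = 1" "\<eta>1 s = 0" "\<eta>2 s = 0" if "s > \<delta>" for s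
  proof -
    have "6 / \<delta> * s > 6" using that \<delta>(1) by (simp add: field_simps)
    then show "\<eta> s = 1" "\<eta>1 s = 0" "\<eta>2 s = 0" using \<theta>(5,6,7) by (simp_all add: \<eta>_def \<eta>1_def \<eta>2_def)
  qed
  have van: "radial_moment w c a m \<psi> = 0" if "{l..u} \<subseteq> I" "continuous_on UNIV \<psi>" "\<And>s. s \<notin> {l..u} \<Longrightarrow> \<psi> s = 0" for a m l u \<psi>
  proof (rule radial_moments_vanish[OF open_ball C2 eq I _ that])
    fix m l u and \<psi> :: "real \<Rightarrow> complex" and e :: real
    assume lu: "{l..u} \<subseteq> I" and \<psi>: "continuous_on UNIV \<psi>" "\<forall>s. s \<notin> {l..u} \<longrightarrow> \<psi> s = 0" and e: "e > 0"
    obtain l' u' where l'u': "l' > 0" "u' < \<rho>\<^sup>2" "\<And>s. s \<notin> {l'..u'} \<Longrightarrow> \<psi> s = 0"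
    proof (cases "l \<le> u")
      case True
      then have "l \<in> I" "u \<in> I" using lu by auto
      then show ?thesis using that[of l u] \<psi>(2) by (auto simp: I_def)
    next
      case False then show ?thesis using that[of 1 0] \<psi>(2) \<rho> by auto
    qed
    have \<psi>0: "\<forall>s. s \<notin> {l'..u'} \<longrightarrow> \<psi> s = 0" using l'u'(3) by blast
    from radial_equation_solution_right[OF k \<psi>(1) l'u'(1) \<psi>0, where m = m]
    obtain f f1 f2 where f': "\<forall>s>0. (f has_vector_derivative f1 s) (at s)"
      "\<forall>s>0. (f1 has_vector_derivative f2 s) (at s)" "continuous_on {0<..} f2"
      and ode': "\<forall>s>0. 4 * of_real s * f2 s + (4 * of_nat m + 6) * f1 s + of_real (k\<^sup>2) * f s = \<psi> s"
      and fu': "\<forall>s\<ge>u'. f s = 0 \<and> f1 s = 0"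
      by (elim exE conjE) blast
    note f = f'(1,2)[rule_format] f'(3) and ode = ode'[rule_format]
      and fu = fu'[rule_format, THEN conjunct1] fu'[rule_format, THEN conjunct2]
    define U where "U = max u' \<delta>"
    have U: "U < \<rho>\<^sup>2" "U \<ge> u'" "U > 0" using l'u' \<delta> by (auto simp: U_def)
    have f2U: "f2 s = 0" if "s > U" for s
    proof -
      have "s > 0" "\<psi> s = 0" using that U l'u'(3)[of s] by auto
      then show ?thesis using ode[of s] fu(1)[of s] fu(2)[of s] that U by simp
    qed
    let ?F = "\<lambda>s. of_real (\<eta> s) * f s" and ?F1 = "\<lambda>s. of_real (\<eta>1 s) * f s + of_real (\<eta> s) * f1 s"
    let ?F2 = "\<lambda>s. of_real (\<eta>2 s) * f s + 2 * of_real (\<eta>1 s) * f1 s + of_real (\<eta> s) * f2 s"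
    have "\<delta> / 3 > 0" using \<delta> by simp
    have lo': "\<eta> s = 0 \<and> \<eta>1 s = 0 \<and> \<eta>2 s = 0 \<or> f s = 0 \<and> f1 s = 0 \<and> f2 s = 0" if "s \<le> \<delta> / 3" for s
      using lo[OF that] by blast
    note cp = cutoff_product[OF f \<eta> c\<eta> \<open>\<delta> / 3 > 0\<close> lo']
    show "\<exists>F F1 F2 l' u'. {l'..u'} \<subseteq> I \<and> (\<forall>s. (F has_vector_derivative F1 s) (at s)) \<and> (\<forall>s. (F1 has_vector_derivative F2 s) (at s)) \<and>
        continuous_on UNIV F2 \<and> (\<forall>s. s \<notin> {l'..u'} \<longrightarrow> F s = 0 \<and> F1 s = 0 \<and> F2 s = 0) \<and>
        norm (radial_moment w c a m (\<lambda>s. 4 * of_real s * F2 s + (4 * of_nat m + 6) * F1 s + of_real (k\<^sup>2) * F s - \<psi> s)) < e"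
    proof (intro exI conjI allI impI)
      show "{\<delta> / 3..U} \<subseteq> I" using \<delta>(1) U by (auto simp: I_def)
      show "(?F has_vector_derivative ?F1 s) (at s)" "(?F1 has_vector_derivative ?F2 s) (at s)" "continuous_on UNIV ?F2" for s
        by (rule cp; assumption)+
      show "?F s = 0" "?F1 s = 0" "?F2 s = 0" if s: "s \<notin> {\<delta> / 3..U}" for s
      proof -
        consider "s \<le> \<delta> / 3" | "s > U" using s by force
        then have "?F s = 0 \<and> ?F1 s = 0 \<and> ?F2 s = 0"
        proof cases
          case 1 then show ?thesis using lo[OF 1] by simp
        next
          case 2 then show ?thesis using f2U[OF 2] fu(1)[of s] fu(2)[of s] U by simp
        qed
        then show "?F s = 0" "?F1 s = 0" "?F2 s = 0" by simp_all
      qed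
      let ?L = "\<lambda>s. 4 * of_real s * ?F2 s + (4 * of_nat m + 6) * ?F1 s + of_real (k\<^sup>2) * ?F s - \<psi> s"
      have wL: "w x * ?L ((x - c) \<bullet> (x - c)) = 0" for x
      proof (cases "norm (x - c) < \<epsilon>")
        case True
        then have "w x = 0" using \<epsilon>(2) by (simp add: dist_norm norm_minus_commute)
        then show ?thesis by simp
      next
        case False
        define s where "s = (x - c) \<bullet> (x - c)"
        have "\<epsilon>\<^sup>2 \<le> (norm (x - c))\<^sup>2" using False \<epsilon>(1) by (intro power_mono) auto
        then have s: "s > \<delta>" using \<delta>(2) by (simp add: s_def power2_norm_eq_inner)
        have "?L s = 0" using ode[of s] \<delta>(1) s hi[OF s] by simp
        then show ?thesis by (simp add: s_def)
      qed
      have "w x * of_real ((a \<bullet> (x - c)) ^ m) * ?L ((x - c) \<bullet> (x - c)) = 0" for x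
        using wL[of x] by (simp only: mult_eq_0_iff) blast
      then have "radial_moment w c a m ?L = 0"
        unfolding radial_moment_def by (simp only: integral_zero)
      then show "norm (radial_moment w c a m ?L) < e" using e by simp
    qed
  qed
  show ?thesis
  proof (cases "x = c")
    case True then show ?thesis using \<epsilon> by simp
  next
    case False
    have "(norm (x - c))\<^sup>2 < \<rho>\<^sup>2"
      using x \<rho> by (intro power_strict_mono) (auto simp: dist_norm norm_minus_commute)
    then have xI: "(x - c) \<bullet> (x - c) \<in> I" using False by (simp add: I_def power2_norm_eq_inner)
    have "open I" by (simp add: I_def)
    from open_ball Ck_on_2_continuous(1)[OF C2] this I show ?thesis
    proof (rule zero_if_radial_moments_vanish[OF _ _ _ _ _ xI])
      show "radial_moment w c a m \<psi> = 0" if "{l..u} \<subseteq> I" "continuous_on UNIV \<psi>" "\<And>s. s \<notin> {l..u} \<Longrightarrow> \<psi> s = 0" for a m l u \<psi>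
        by (rule van[OF that(1,2)]) (rule that(3))
    qed
  qed
qed

lemma Ck_on_subset: "Ck_on n S f \<Longrightarrow> T \<subseteq> S \<Longrightarrow> Ck_on n T f"
  by (induction n arbitrary: f) (auto intro: continuous_on_subset)

text \<open>The interior \<open>Z\<close> of the zero set is closed in \<open>G\<close>: a limit point of \<open>Z\<close> in \<open>G\<close> lies in a ball in \<open>G\<close>
  whose centre belongs to \<open>Z\<close>, and \<open>w\<close> vanishes in this ball by \<open>Helmholtz_zero_on_ball\<close>.\<close>

theorem Helmholtz_unique_continuation:
  fixes w :: "real^3 \<Rightarrow> complex"
  assumes k: "k > 0" and G: "open G" "connected G" "Ck_on 2 G w"
    and eq: "\<And>x. x \<in> G \<Longrightarrow> laplacian w x + of_real (k\<^sup>2) * w x = 0"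
    and U: "open U" "U \<noteq> {}" "U \<subseteq> G" "\<And>x. x \<in> U \<Longrightarrow> w x = 0" and x: "x \<in> G"
  shows "w x = 0"
proof -
  define Z where "Z = {x. \<exists>e>0. ball x e \<subseteq> G \<and> (\<forall>y\<in>ball x e. w y = 0)}"
  have oZ: "open Z"
  proof (subst open_contains_ball, safe)
    fix x assume "x \<in> Z"
    then obtain e where e: "e > 0" "ball x e \<subseteq> G" "\<forall>y\<in>ball x e. w y = 0" by (auto simp: Z_def)
    have "ball x (e / 2) \<subseteq> Z"
    proof
      fix y assume y: "y \<in> ball x (e / 2)"
      have "ball y (e / 2) \<subseteq> ball x e" using y by (intro subsetI) (auto intro: dist_triangle_half_r simp: dist_commute)
      then show "y \<in> Z" using e unfolding Z_def by (intro CollectI exI[of _ "e / 2"]) auto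
    qed
    then show "\<exists>e>0. ball x e \<subseteq> Z" using e by (intro exI[of _ "e / 2"]) auto
  qed
  have cl: "\<exists>r>0. ball x r \<inter> Z = {}" if x: "x \<in> G" "x \<notin> Z" for x
  proof -
    obtain \<rho> where \<rho>: "\<rho> > 0" "ball x \<rho> \<subseteq> G" using G(1) x(1) open_contains_ball by blast
    have "ball x (\<rho> / 2) \<inter> Z = {}"
    proof (rule ccontr)
      assume "ball x (\<rho> / 2) \<inter> Z \<noteq> {}"
      then obtain y where y: "dist x y < \<rho> / 2" and "y \<in> Z" by auto
      then obtain e where e: "e > 0" "\<And>z. z \<in> ball y e \<Longrightarrow> w z = 0" unfolding Z_def by blast
      have sub: "ball y (\<rho> / 2) \<subseteq> ball x \<rho>"
        using y by (intro subsetI) (auto intro: dist_triangle_half_r simp: dist_commute)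
      have "w z = 0" if "z \<in> ball y (\<rho> / 2)" for z
        by (rule Helmholtz_zero_on_ball[OF k Ck_on_subset[OF G(3)] eq e that]) (use sub \<rho>(2) in auto)
      moreover have "x \<in> ball y (\<rho> / 2)" using y by (simp add: dist_commute)
      then obtain d where "d > 0" "ball x d \<subseteq> ball y (\<rho> / 2)"
        by (meson openE open_ball)
      ultimately have "x \<in> Z" using sub \<rho>(2) unfolding Z_def by (intro CollectI exI[of _ d]) auto
      then show False using x by simp
    qed
    then show ?thesis using \<rho>(1) by (intro exI[of _ "\<rho> / 2"]) auto
  qed
  have "open (G - Z)"
  proof (subst open_contains_ball, safe)
    fix x assume x: "x \<in> G" "x \<notin> Z"
    obtain r1 where "r1 > 0" "ball x r1 \<inter> Z = {}" using cl[OF x] by blast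
    moreover obtain r2 where "r2 > 0" "ball x r2 \<subseteq> G" using G(1) x(1) open_contains_ball by blast
    ultimately show "\<exists>e>0. ball x e \<subseteq> G - Z" by (intro exI[of _ "min r1 r2"]) auto
  qed
  moreover have ZG: "Z \<subseteq> G" by (auto simp: Z_def)
  moreover have "Z \<noteq> {}"
  proof -
    obtain u where u: "u \<in> U" using U(2) by auto
    then obtain e where e: "e > 0" "ball u e \<subseteq> U" using U(1) open_contains_ball by blast
    have "u \<in> Z" unfolding Z_def using e U(3,4) by (intro CollectI exI[of _ e]) auto
    then show ?thesis by auto
  qed
  ultimately have "G - Z = {}"
    using G(2) oZ unfolding connected_def by blast
  then have "x \<in> Z" using x by auto
  then show ?thesis by (force simp: Z_def)
qed

text \<open>The solution of the radial equation that vanishes to the left of the support of \<open>\<psi>\<close> is cut off between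
  $s = N$ and $s = 2N$. It is a free spherical wave there, so the error in the equation is of order
  $N^{-(m+2)/2}$. The factor $(a \cdot x)^m$ is of order $N^{m/2}$, the function \<open>w\<close> of order $N^{-1}$, and the shell
  has volume of order $N^{3/2}$. Hence the moment of the error is of order $N^{-1/2}$.\<close>

theorem Rellich:
  fixes w :: "real^3 \<Rightarrow> complex"
  assumes k: "k > 0" and R: "R \<ge> 1" and C2: "Ck_on 2 {x. norm x > R} w"
    and eq: "\<And>x. norm x > R \<Longrightarrow> laplacian w x + of_real (k\<^sup>2) * w x = 0"
    and decay: "\<And>x. norm x > R \<Longrightarrow> norm (w x) \<le> C / (norm x)\<^sup>2"
    and x: "norm x > R"
  shows "w x = 0"
proof -
  define G where "G = {x::real^3. norm x > R}"
  define I where "I = {R\<^sup>2<..}"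
  have G: "open G" unfolding G_def by (intro open_Collect_less continuous_intros)
  have I: "x \<in> G" if "(x - 0) \<bullet> (x - 0) \<in> I" for x
  proof -
    have "R\<^sup>2 < (norm x)\<^sup>2" using that by (simp add: I_def power2_norm_eq_inner)
    then show ?thesis unfolding G_def using power2_less_imp_less[of R "norm x"] by auto
  qed
  have C: "C \<ge> 0"
  proof -
    have "0 \<le> C / (norm x)\<^sup>2" using decay[OF x] norm_ge_zero order_trans by blast
    moreover have "(norm x)\<^sup>2 > 0" using x R by (intro zero_less_power) linarith
    ultimately show ?thesis by (simp add: zero_le_divide_iff)
  qed
  note C2' = C2[folded G_def]
  have eqG: "laplacian w x + of_real (k\<^sup>2) * w x = 0" if "x \<in> G" for x
    using eq that by (simp add: G_def)
  have cw: "continuous_on G w" by (rule Ck_on_2_continuous[OF C2'])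
  obtain \<theta> \<theta>1 \<theta>2 :: "real \<Rightarrow> real" and B where \<theta>:
    "\<And>t. (\<theta> has_real_derivative \<theta>1 t) (at t)" "\<And>t. (\<theta>1 has_real_derivative \<theta>2 t) (at t)"
    "continuous_on UNIV \<theta>2" "\<And>t. t \<le> 0 \<Longrightarrow> \<theta> t = 0" "\<And>t. t \<ge> 3 \<Longrightarrow> \<theta> t = 1"
    "\<And>t. t \<notin> {0..3} \<Longrightarrow> \<theta>1 t = 0" "\<And>t. t \<notin> {0..3} \<Longrightarrow> \<theta>2 t = 0"
    and B: "\<And>t. \<bar>\<theta>1 t\<bar> \<le> B" "\<And>t. \<bar>\<theta>2 t\<bar> \<le> B"
    using C2_cutoff by metis
  have B0: "B \<ge> 0" using B(1)[of 0] by linarith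
  have van: "radial_moment w 0 a m \<psi> = 0" if "{l..u} \<subseteq> I" "continuous_on UNIV \<psi>" "\<And>s. s \<notin> {l..u} \<Longrightarrow> \<psi> s = 0" for a m l u \<psi>
  proof (rule radial_moments_vanish[OF G C2' eqG I _ that])
    fix m l u and \<psi> :: "real \<Rightarrow> complex" and e :: real
    assume lu: "{l..u} \<subseteq> I" and \<psi>: "continuous_on UNIV \<psi>" "\<forall>s. s \<notin> {l..u} \<longrightarrow> \<psi> s = 0" and e: "e > 0"
    obtain l' u' where l'u': "l' > R\<^sup>2" "\<And>s. s \<notin> {l'..u'} \<Longrightarrow> \<psi> s = 0"
    proof (cases "l \<le> u")
      case True
      then have "l \<in> I" "u \<in> I" using lu by auto
      then show ?thesis using that[of l u] \<psi>(2) by (auto simp: I_def)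
    next
      case False then show ?thesis using that[of "R\<^sup>2 + 1" 0] \<psi>(2) by auto
    qed
    have R2: "R\<^sup>2 \<ge> 1" using R by simp
    then have l'0: "l' > 0" using l'u'(1) by linarith
    have \<psi>0: "\<forall>s. s \<notin> {l'..u'} \<longrightarrow> \<psi> s = 0" using l'u'(2) by blast
    from radial_equation_solution_left[OF k \<psi>(1) l'0 \<psi>0, where m = m]
    obtain f f1 f2 A1 A2 where f': "\<forall>s>0. (f has_vector_derivative f1 s) (at s)"
      "\<forall>s>0. (f1 has_vector_derivative f2 s) (at s)" "continuous_on {0<..} f2"
      and ode': "\<forall>s>0. 4 * of_real s * f2 s + (4 * of_nat m + 6) * f1 s + of_real (k\<^sup>2) * f s = \<psi> s"
      and fl': "\<forall>s\<le>l'. f s = 0 \<and> f1 s = 0"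
      and fu': "\<forall>s\<ge>u'. f s = A1 * spherical_wave k m s - A2 * cnj (spherical_wave k m s) \<and>
        f1 s = A1 * spherical_wave k (Suc m) s - A2 * cnj (spherical_wave k (Suc m) s)"
      by (elim exE conjE) blast
    note f = f'(1,2)[rule_format] f'(3) and ode = ode'[rule_format]
      and fl = fl'[rule_format, THEN conjunct1] fl'[rule_format, THEN conjunct2]
      and fu = fu'[rule_format, THEN conjunct1] fu'[rule_format, THEN conjunct2]
    obtain D1 where D1: "D1 > 0" "\<And>s. s \<ge> 1 \<Longrightarrow> norm (spherical_wave k m s) \<le> D1 * (1 / sqrt s) ^ (m + 1)"
      using spherical_wave_bound by metis
    obtain D2 where D2: "D2 > 0" "\<And>s. s \<ge> 1 \<Longrightarrow> norm (spherical_wave k (Suc m) s) \<le> D2 * (1 / sqrt s) ^ (Suc m + 1)"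
      using spherical_wave_bound by metis
    define A where "A = norm A1 + norm A2"
    have A0: "A \<ge> 0" by (simp add: A_def)
    have bd: "norm (f s) \<le> A * D1 * (1 / z) ^ (m + 1)" "norm (f1 s) \<le> A * D2 * (1 / z) ^ (m + 2)"
      if "s \<ge> u'" "s \<ge> z\<^sup>2" "z \<ge> 1" for s z
    proof -
      have s1: "s \<ge> 1" using that(2,3) by (smt (verit) one_le_power)
      have z: "1 / sqrt s \<le> 1 / z" using that(2,3) s1 real_le_rsqrt[of z s] by (intro divide_left_mono mult_pos_pos) auto
      have "norm (f s) \<le> A * norm (spherical_wave k m s)"
        unfolding fu(1)[OF that(1)] A_def
        by (rule order_trans[OF norm_triangle_ineq4]) (simp add: norm_mult ring_distribs)
      also have "\<dots> \<le> A * (D1 * (1 / sqrt s) ^ (m + 1))" using D1(2)[OF s1] A0 by (rule mult_left_mono)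
      also have "\<dots> \<le> A * (D1 * (1 / z) ^ (m + 1))"
        using A0 D1(1) z s1 by (intro mult_left_mono power_mono) auto
      finally show "norm (f s) \<le> A * D1 * (1 / z) ^ (m + 1)" by simp
      have "norm (f1 s) \<le> A * norm (spherical_wave k (Suc m) s)"
        unfolding fu(2)[OF that(1)] A_def
        by (rule order_trans[OF norm_triangle_ineq4]) (simp add: norm_mult ring_distribs)
      also have "\<dots> \<le> A * (D2 * (1 / sqrt s) ^ (Suc m + 1))" using D2(2)[OF s1] A0 by (rule mult_left_mono)
      also have "\<dots> \<le> A * (D2 * (1 / z) ^ (Suc m + 1))"
        using A0 D2(1) z s1 by (intro mult_left_mono power_mono) auto
      finally show "norm (f1 s) \<le> A * D2 * (1 / z) ^ (m + 2)" by simp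
    qed
    define E where "E = 72 * B * A * D1 + 48 * B * A * D2 + (12 * real m + 18) * B * A * D1"
    have E0: "E \<ge> 0" unfolding E_def using B0 A0 D1(1) D2(1) by simp
    define Q where "Q = C * (2 * norm a) ^ m * E * unit_ball_vol 3 * 8"
    (* z is the square root of the scale N of the cutoff; the moment of the error will be at most Q / z. *)
    obtain z :: real where z: "z \<ge> 1" "z\<^sup>2 > u'" "z\<^sup>2 > l'" "Q / z < e"
    proof
      define z where "z = max (max 1 (\<bar>u'\<bar> + 1)) (max (l' + 1) (\<bar>Q\<bar> / e + 1))"
      have z: "z \<ge> 1" "z \<ge> \<bar>u'\<bar> + 1" "z \<ge> l' + 1" "z \<ge> \<bar>Q\<bar> / e + 1" by (auto simp: z_def)
      have "z * 1 \<le> z * z" using z(1) by (intro mult_left_mono) auto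
      then have zz: "z \<le> z\<^sup>2" by (simp add: power2_eq_square)
      show "z \<ge> 1" "z\<^sup>2 > u'" "z\<^sup>2 > l'" using z zz by linarith+
      have "\<bar>Q\<bar> / e < z" using z(4) by linarith
      then have "\<bar>Q\<bar> < z * e" using e by (simp add: field_simps)
      then show "Q / z < e" using z(1) by (simp add: field_simps abs_less_iff)
    qed
    define N where "N = z\<^sup>2"
    have N: "N \<ge> 1" "N > u'" "N > l'" using z by (simp_all add: N_def)
    (* The cutoff falls from 1 at s = N to 0 at s = 2 * N. *)
    define \<eta> where "\<eta> = (\<lambda>s. 1 + (- 1) * \<theta> (3 / N * s + (- 3)))"
    define \<eta>1 where "\<eta>1 = (\<lambda>s. (- 3 / N) * \<theta>1 (3 / N * s + (- 3)))"
    define \<eta>2 where "\<eta>2 = (\<lambda>s. (- 3 / N) * (3 / N * \<theta>2 (3 / N * s + (- 3))))"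
    have \<eta>: "(\<eta> has_real_derivative \<eta>1 s) (at s)" "(\<eta>1 has_real_derivative \<eta>2 s) (at s)" for s
    proof -
      show "(\<eta> has_real_derivative \<eta>1 s) (at s)" unfolding \<eta>_def \<eta>1_def
        using DERIV_add[OF DERIV_const[of 1] DERIV_affine[OF \<theta>(1), of "- 1" "3 / N" "- 3" s]] by simp
      show "(\<eta>1 has_real_derivative \<eta>2 s) (at s)" unfolding \<eta>1_def \<eta>2_def
        by (rule DERIV_affine[OF \<theta>(2)])
    qed
    have c\<eta>: "continuous_on UNIV \<eta>2" unfolding \<eta>2_def
      by (intro continuous_intros continuous_on_compose2[OF \<theta>(3)]) auto
    have lo: "\<eta> s = 1" "\<eta>1 s = 0" "\<eta>2 s = 0" if "s < N" for s
    proof -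
      have "3 / N * s < 3" using that N(1) by (simp add: field_simps)
      then show "\<eta> s = 1" "\<eta>1 s = 0" "\<eta>2 s = 0" using \<theta>(4,6,7) by (simp_all add: \<eta>_def \<eta>1_def \<eta>2_def)
    qed
    have hi: "\<eta> s = 0" "\<eta>1 s = 0" "\<eta>2 s = 0" if "s > 2 * N" for s
    proof -
      have "3 / N * s > 6" using that N(1) by (simp add: field_simps)
      then show "\<eta> s = 0" "\<eta>1 s = 0" "\<eta>2 s = 0" using \<theta>(5,6,7) by (simp_all add: \<eta>_def \<eta>1_def \<eta>2_def)
    qed
    have f2l: "f2 s = 0" if "s > 0" "s < l'" for s
      using ode[OF that(1)] fl(1)[of s] fl(2)[of s] that l'u'(2)[of s] by simp
    let ?F = "\<lambda>s. of_real (\<eta> s) * f s" and ?F1 = "\<lambda>s. of_real (\<eta>1 s) * f s + of_real (\<eta> s) * f1 s"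
    (* The values of f2 for s \<le> 0 are arbitrary; f vanishes there, so 0 is the value that fits. *)
    define g2 where "g2 = (\<lambda>s. if s > 0 then f2 s else 0)"
    have g2: "\<And>s. s > 0 \<Longrightarrow> (f1 has_vector_derivative g2 s) (at s)" using f(2) by (simp add: g2_def)
    have cg2: "continuous_on {0<..} g2" using f(3) by (rule continuous_on_eq) (simp add: g2_def)
    let ?F2 = "\<lambda>s. of_real (\<eta>2 s) * f s + 2 * of_real (\<eta>1 s) * f1 s + of_real (\<eta> s) * g2 s"
    define b where "b = (R\<^sup>2 + l') / 2"
    have b: "b > 0" "b > R\<^sup>2" "b < l'" using l'u'(1) R2 by (auto simp: b_def)
    have fb: "f s = 0 \<and> f1 s = 0 \<and> g2 s = 0" if "s \<le> b" for s
      using that b(3) fl(1)[of s] fl(2)[of s] f2l[of s] by (auto simp: g2_def)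
    have fb': "\<eta> s = 0 \<and> \<eta>1 s = 0 \<and> \<eta>2 s = 0 \<or> f s = 0 \<and> f1 s = 0 \<and> g2 s = 0" if "s \<le> b" for s
      using fb[OF that] by blast
    note cp = cutoff_product[OF f(1) g2 cg2 \<eta> c\<eta> b(1) fb']
    show "\<exists>F F1 F2 l' u'. {l'..u'} \<subseteq> I \<and> (\<forall>s. (F has_vector_derivative F1 s) (at s)) \<and> (\<forall>s. (F1 has_vector_derivative F2 s) (at s)) \<and>
        continuous_on UNIV F2 \<and> (\<forall>s. s \<notin> {l'..u'} \<longrightarrow> F s = 0 \<and> F1 s = 0 \<and> F2 s = 0) \<and>
        norm (radial_moment w 0 a m (\<lambda>s. 4 * of_real s * F2 s + (4 * of_nat m + 6) * F1 s + of_real (k\<^sup>2) * F s - \<psi> s)) < e"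
    proof (intro exI conjI allI impI)
      show "{b..2 * N} \<subseteq> I" using b(2) by (auto simp: I_def)
      show "(?F has_vector_derivative ?F1 s) (at s)" "(?F1 has_vector_derivative ?F2 s) (at s)" "continuous_on UNIV ?F2" for s
        by (rule cp; assumption)+
      show "?F s = 0" "?F1 s = 0" "?F2 s = 0" if s: "s \<notin> {b..2 * N}" for s
      proof -
        consider "s \<le> b" | "s > 2 * N" using s by force
        then have "?F s = 0 \<and> ?F1 s = 0 \<and> ?F2 s = 0"
        proof cases
          case 1 then show ?thesis using fb[OF 1] by simp
        next
          case 2 then show ?thesis using hi[OF 2] by simp
        qed
        then show "?F s = 0" "?F1 s = 0" "?F2 s = 0" by simp_all
      qed
      let ?L = "\<lambda>s. 4 * of_real s * ?F2 s + (4 * of_nat m + 6) * ?F1 s + of_real (k\<^sup>2) * ?F s - \<psi> s"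
      have L0: "?L s = 0" if "s < N" "s > 0" for s
        using ode[OF that(2)] lo[OF that(1)] that(2) by (simp add: g2_def)
      have L0': "?L s = 0" if "s \<le> 0" for s
        using fb[of s] that b(1) l'u'(2)[of s] l'0 by simp
      have Lhi: "?L s = 0" if "s > 2 * N" for s
        using hi[OF that] that N l'u'(2)[of s] by simp
      have Lb: "norm (?L s) \<le> E * (1 / z) ^ (m + 2)" if s: "N \<le> s" "s \<le> 2 * N" for s
      proof -
        have s0: "s > 0" "s > u'" "s \<ge> z\<^sup>2" "s \<ge> u'" using s N by (auto simp: N_def)
        define X where "X = A * D1 * (1 / z) ^ (m + 1)"
        define Y where "Y = A * D2 * (1 / z) ^ (m + 2)"
        have X: "norm (f s) \<le> X" and Y: "norm (f1 s) \<le> Y"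
          unfolding X_def Y_def by (rule bd[OF s0(4,3) z(1)])+
        have e1: "\<bar>\<eta>1 s\<bar> \<le> 3 * B / N"
        proof -
          have "\<bar>\<eta>1 s\<bar> = 3 / N * \<bar>\<theta>1 (3 / N * s + (- 3))\<bar>" using N(1) by (simp add: \<eta>1_def abs_mult)
          also have "\<dots> \<le> 3 / N * B" using N(1) by (intro mult_left_mono B) auto
          finally show ?thesis by simp
        qed
        have e2: "\<bar>\<eta>2 s\<bar> \<le> 9 * B / N\<^sup>2"
        proof -
          have "\<bar>\<eta>2 s\<bar> = 9 / N\<^sup>2 * \<bar>\<theta>2 (3 / N * s + (- 3))\<bar>" using N(1) by (simp add: \<eta>2_def abs_mult power2_eq_square)
          also have "\<dots> \<le> 9 / N\<^sup>2 * B" using N(1) by (intro mult_left_mono B) auto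
          finally show ?thesis by simp
        qed
        have "?L s = of_real (\<eta> s) * (4 * of_real s * f2 s + (4 * of_nat m + 6) * f1 s + of_real (k\<^sup>2) * f s)
          + 4 * of_real s * (of_real (\<eta>2 s) * f s + 2 * of_real (\<eta>1 s) * f1 s)
          + (4 * of_nat m + 6) * of_real (\<eta>1 s) * f s - \<psi> s"
          using s0(1) by (simp add: g2_def algebra_simps)
        also have "\<dots> = of_real (4 * s) * (of_real (\<eta>2 s) * f s + of_real (2 * \<eta>1 s) * f1 s)
          + of_real (4 * real m + 6) * of_real (\<eta>1 s) * f s"
          unfolding ode[OF s0(1)] using l'u'(2)[of s] s0(2) by simp
        finally have L: "?L s = of_real (4 * s) * (of_real (\<eta>2 s) * f s + of_real (2 * \<eta>1 s) * f1 s)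
          + of_real (4 * real m + 6) * of_real (\<eta>1 s) * f s" .
        have "norm (?L s) \<le> norm (of_real (4 * s) * (of_real (\<eta>2 s) * f s + of_real (2 * \<eta>1 s) * f1 s))
           + norm (of_real (4 * real m + 6) * of_real (\<eta>1 s) * f s)" unfolding L by (rule norm_triangle_ineq)
        also have "\<dots> = (4 * s) * norm (of_real (\<eta>2 s) * f s + of_real (2 * \<eta>1 s) * f1 s)
           + (4 * real m + 6) * \<bar>\<eta>1 s\<bar> * norm (f s)"
          unfolding norm_mult norm_of_real using s0(1) by simp
        also have "\<dots> \<le> (8 * N) * (9 * B / N\<^sup>2 * X + 2 * (3 * B / N) * Y) + (4 * real m + 6) * (3 * B / N) * X"
        proof (rule add_mono)
          have "norm (of_real (\<eta>2 s) * f s + of_real (2 * \<eta>1 s) * f1 s) \<le> \<bar>\<eta>2 s\<bar> * norm (f s) + 2 * \<bar>\<eta>1 s\<bar> * norm (f1 s)"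
            by (rule order_trans[OF norm_triangle_ineq]) (simp only: norm_mult norm_of_real abs_mult abs_numeral order_refl)
          also have "\<dots> \<le> 9 * B / N\<^sup>2 * X + 2 * (3 * B / N) * Y"
            using e1 e2 X Y B0 N(1) by (intro add_mono mult_mono mult_nonneg_nonneg) auto
          finally have n: "norm (of_real (\<eta>2 s) * f s + of_real (2 * \<eta>1 s) * f1 s) \<le> 9 * B / N\<^sup>2 * X + 2 * (3 * B / N) * Y" .
          have "4 * s \<le> 8 * N" "0 \<le> 8 * N" using s(2) N(1) by simp_all
          then show "(4 * s) * norm (of_real (\<eta>2 s) * f s + of_real (2 * \<eta>1 s) * f1 s)
              \<le> (8 * N) * (9 * B / N\<^sup>2 * X + 2 * (3 * B / N) * Y)"
            by (intro mult_mono[OF _ n]) simp_all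
          show "(4 * real m + 6) * \<bar>\<eta>1 s\<bar> * norm (f s) \<le> (4 * real m + 6) * (3 * B / N) * X"
            using e1 X B0 N(1) by (intro mult_mono) auto
        qed
        also have "\<dots> = 72 * B * (X / N) + 48 * B * Y + (12 * real m + 18) * B * (X / N)"
          using N(1) by (simp add: field_simps power2_eq_square)
        also have "\<dots> \<le> 72 * B * (A * D1 * (1 / z) ^ (m + 2)) + 48 * B * Y + (12 * real m + 18) * B * (A * D1 * (1 / z) ^ (m + 2))"
        proof -
          have "X / N = A * D1 * (1 / z) ^ (m + 3)" by (simp add: X_def N_def power_divide power_add power2_eq_square power3_eq_cube)
          also have "\<dots> \<le> A * D1 * (1 / z) ^ (m + 2)"
            using A0 D1(1) z(1) by (intro mult_left_mono power_decreasing) auto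
          finally show ?thesis using B0 by (intro add_mono mult_left_mono) auto
        qed
        also have "\<dots> = E * (1 / z) ^ (m + 2)" unfolding E_def Y_def by (simp add: ring_distribs mult_ac)
        finally show ?thesis .
      qed
      have cL: "continuous_on UNIV ?L"
      proof -
        have c: "continuous_on UNIV ?F" "continuous_on UNIV ?F1"
          using cp(1,2) by (meson continuous_at_imp_continuous_on has_vector_derivative_continuous)+
        have c2: "continuous_on UNIV ?F2" by (rule cp; assumption)
        have "continuous_on UNIV (\<lambda>s. 4 * of_real s * H2 s + (4 * of_nat m + 6) * H1 s + of_real (k\<^sup>2) * H0 s - \<psi> s)"
          if "continuous_on UNIV H0" "continuous_on UNIV H1" "continuous_on UNIV H2" for H0 H1 H2
          by (intro continuous_intros that \<psi>(1))
        from this[OF c c2] show ?thesis .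
      qed
      define M where "M = C * (2 * norm a) ^ m * E / z ^ 4"
      have M0: "M \<ge> 0" unfolding M_def using C E0 z(1) by simp
      define V where "V = (\<lambda>x::real^3. w x * of_real ((a \<bullet> (x - 0)) ^ m) * ?L ((x - 0) \<bullet> (x - 0)))"
      have int: "integrable lborel V" unfolding V_def
      proof (rule integrable_on_shell[OF cw _ cL, of _ N "2 * N"])
        show "?L s = 0" if "s \<notin> {N..2 * N}" for s
          using that L0[of s] L0'[of s] Lhi[of s] by (cases "s < N"; cases "s > 0") auto
        show "x \<in> G" if "(x - 0) \<bullet> (x - 0) \<in> {N..2 * N}" for x :: "real^3"
          by (rule I) (use that N(3) l'u'(1) in \<open>auto simp: I_def\<close>)
      qed (intro continuous_intros)
      have bound: "norm (V x) \<le> indicator (cball 0 (2 * z)) x *\<^sub>R M" for x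
      proof -
        define s where "s = (norm x)\<^sup>2"
        have sx: "(x - 0) \<bullet> (x - 0) = s" by (simp add: s_def power2_norm_eq_inner)
        show ?thesis
        proof (cases "N \<le> s \<and> s \<le> 2 * N")
          case False
          then have "?L s = 0" using L0[of s] L0'[of s] Lhi[of s] by (cases "s < N"; cases "s > 0") auto
          then have "V x = 0" unfolding V_def sx by simp
          then show ?thesis using M0 by simp
        next
          case True
          have xz: "norm x \<le> 2 * z"
          proof (rule power2_le_imp_le)
            show "(norm x)\<^sup>2 \<le> (2 * z)\<^sup>2" using True by (simp add: s_def N_def power_mult_distrib)
          qed (use z(1) in simp)
          have xR: "norm x > R"
          proof -
            have "R\<^sup>2 < (norm x)\<^sup>2" using True N(3) l'u'(1) by (simp add: s_def)
            then show ?thesis using power2_less_imp_less[of R "norm x"] by simp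
          qed
          have sN: "s \<ge> N" "s * N > 0" using True N(1) by simp_all
          have "norm (w x) \<le> C / N"
            using decay[OF xR] divide_left_mono[OF sN(1) C sN(2)] by (simp add: s_def)
          moreover have "\<bar>a \<bullet> (x - 0)\<bar> ^ m \<le> (2 * norm a * z) ^ m"
          proof (rule power_mono)
            have "\<bar>a \<bullet> x\<bar> \<le> norm a * norm x" by (rule Cauchy_Schwarz_ineq2)
            also have "\<dots> \<le> norm a * (2 * z)" using xz by (rule mult_left_mono) simp
            finally show "\<bar>a \<bullet> (x - 0)\<bar> \<le> 2 * norm a * z" by simp
          qed simp
          moreover have "norm (?L s) \<le> E * (1 / z) ^ (m + 2)" using Lb True by blast
          ultimately have "norm (w x) * \<bar>a \<bullet> (x - 0)\<bar> ^ m * norm (?L s) \<le> (C / N) * (2 * norm a * z) ^ m * (E * (1 / z) ^ (m + 2))"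
            using C N(1) E0 z(1) by (intro mult_mono mult_nonneg_nonneg) auto
          also have "\<dots> = M"
            using z(1) unfolding M_def N_def by (simp add: power_mult_distrib power_divide power_add field_simps power2_eq_square power4_eq_xxxx)
          finally have "norm (V x) \<le> M" unfolding V_def sx norm_mult norm_of_real power_abs .
          then show ?thesis using xz by simp
        qed
      qed
      have "norm (radial_moment w 0 a m ?L) = norm (integral\<^sup>L lborel V)" by (simp add: radial_moment_def V_def)
      also have "\<dots> \<le> (LINT x|lborel. norm (V x))" by (rule integral_norm_bound)
      also have "\<dots> \<le> (LINT x|lborel. indicator (cball 0 (2 * z)) (x::real^3) *\<^sub>R M)"
        by (rule integral_mono[OF integrable_norm[OF int] borel_integrable_compact bound]) auto
      also have "\<dots> = M * measure lborel (cball (0::real^3) (2 * z))" by simp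
      also have "\<dots> = Q / z"
        using z(1) by (simp add: content_cball M_def Q_def field_simps power3_eq_cube power4_eq_xxxx)
      also have "\<dots> < e" by (rule z(4))
      finally show "norm (radial_moment w 0 a m ?L) < e" .
    qed
  qed
  show ?thesis
  proof -
    have "R\<^sup>2 < (norm x)\<^sup>2" using x R by (intro power_strict_mono) auto
    then have xI: "(x - 0) \<bullet> (x - 0) \<in> I" by (simp add: I_def power2_norm_eq_inner)
    have "open I" by (simp add: I_def)
    from G cw this I show ?thesis
    proof (rule zero_if_radial_moments_vanish[OF _ _ _ _ _ xI])
      show "radial_moment w 0 a m \<psi> = 0" if "{l..u} \<subseteq> I" "continuous_on UNIV \<psi>" "\<And>s. s \<notin> {l..u} \<Longrightarrow> \<psi> s = 0" for a m l u \<psi>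
        by (rule van[OF that(1,2)]) (rule that(3))
    qed
  qed
qed

section \<open>Smooth functions and mollification\<close>

lemma Ck_on_UNIV_Suc:
  assumes "\<And>x. (f has_derivative f' x) (at x)" "\<And>v. Ck_on m UNIV (\<lambda>x. f' x v)"
  shows "Ck_on (Suc m) UNIV f"
proof -
  have "frechet_derivative f (at x) = f' x" for x using frechet_derivative_at[OF assms(1)] by simp
  then show ?thesis using assms by (auto simp: differentiable_def)
qed

lemma Ck_on_SucD:
  assumes "Ck_on (Suc m) UNIV f"
  shows "(f has_derivative frechet_derivative f (at x)) (at x)"
    "Ck_on m UNIV (\<lambda>x. frechet_derivative f (at x) v)"
proof -
  have "f differentiable (at x)" using assms unfolding Ck_on.simps by blast
  then show "(f has_derivative frechet_derivative f (at x)) (at x)" by (rule frechet_derivative_works[THEN iffD1])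
  show "Ck_on m UNIV (\<lambda>x. frechet_derivative f (at x) v)" using assms unfolding Ck_on.simps by blast
qed

lemma Ck_on_imp_less: "Ck_on (Suc m) UNIV f \<Longrightarrow> Ck_on m UNIV f"
proof (induction m arbitrary: f)
  case 0
  then show ?case using Ck_on_SucD(1)[OF 0]
    by (simp del: Ck_on.simps(2)) (meson continuous_at_imp_continuous_on has_derivative_continuous)
next
  case (Suc m)
  show ?case
    by (rule Ck_on_UNIV_Suc[OF Ck_on_SucD(1)[OF Suc.prems] Suc.IH[OF Ck_on_SucD(2)[OF Suc.prems]]])
qed

lemma Ck_on_const: "Ck_on m UNIV (\<lambda>x. c)"
proof (induction m arbitrary: c)
  case (Suc m)
  show ?case by (rule Ck_on_UNIV_Suc[of _ "\<lambda>_ _. 0"]) (use Suc in auto)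
qed simp

lemma Ck_on_linear:
  assumes "bounded_linear f"
  shows "Ck_on m UNIV f"
proof (cases m)
  case 0
  then show ?thesis using assms by (simp add: linear_continuous_on)
next
  case (Suc n)
  show ?thesis unfolding Suc
    by (rule Ck_on_UNIV_Suc[of _ "\<lambda>_. f"]) (use assms bounded_linear_imp_has_derivative Ck_on_const in auto)
qed

lemma Ck_on_add: "Ck_on m UNIV f \<Longrightarrow> Ck_on m UNIV g \<Longrightarrow> Ck_on m UNIV (\<lambda>x. f x + g x)"
proof (induction m arbitrary: f g)
  case (Suc m)
  show ?case
    by (rule Ck_on_UNIV_Suc[OF has_derivative_add[OF Ck_on_SucD(1)[OF Suc.prems(1)] Ck_on_SucD(1)[OF Suc.prems(2)]]])
       (rule Suc.IH[OF Ck_on_SucD(2)[OF Suc.prems(1)] Ck_on_SucD(2)[OF Suc.prems(2)]])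
qed (auto intro!: continuous_intros)

lemma Ck_on_mult:
  fixes f g :: "'a::euclidean_space \<Rightarrow> real"
  shows "Ck_on m UNIV f \<Longrightarrow> Ck_on m UNIV g \<Longrightarrow> Ck_on m UNIV (\<lambda>x. f x * g x)"
proof (induction m arbitrary: f g)
  case (Suc m)
  show ?case
    by (rule Ck_on_UNIV_Suc[OF has_derivative_mult[OF Ck_on_SucD(1)[OF Suc.prems(1)] Ck_on_SucD(1)[OF Suc.prems(2)]]])
       (rule Ck_on_add Suc.IH Ck_on_imp_less[OF Suc.prems(1)] Ck_on_imp_less[OF Suc.prems(2)]
          Ck_on_SucD(2)[OF Suc.prems(1)] Ck_on_SucD(2)[OF Suc.prems(2)])+
qed (auto intro!: continuous_intros)

text \<open>The derivative of a member of this family is a linear combination of members, so all of them are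
  smooth, in particular $e^{-1/t}$ extended by zero.\<close>

definition flat :: "nat \<Rightarrow> real \<Rightarrow> real" where
  "flat j t = (if t > 0 then inverse t ^ j * exp (- inverse t) else 0)"

text \<open>Keep the single term $y^{j+1}/(j+1)!$ of the exponential series of $y = 1/t$.\<close>

lemma flat_bound: "\<bar>flat j t\<bar> \<le> fact (Suc j) * \<bar>t\<bar>"
proof (cases "t > 0")
  case True
  define y where "y = inverse t"
  have y: "y > 0" using True by (simp add: y_def)
  have s: "(\<lambda>n. y ^ n / fact n) sums exp y" using exp_converges[of y] by (simp add: field_simps)
  have "(\<Sum>n\<in>{Suc j}. y ^ n / fact n) \<le> (\<Sum>n. y ^ n / fact n)"
    by (rule sum_le_suminf[OF sums_summable[OF s]]) (use y in auto)
  then have "y ^ Suc j / fact (Suc j) \<le> exp y" using sums_unique[OF s] by simp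
  then have "y * y ^ j \<le> fact (Suc j) * exp y" by (simp add: pos_divide_le_eq mult.commute del: fact_Suc)
  then have "y ^ j * exp (- y) \<le> fact (Suc j) * inverse y"
    using y by (simp add: exp_minus field_simps del: fact_Suc)
  then show ?thesis using True y by (simp add: flat_def y_def abs_mult)
next
  case False
  then have "flat j t = 0" by (simp add: flat_def)
  then show ?thesis by (simp del: fact_Suc)
qed

lemma flat_deriv: "(flat j has_real_derivative flat (j + 2) t - real j * flat (j + 1) t) (at t)"
proof -
  consider "t > 0" | "t < 0" | "t = 0" by linarith
  then show ?thesis
  proof cases
    case 1
    let ?d = "inverse t ^ j * (exp (- inverse t) * (inverse t * inverse t)) - (real j * inverse t ^ (j - 1) * (inverse t * inverse t)) * exp (- inverse t)"
    have "((\<lambda>t. inverse t ^ j * exp (- inverse t)) has_real_derivative ?d) (at t)"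
      using 1 by (auto intro!: derivative_eq_intros simp: algebra_simps)
    moreover have "?d = flat (j + 2) t - real j * flat (j + 1) t"
      using 1 by (cases j) (simp_all add: flat_def algebra_simps)
    ultimately have "((\<lambda>t. inverse t ^ j * exp (- inverse t)) has_real_derivative flat (j + 2) t - real j * flat (j + 1) t) (at t)"
      by simp
    then show ?thesis
      by (rule has_field_derivative_transform_within_open[of _ _ _ "{0<..}"]) (use 1 in \<open>auto simp: flat_def\<close>)
  next
    case 2
    have "((\<lambda>t. 0) has_real_derivative 0) (at t)" by simp
    then have "(flat j has_real_derivative 0) (at t)"
      by (rule has_field_derivative_transform_within_open[of _ _ _ "{..<0}"]) (use 2 in \<open>auto simp: flat_def\<close>)
    then show ?thesis using 2 by (simp add: flat_def)
  next
    case 3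
    have "((\<lambda>h. flat j h / h) \<longlongrightarrow> 0) (at 0)"
    proof (rule Lim_null_comparison)
      show "((\<lambda>h::real. fact (Suc (Suc j)) * \<bar>h\<bar>) \<longlongrightarrow> 0) (at 0)"
        by (rule tendsto_eq_intros | simp)+
      show "\<forall>\<^sub>F h in at 0. norm (flat j h / h) \<le> fact (Suc (Suc j)) * \<bar>h\<bar>"
      proof (rule always_eventually, rule allI)
        fix h :: real
        have "flat j h / h = flat (Suc j) h" by (simp add: flat_def field_simps)
        then show "norm (flat j h / h) \<le> fact (Suc (Suc j)) * \<bar>h\<bar>" using flat_bound[of "Suc j" h] by simp
      qed
    qed
    then have "(flat j has_real_derivative 0) (at 0)" unfolding DERIV_def by (simp add: flat_def)
    then show ?thesis using 3 by (simp add: flat_def)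
  qed
qed

lemma Ck_on_flat_radial: "Ck_on m UNIV (\<lambda>x::'a::euclidean_space. flat j (r - x \<bullet> x))"
proof (induction m arbitrary: j)
  case 0
  have "continuous_on UNIV (flat j)"
    using flat_deriv by (meson DERIV_isCont continuous_at_imp_continuous_on)
  then have "continuous_on UNIV (\<lambda>x::'a. flat j (r - x \<bullet> x))"
    by (rule continuous_on_compose2) (auto intro!: continuous_intros)
  then show ?case by simp
next
  case (Suc m)
  have d: "((\<lambda>x. flat j (r - x \<bullet> x)) has_derivative
      (\<lambda>v. (flat (j + 2) (r - x \<bullet> x) + (- real j) * flat (j + 1) (r - x \<bullet> x)) * (- 2 * (x \<bullet> v)))) (at x)" for x :: 'a
  proof -
    have "((\<lambda>x::'a. r - x \<bullet> x) has_derivative (\<lambda>v. - 2 * (x \<bullet> v))) (at x)"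
      by (auto intro!: derivative_eq_intros simp: inner_commute)
    from has_derivative_compose[OF this flat_deriv[unfolded has_field_derivative_def]]
    show ?thesis by simp
  qed
  have lin: "Ck_on m UNIV (\<lambda>x::'a. x \<bullet> v)" for v by (rule Ck_on_linear) (rule bounded_linear_inner_left)
  show ?case
    by (rule Ck_on_UNIV_Suc[OF d]) (intro Ck_on_mult Ck_on_add Ck_on_const Suc lin)
qed

lemma mollifier_exists:
  assumes "\<delta> > 0"
  obtains \<rho> :: "'a::euclidean_space \<Rightarrow> real" where "\<And>m. Ck_on m UNIV \<rho>" "\<And>x. \<rho> x \<ge> 0"
    "\<And>x. norm x \<ge> \<delta> \<Longrightarrow> \<rho> x = 0" "(LINT x|lborel. \<rho> x) = 1"
proof -
  define \<beta> where "\<beta> = (\<lambda>x::'a. flat 0 (\<delta>\<^sup>2 - x \<bullet> x))"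
  have C: "Ck_on m UNIV \<beta>" for m unfolding \<beta>_def by (rule Ck_on_flat_radial)
  have cont: "continuous_on UNIV \<beta>" using C[of 0] by simp
  have nn: "\<beta> x \<ge> 0" for x by (simp add: \<beta>_def flat_def)
  have z: "\<beta> x = 0" if "norm x \<ge> \<delta>" for x
  proof -
    have "\<delta>\<^sup>2 \<le> (norm x)\<^sup>2" using that assms by (intro power_mono) auto
    then show ?thesis by (simp add: \<beta>_def flat_def power2_norm_eq_inner)
  qed
  have int: "integrable lborel \<beta>"
    by (rule integrable_continuous_compact_support[OF cont, of "cball 0 \<delta>"]) (use z in auto)
  define c where "c = (LINT x|lborel. \<beta> x)"
  have "c \<noteq> 0"
  proof
    assume "c = 0"
    then have "\<beta> 0 = 0" using integral_continuous_eq_0[OF cont nn int] by (simp add: c_def)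
    then show False using assms by (simp add: \<beta>_def flat_def)
  qed
  moreover have "c \<ge> 0" unfolding c_def using nn by simp
  ultimately have c: "c > 0" by simp
  show ?thesis
  proof (rule that[of "\<lambda>x. (1 / c) * \<beta> x"])
    show "Ck_on m UNIV (\<lambda>x. (1 / c) * \<beta> x)" for m by (intro Ck_on_mult Ck_on_const C)
    show "(LINT x|lborel. (1 / c) * \<beta> x) = 1" using c by (simp add: c_def)
  qed (use c nn z in auto)
qed

lemma compact_support_uniformly_continuous:
  fixes f :: "'a::euclidean_space \<Rightarrow> 'b::real_normed_vector"
  assumes cont: "continuous_on UNIV f" and K: "compact K" "\<And>x. x \<notin> K \<Longrightarrow> f x = 0" and e: "e > 0"
  obtains d where "d > 0" "\<And>x y. dist x y < d \<Longrightarrow> dist (f x) (f y) < e"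
proof -
  obtain R where R: "\<And>x. x \<in> K \<Longrightarrow> norm x \<le> R" using K(1) compact_imp_bounded bounded_iff by metis
  have "uniformly_continuous_on (cball 0 (R + 1)) f"
    by (rule compact_uniformly_continuous[OF continuous_on_subset[OF cont]]) auto
  then obtain d where d: "d > 0" "\<And>x y. x \<in> cball 0 (R + 1) \<Longrightarrow> y \<in> cball 0 (R + 1) \<Longrightarrow> dist y x < d \<Longrightarrow> dist (f y) (f x) < e"
    using e unfolding uniformly_continuous_on_def by metis
  show ?thesis
  proof (rule that[of "min d 1"])
    fix x y :: 'a assume xy: "dist x y < min d 1"
    have n: "norm x \<le> norm y + 1" "norm y \<le> norm x + 1"
      using xy norm_triangle_sub[of x y] norm_triangle_sub[of y x] by (auto simp: dist_norm norm_minus_commute)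
    show "dist (f x) (f y) < e"
    proof (cases "norm x \<le> R + 1 \<and> norm y \<le> R + 1")
      case True then show ?thesis using d(2)[of y x] xy by simp
    next
      case False
      then have "norm x > R" "norm y > R" using n by auto
      then have "x \<notin> K" "y \<notin> K" using R by force+
      then show ?thesis using K(2) e by simp
    qed
  qed (use d in auto)
qed

text \<open>The derivative of \<open>g\<close> is uniformly continuous, hence the error of its linearisation is uniform in the
  base point and can be integrated against \<open>\<phi>\<close>. The sign \<open>s\<close> covers both $\int \varphi(y) g(y + x)\,dy$ and
  $\int \varphi(y) g(y - x)\,dy$.\<close>

lemma has_derivative_convolution:
  fixes g :: "'a::euclidean_space \<Rightarrow> real" and \<phi> :: "'a \<Rightarrow> real"
  assumes g: "\<And>x. (g has_derivative g' x) (at x)" "\<And>v. continuous_on UNIV (\<lambda>x. g' x v)"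
    and K: "compact K" "\<And>x. x \<notin> K \<Longrightarrow> g x = 0"
    and \<phi>: "continuous_on UNIV \<phi>" "compact L" "\<And>x. x \<notin> L \<Longrightarrow> \<phi> x = 0" and s: "\<bar>s\<bar> = 1"
  shows "((\<lambda>x. LINT y|lborel. \<phi> y * g (y + s *\<^sub>R x)) has_derivative
    (\<lambda>v. LINT y|lborel. \<phi> y * (s * g' (y + s *\<^sub>R x) v))) (at x)"
proof -
  have lin: "bounded_linear (g' x)" for x using g(1) has_derivative_bounded_linear by blast
  have g'0: "g' x v = 0" if "x \<notin> K" for x v
  proof -
    have op: "open (- K)" using K by (simp add: compact_imp_closed open_Compl)
    have "((\<lambda>_. 0) has_derivative (\<lambda>_. 0)) (at x)" by simp
    then have "(g has_derivative (\<lambda>_. 0)) (at x)"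
      by (rule has_derivative_transform_within_open[OF _ op]) (use that K(2) in auto)
    from has_derivative_unique[OF g(1) this] show ?thesis by simp
  qed
  have cg: "continuous_on UNIV g" using g(1) by (meson continuous_at_imp_continuous_on has_derivative_continuous)
  have int: "integrable lborel (\<lambda>y. \<phi> y * h (y + s *\<^sub>R x))" if "continuous_on UNIV h" for h x
    by (rule integrable_continuous_compact_support[OF _ \<phi>(2)])
       (use \<phi> in \<open>auto intro!: continuous_intros continuous_on_compose2[OF that]\<close>)
  have int': "integrable lborel (\<lambda>y. \<phi> y * (s * g' (y + s *\<^sub>R x) v))" for x v
    by (rule int[of "\<lambda>p. s * g' p v"]) (intro continuous_intros g(2))
  define C where "C = (LINT y|lborel. \<bar>\<phi> y\<bar>)"
  have iC: "integrable lborel (\<lambda>y. \<bar>\<phi> y\<bar>)" using integrable_norm[OF int[of "\<lambda>_. 1" 0]] by (simp add: continuous_on_const)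
  have C: "C \<ge> 0" by (simp add: C_def)
  (* The error of the linearisation of g is uniformly small, by uniform continuity of the derivatives
     in the finitely many basis directions. *)
  have unif: "\<exists>d>0. \<forall>p h. norm h < d \<longrightarrow> \<bar>g (p + h) - g p - g' p h\<bar> \<le> e * norm h" if "e > 0" for e
  proof -
    have "\<exists>d>0. \<forall>x y. dist x y < d \<longrightarrow> \<bar>g' x b - g' y b\<bar> < e / DIM('a)" for b
    proof -
      have "e / DIM('a) > 0" using that by simp
      then obtain d where "d > 0" "\<And>x y. dist x y < d \<Longrightarrow> dist (g' x b) (g' y b) < e / DIM('a)"
        using compact_support_uniformly_continuous[OF g(2)[of b] K(1) g'0] by blast
      then show ?thesis by (intro exI[of _ d]) (auto simp: dist_real_def)
    qed
    then obtain d where d: "\<And>b. d b > 0" "\<And>b x y. dist x y < d b \<Longrightarrow> \<bar>g' x b - g' y b\<bar> < e / DIM('a)" by metis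
    define D where "D = Min (d ` (Basis::'a set))"
    have D: "D > 0" "\<And>b. b \<in> Basis \<Longrightarrow> D \<le> d b" using d(1) by (auto simp: D_def)
    have "\<bar>g (p + h) - g p - g' p h\<bar> \<le> e * norm h" if h: "norm h < D" for p h
    proof -
      have "norm (g (p + h) - g p - g' p (p + h - p)) \<le> norm (p + h - p) * e"
      proof (rule differentiable_bound_linearization[where S = "ball p D"])
        show "p + t *\<^sub>R (p + h - p) \<in> ball p D" if "t \<in> {0..1}" for t
        proof -
          have "norm (t *\<^sub>R h) \<le> 1 * norm h" unfolding norm_scaleR using that by (intro mult_right_mono) auto
          then show ?thesis using h by (simp add: dist_norm)
        qed
        show "(g has_derivative g' x) (at x within ball p D)" for x using g(1) has_derivative_at_withinI by blast
        show "onorm (g' x - g' p) \<le> e" if x: "x \<in> ball p D" for x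
        proof (rule onorm_le)
          fix v
          have l: "bounded_linear (\<lambda>v. g' x v - g' p v)" using lin by (intro bounded_linear_sub)
          have "g' x v - g' p v = (\<lambda>v. g' x v - g' p v) (\<Sum>b\<in>Basis. (v \<bullet> b) *\<^sub>R b)" by (simp add: euclidean_representation)
          also have "\<dots> = (\<Sum>b\<in>Basis. (v \<bullet> b) *\<^sub>R (g' x b - g' p b))"
            by (simp only: linear_sum[OF bounded_linear.linear[OF l]] linear_cmul[OF bounded_linear.linear[OF l]])
          also have "\<bar>\<dots>\<bar> \<le> (\<Sum>b\<in>Basis. \<bar>(v \<bullet> b) *\<^sub>R (g' x b - g' p b)\<bar>)" by (rule sum_abs)
          also have "\<dots> \<le> (\<Sum>b\<in>(Basis::'a set). norm v * (e / DIM('a)))"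
          proof (rule sum_mono)
            fix b :: 'a assume b: "b \<in> Basis"
            have "\<bar>v \<bullet> b\<bar> \<le> norm v" using b by (rule Basis_le_norm)
            moreover have "dist x p < d b" using x D(2)[OF b] by (simp add: dist_commute)
            then have "\<bar>g' x b - g' p b\<bar> \<le> e / DIM('a)" using d(2) less_imp_le by blast
            ultimately show "\<bar>(v \<bullet> b) *\<^sub>R (g' x b - g' p b)\<bar> \<le> norm v * (e / DIM('a))"
              unfolding real_scaleR_def abs_mult by (intro mult_mono) auto
          qed
          also have "\<dots> = e * norm v" by simp
          finally show "norm ((g' x - g' p) v) \<le> e * norm v" by simp
        qed
        show "p \<in> ball p D" using D by simp
      qed
      then show ?thesis by (simp add: mult.commute)
    qed
    then show ?thesis using D(1) by blast
  qed
  show ?thesis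
    unfolding has_derivative_at_alt
  proof (intro conjI allI impI)
    show "bounded_linear (\<lambda>v. LINT y|lborel. \<phi> y * (s * g' (y + s *\<^sub>R x) v))"
    proof (rule linear_conv_bounded_linear[THEN iffD1], rule linearI)
      fix v w :: 'a and r :: real
      show "(LINT y|lborel. \<phi> y * (s * g' (y + s *\<^sub>R x) (v + w))) =
         (LINT y|lborel. \<phi> y * (s * g' (y + s *\<^sub>R x) v)) + (LINT y|lborel. \<phi> y * (s * g' (y + s *\<^sub>R x) w))"
        using int'[of x v] int'[of x w] by (simp add: linear_add[OF bounded_linear.linear[OF lin]] ring_distribs)
      show "(LINT y|lborel. \<phi> y * (s * g' (y + s *\<^sub>R x) (r *\<^sub>R v))) = r *\<^sub>R (LINT y|lborel. \<phi> y * (s * g' (y + s *\<^sub>R x) v))"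
        by (simp add: linear_cmul[OF bounded_linear.linear[OF lin]] mult.left_commute[of _ r])
    qed
    fix e :: real assume e: "e > 0"
    then have "e / (C + 1) > 0" using C by simp
    then obtain d where d: "d > 0" "\<And>p h. norm h < d \<Longrightarrow> \<bar>g (p + h) - g p - g' p h\<bar> \<le> e / (C + 1) * norm h"
      using unif by blast
    show "\<exists>d>0. \<forall>y. norm (y - x) < d \<longrightarrow>
      norm ((LINT z|lborel. \<phi> z * g (z + s *\<^sub>R y)) - (LINT z|lborel. \<phi> z * g (z + s *\<^sub>R x)) -
        (LINT z|lborel. \<phi> z * (s * g' (z + s *\<^sub>R x) (y - x)))) \<le> e * norm (y - x)"
    proof (intro exI[of _ d] conjI allI impI d(1))
      fix y assume y: "norm (y - x) < d"
      let ?r = "\<lambda>z. \<phi> z * g (z + s *\<^sub>R y) - \<phi> z * g (z + s *\<^sub>R x) - \<phi> z * (s * g' (z + s *\<^sub>R x) (y - x))"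
      have r: "\<bar>?r z\<bar> \<le> \<bar>\<phi> z\<bar> * (e / (C + 1) * norm (y - x))" for z
      proof -
        define p where "p = z + s *\<^sub>R x"
        define h where "h = s *\<^sub>R (y - x)"
        have n: "norm h = norm (y - x)" using s by (simp add: h_def)
        have gh: "g' p h = s * g' p (y - x)" by (simp add: h_def linear_cmul[OF bounded_linear.linear[OF lin]])
        have ph: "p + h = z + s *\<^sub>R y" by (simp add: p_def h_def algebra_simps)
        have "?r z = \<phi> z * (g (p + h) - g p - g' p h)"
          unfolding gh ph unfolding p_def by (simp add: right_diff_distrib)
        then have "\<bar>?r z\<bar> = \<bar>\<phi> z\<bar> * \<bar>g (p + h) - g p - g' p h\<bar>" by (simp add: abs_mult)
        also have "\<dots> \<le> \<bar>\<phi> z\<bar> * (e / (C + 1) * norm h)" using d(2)[of h p] y n by (intro mult_left_mono) auto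
        finally show ?thesis by (simp add: n)
      qed
      have "(LINT z|lborel. \<phi> z * g (z + s *\<^sub>R y)) - (LINT z|lborel. \<phi> z * g (z + s *\<^sub>R x)) -
        (LINT z|lborel. \<phi> z * (s * g' (z + s *\<^sub>R x) (y - x))) = (LINT z|lborel. ?r z)"
        using int[OF cg] int' by simp
      also have "norm \<dots> \<le> (LINT z|lborel. \<bar>\<phi> z\<bar> * (e / (C + 1) * norm (y - x)))"
        by (rule order_trans[OF integral_norm_bound integral_mono]) (use int[OF cg] int' iC r in auto)
      also have "\<dots> = C * (e / (C + 1)) * norm (y - x)" by (simp add: C_def)
      also have "\<dots> \<le> e * norm (y - x)"
        using C e by (intro mult_right_mono) (auto simp: field_simps)
      finally show "norm ((LINT z|lborel. \<phi> z * g (z + s *\<^sub>R y)) - (LINT z|lborel. \<phi> z * g (z + s *\<^sub>R x)) -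
        (LINT z|lborel. \<phi> z * (s * g' (z + s *\<^sub>R x) (y - x)))) \<le> e * norm (y - x)" .
    qed
  qed
qed

text \<open>All derivatives fall on the kernel \<open>\<rho>\<close>, whose directional derivatives satisfy the same hypotheses.\<close>

lemma convolution_Ck:
  fixes f \<rho> :: "'a::euclidean_space \<Rightarrow> real"
  assumes f: "continuous_on UNIV f" "compact K" "\<And>x. x \<notin> K \<Longrightarrow> f x = 0"
    and \<rho>: "\<And>m. Ck_on m UNIV \<rho>" "compact L" "\<And>x. x \<notin> L \<Longrightarrow> \<rho> x = 0"
  shows "Ck_on m UNIV (\<lambda>x. LINT y|lborel. f y * \<rho> (y - x))"
  using \<rho>(1,3)
proof (induction m arbitrary: \<rho>)
  case (0 \<rho>)
  have "((\<lambda>x. LINT y|lborel. f y * \<rho> (y + (- 1) *\<^sub>R x)) has_derivative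
    (\<lambda>v. LINT y|lborel. f y * (- 1 * frechet_derivative \<rho> (at (y + (- 1) *\<^sub>R x)) v))) (at x)" for x
    by (rule has_derivative_convolution[OF _ _ \<rho>(2) _ f])
       (use Ck_on_SucD[OF 0(1)[of "Suc 0"]] 0(2) in auto)
  then have "continuous_on UNIV (\<lambda>x. LINT y|lborel. f y * \<rho> (y + (- 1) *\<^sub>R x))"
    by (meson continuous_at_imp_continuous_on has_derivative_continuous)
  then show ?case by simp
next
  case (Suc m \<rho>)
  define \<rho>' where "\<rho>' = (\<lambda>v x. frechet_derivative \<rho> (at x) v)"
  have d: "((\<lambda>x. LINT y|lborel. f y * \<rho> (y + (- 1) *\<^sub>R x)) has_derivative
    (\<lambda>v. LINT y|lborel. f y * (- 1 * frechet_derivative \<rho> (at (y + (- 1) *\<^sub>R x)) v))) (at x)" for x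
    by (rule has_derivative_convolution[OF _ _ \<rho>(2) _ f])
       (use Ck_on_SucD[OF Suc.prems(1)[of "Suc 0"]] Suc.prems(2) in auto)
  have c: "Ck_on m UNIV (\<rho>' v)" for m v
    unfolding \<rho>'_def by (rule Ck_on_SucD(2)[OF Suc.prems(1)])
  have z: "\<rho>' v x = 0" if "x \<notin> L" for v x
  proof -
    have op: "open (- L)" using \<rho>(2) by (simp add: compact_imp_closed open_Compl)
    have "((\<lambda>_. 0) has_derivative (\<lambda>_. 0)) (at x)" by simp
    then have "(\<rho> has_derivative (\<lambda>_. 0)) (at x)"
      by (rule has_derivative_transform_within_open[OF _ op]) (use that Suc.prems(2) in auto)
    from fun_cong[OF frechet_derivative_at[OF this], of v] show ?thesis by (simp add: \<rho>'_def)
  qed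
  have eq: "(LINT y|lborel. f y * (- 1 * frechet_derivative \<rho> (at (y + (- 1) *\<^sub>R x)) v)) = - 1 * (LINT y|lborel. f y * \<rho>' v (y - x))" for x v
    by (simp add: \<rho>'_def)
  have "Ck_on (Suc m) UNIV (\<lambda>x. LINT y|lborel. f y * \<rho> (y + (- 1) *\<^sub>R x))"
    by (rule Ck_on_UNIV_Suc[OF d]) (unfold eq, intro Ck_on_mult Ck_on_const Suc.IH[OF c z])
  then show ?case by (simp del: Ck_on.simps)
qed

lemma mollification_close:
  fixes g \<rho> :: "'a::euclidean_space \<Rightarrow> real"
  assumes \<rho>: "continuous_on UNIV \<rho>" "\<And>x. \<rho> x \<ge> 0" "\<And>x. norm x \<ge> \<delta> \<Longrightarrow> \<rho> x = 0" "(LINT x|lborel. \<rho> x) = 1"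
    and g: "continuous_on UNIV g" "\<And>p q. dist p q < \<delta> \<Longrightarrow> \<bar>g p - g q\<bar> \<le> e"
  shows "\<bar>(LINT y|lborel. \<rho> y * g (y + x)) - g x\<bar> \<le> e"
proof -
  have int: "integrable lborel (\<lambda>y. \<rho> y * h y)" if "continuous_on UNIV h" for h
    by (rule integrable_continuous_compact_support[of _ "cball 0 \<delta>"]) (use \<rho> that in \<open>auto intro!: continuous_intros\<close>)
  have cg: "continuous_on UNIV (\<lambda>y. g (y + x))" by (rule continuous_on_compose2[OF g(1)]) (auto intro!: continuous_intros)
  have i1: "integrable lborel \<rho>" using int[of "\<lambda>_. 1"] by (simp add: continuous_on_const)
  have "(LINT y|lborel. \<rho> y * g (y + x)) - g x = (LINT y|lborel. \<rho> y * g (y + x)) - (LINT y|lborel. \<rho> y * g x)"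
    using \<rho>(4) by simp
  also have "\<dots> = (LINT y|lborel. \<rho> y * g (y + x) - \<rho> y * g x)" using int[OF cg] i1 by simp
  also have "\<bar>\<dots>\<bar> \<le> (LINT y|lborel. \<rho> y * e)"
  proof (rule order_trans[OF integral_abs_bound integral_mono])
    fix y
    show "\<bar>\<rho> y * g (y + x) - \<rho> y * g x\<bar> \<le> \<rho> y * e"
    proof (cases "norm y < \<delta>")
      case True
      then have "\<bar>g (y + x) - g x\<bar> \<le> e" by (intro g(2)) (simp add: dist_norm)
      then have "\<rho> y * \<bar>g (y + x) - g x\<bar> \<le> \<rho> y * e" using \<rho>(2) by (rule mult_left_mono)
      then show ?thesis using \<rho>(2)[of y] by (simp add: abs_mult flip: right_diff_distrib)
    qed (use \<rho>(3) in auto)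
  qed (use int[OF cg] i1 in auto)
  also have "\<dots> = e" using \<rho>(4) by simp
  finally show ?thesis .
qed

lemma grad_inner:
  assumes "(f has_derivative f') (at x)"
  shows "grad f x \<bullet> v = f' v"
proof -
  have f': "frechet_derivative f (at x) = f'" using frechet_derivative_at[OF assms] by simp
  have l: "linear f'" using assms has_derivative_linear by blast
  have "f' v = f' (\<Sum>b\<in>Basis. (v \<bullet> b) *\<^sub>R b)" by (simp add: euclidean_representation)
  also have "\<dots> = (\<Sum>b\<in>Basis. (v \<bullet> b) * f' b)" by (simp add: linear_sum[OF l] linear_cmul[OF l])
  also have "\<dots> = grad f x \<bullet> v" unfolding grad_def f' inner_sum_left inner_scaleR_left by (simp add: inner_commute mult.commute)
  finally show ?thesis by simp
qed

lemma grad_eq_0: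
  assumes "closed K" "\<And>x. x \<notin> K \<Longrightarrow> f x = 0" "x \<notin> K"
  shows "grad f x = 0"
proof -
  have op: "open (- K)" using assms(1) by (simp add: open_Compl)
  have "((\<lambda>_. 0) has_derivative (\<lambda>_. 0)) (at x)" by simp
  then have "(f has_derivative (\<lambda>_. 0)) (at x)"
    by (rule has_derivative_transform_within_open[OF _ op]) (use assms in auto)
  from frechet_derivative_at[OF this, symmetric] show ?thesis by (simp add: grad_def)
qed

lemma Ck_on_1_grad:
  assumes "Ck_on 1 UNIV f"
  shows "(f has_derivative (\<lambda>v. grad f x \<bullet> v)) (at x)" "continuous_on UNIV f" "continuous_on UNIV (grad f)"
proof -
  have C: "Ck_on (Suc 0) UNIV f" using assms by simp
  note d = Ck_on_SucD(1)[OF C]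
  have "frechet_derivative f (at x) = (\<lambda>v. grad f x \<bullet> v)" for x using grad_inner[OF d] by auto
  then show 1: "(f has_derivative (\<lambda>v. grad f x \<bullet> v)) (at x)" for x using d[of x] by simp
  show "continuous_on UNIV f" using 1 by (meson continuous_at_imp_continuous_on has_derivative_continuous)
  have "continuous_on UNIV (\<lambda>x. frechet_derivative f (at x) b)" for b using Ck_on_SucD(2)[OF C, of b] by simp
  then show "continuous_on UNIV (grad f)" unfolding grad_def[abs_def] by (intro continuous_intros)
qed

lemma test_function_iff:
  "test_function U f \<longleftrightarrow> (\<forall>m. Ck_on m UNIV f) \<and> (\<exists>K. compact K \<and> K \<subseteq> U \<and> (\<forall>x. x \<notin> K \<longrightarrow> f x = 0))"
proof
  assume "test_function U f"
  then show "(\<forall>m. Ck_on m UNIV f) \<and> (\<exists>K. compact K \<and> K \<subseteq> U \<and> (\<forall>x. x \<notin> K \<longrightarrow> f x = 0))"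
    unfolding test_function_def using closure_subset[of "{x. f x \<noteq> 0}"] by blast
next
  assume *: "(\<forall>m. Ck_on m UNIV f) \<and> (\<exists>K. compact K \<and> K \<subseteq> U \<and> (\<forall>x. x \<notin> K \<longrightarrow> f x = 0))"
  then obtain K where K: "compact K" "K \<subseteq> U" "{x. f x \<noteq> 0} \<subseteq> K" by blast
  then have "closure {x. f x \<noteq> 0} \<subseteq> K" by (simp add: closure_minimal compact_imp_closed)
  then show "test_function U f" unfolding test_function_def
    using * K compact_closure bounded_subset[OF compact_imp_bounded[OF K(1)] K(3)] by auto
qed

text \<open>Mollification at a scale below the distance of \<open>K\<close> from the complement of \<open>U\<close>. Since \<open>K'\<close> does not
  depend on \<open>e\<close>, uniform closeness implies closeness in the mean square.\<close>

lemma test_function_approximation: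
  fixes f :: "'a::euclidean_space \<Rightarrow> real"
  assumes U: "open U" and f: "Ck_on 1 UNIV f" and K: "compact K" "K \<subseteq> U" "\<And>x. x \<notin> K \<Longrightarrow> f x = 0"
  obtains K' where "compact K'" "K \<subseteq> K'"
    "\<And>e. e > 0 \<Longrightarrow> \<exists>h. test_function U h \<and> (\<forall>x. x \<notin> K' \<longrightarrow> h x = 0) \<and> (\<forall>x. \<bar>h x - f x\<bar> \<le> e \<and> norm (grad h x - grad f x) \<le> e)"
proof (cases "K = {}")
  case True
  then have f0: "f = (\<lambda>_. 0)" using K(3) by auto
  have "test_function U (\<lambda>_. 0)" unfolding test_function_iff using Ck_on_const by blast
  then show ?thesis using that[of "{}"] True f0 by (metis abs_zero compact_empty diff_self empty_subsetI less_imp_le norm_zero)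
next
  case False
  obtain \<epsilon> where \<epsilon>: "\<epsilon> > 0" "{x. infdist x K \<le> \<epsilon>} \<subseteq> U"
    using compact_in_open_separated[OF False K(1) U K(2)] by metis
  define K' where "K' = {x. infdist x K \<le> \<epsilon>}"
  have K': "compact K'" unfolding K'_def by (rule compact_infdist_le[OF False K(1) \<epsilon>(1)])
  have KK': "K \<subseteq> K'" using \<epsilon>(1) by (auto simp: K'_def)
  note F = Ck_on_1_grad[OF f]
  have ex: "\<exists>h. test_function U h \<and> (\<forall>x. x \<notin> K' \<longrightarrow> h x = 0) \<and> (\<forall>x. \<bar>h x - f x\<bar> \<le> e \<and> norm (grad h x - grad f x) \<le> e)" if e: "e > 0" for e
  proof -
    have cK: "closed K" using K(1) compact_imp_closed by blast
    obtain d1 where d1: "d1 > 0" "\<And>x y. dist x y < d1 \<Longrightarrow> dist (f x) (f y) < e"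
      using compact_support_uniformly_continuous[OF F(2) K(1,3) e] by blast
    have "e / DIM('a) > 0" using e by simp
    then obtain d2 where d2: "d2 > 0" "\<And>x y. dist x y < d2 \<Longrightarrow> dist (grad f x) (grad f y) < e / DIM('a)"
      using compact_support_uniformly_continuous[OF F(3) K(1) grad_eq_0[OF cK K(3)]] by blast
    define \<delta> where "\<delta> = min \<epsilon> (min d1 d2)"
    have \<delta>: "\<delta> > 0" "\<delta> \<le> \<epsilon>" "\<delta> \<le> d1" "\<delta> \<le> d2" using \<epsilon>(1) d1 d2 by (auto simp: \<delta>_def)
    obtain \<rho> :: "'a \<Rightarrow> real" where \<rho>: "\<And>m. Ck_on m UNIV \<rho>" "\<And>x. \<rho> x \<ge> 0" "\<And>x. norm x \<ge> \<delta> \<Longrightarrow> \<rho> x = 0" "(LINT x|lborel. \<rho> x) = 1"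
      using mollifier_exists[OF \<delta>(1)] by blast
    have c\<rho>: "continuous_on UNIV \<rho>" using \<rho>(1)[of 0] by simp
    have \<rho>0: "\<rho> x = 0" if "x \<notin> cball 0 \<delta>" for x using that \<rho>(3)[of x] by simp
    define h where "h = (\<lambda>x. LINT y|lborel. \<rho> y * f (y + 1 *\<^sub>R x))"
    have h_eq: "h x = (LINT y|lborel. f y * \<rho> (y - x))" for x
    proof -
      have m: "(\<lambda>y. f y * \<rho> (y - x)) \<in> borel_measurable borel"
        by (rule borel_measurable_continuous_onI) (intro continuous_intros F(2) continuous_on_compose2[OF c\<rho>], auto)
      show ?thesis using integral_translation[OF m, of x] by (simp add: h_def mult.commute)
    qed
    have Ch: "Ck_on m UNIV h" for m
      unfolding h_eq[abs_def] by (rule convolution_Ck[OF F(2) K(1,3) \<rho>(1) compact_cball \<rho>0])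
    have h0: "h x = 0" if x: "x \<notin> K'" for x
    proof -
      have "\<rho> y * f (y + 1 *\<^sub>R x) = 0" for y
      proof (rule ccontr)
        assume n: "\<rho> y * f (y + 1 *\<^sub>R x) \<noteq> 0"
        then have y: "norm y < \<delta>" "y + x \<in> K" using \<rho>(3)[of y] K(3)[of "y + x"] by force+
        have "infdist x K \<le> dist x (y + x)" by (rule infdist_le[OF y(2)])
        then show False using y(1) \<delta>(2) x by (simp add: K'_def dist_norm)
      qed
      then have "(\<lambda>y. \<rho> y * f (y + 1 *\<^sub>R x)) = (\<lambda>_. 0)" by (rule ext)
      then show ?thesis by (simp only: h_def integral_zero)
    qed
    have test: "test_function U h" unfolding test_function_iff using Ch K' h0 \<epsilon>(2) unfolding K'_def[symmetric] by blast
    have close: "\<bar>h x - f x\<bar> \<le> e" for x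
      unfolding h_def scaleR_one
    proof (rule mollification_close[OF c\<rho> \<rho>(2-4) F(2)])
      show "\<bar>f p - f q\<bar> \<le> e" if "dist p q < \<delta>" for p q
        using d1(2)[of p q] that \<delta>(3) by (simp add: dist_real_def)
    qed
    have dh: "(h has_derivative (\<lambda>v. LINT y|lborel. \<rho> y * (1 * (grad f (y + 1 *\<^sub>R x) \<bullet> v)))) (at x)" for x
      unfolding h_def
      by (rule has_derivative_convolution[OF F(1) _ K(1,3) c\<rho> compact_cball[of 0 \<delta>] \<rho>0])
         (auto intro!: continuous_intros F(3))
    have close': "\<bar>(grad h x - grad f x) \<bullet> b\<bar> \<le> e / DIM('a)" if b: "b \<in> Basis" for x b
    proof -
      have "(grad h x - grad f x) \<bullet> b = (LINT y|lborel. \<rho> y * (grad f (y + x) \<bullet> b)) - grad f x \<bullet> b"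
        using grad_inner[OF dh] by (simp add: inner_diff_left)
      also have "\<bar>\<dots>\<bar> \<le> e / DIM('a)"
      proof (rule mollification_close[OF c\<rho> \<rho>(2-4)])
        show "continuous_on UNIV (\<lambda>y. grad f y \<bullet> b)" by (intro continuous_intros F(3))
        show "\<bar>grad f p \<bullet> b - grad f q \<bullet> b\<bar> \<le> e / DIM('a)" if "dist p q < \<delta>" for p q
        proof -
          have "\<bar>grad f p \<bullet> b - grad f q \<bullet> b\<bar> \<le> norm (grad f p - grad f q)"
            using Basis_le_norm[OF b, of "grad f p - grad f q"] by (simp add: inner_diff_left)
          also have "\<dots> < e / DIM('a)" using d2(2)[of p q] that \<delta>(4) by (simp add: dist_norm)
          finally show ?thesis by simp
        qed
      qed
      finally show ?thesis .
    qed
    have "norm (grad h x - grad f x) \<le> e" for x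
    proof -
      have "norm (grad h x - grad f x) \<le> (\<Sum>b\<in>Basis. \<bar>(grad h x - grad f x) \<bullet> b\<bar>)" by (rule norm_le_l1)
      also have "\<dots> \<le> (\<Sum>b\<in>(Basis::'a set). e / DIM('a))" by (rule sum_mono) (rule close')
      finally show ?thesis by simp
    qed
    then show ?thesis using test h0 close by blast
  qed
  show ?thesis by (rule that[OF K' KK' ex])
qed

section \<open>Square integrable functions\<close>

definition square_integrable :: "'x measure \<Rightarrow> ('x \<Rightarrow> 'b::euclidean_space) \<Rightarrow> bool" where
  "square_integrable M f \<longleftrightarrow> f \<in> borel_measurable M \<and> integrable M (\<lambda>x. (norm (f x))\<^sup>2)"

lemma integrable_inner:
  fixes f g :: "'x \<Rightarrow> 'b::euclidean_space"
  assumes f: "square_integrable M f" and g: "square_integrable M g"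
  shows "integrable M (\<lambda>x. f x \<bullet> g x)"
proof (rule Bochner_Integration.integrable_bound)
  show "integrable M (\<lambda>x. (norm (f x))\<^sup>2 + (norm (g x))\<^sup>2)"
    using f g by (simp add: square_integrable_def)
  show "(\<lambda>x. f x \<bullet> g x) \<in> borel_measurable M"
    using f g by (intro borel_measurable_inner) (simp_all add: square_integrable_def)
  have "norm (f x \<bullet> g x) \<le> norm ((norm (f x))\<^sup>2 + (norm (g x))\<^sup>2)" for x
  proof -
    have "\<bar>f x \<bullet> g x\<bar> \<le> norm (f x) * norm (g x)" by (rule Cauchy_Schwarz_ineq2)
    moreover have "0 \<le> (norm (f x) - norm (g x))\<^sup>2" by simp
    moreover have "0 \<le> norm (f x) * norm (g x)" by simp
    ultimately show ?thesis by (simp add: power2_diff)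
  qed
  then show "AE x in M. norm (f x \<bullet> g x) \<le> norm ((norm (f x))\<^sup>2 + (norm (g x))\<^sup>2)" by simp
qed

lemma square_integrable_lincomb:
  fixes f g :: "'x \<Rightarrow> 'b::euclidean_space"
  assumes f: "square_integrable M f" and g: "square_integrable M g"
  shows "square_integrable M (\<lambda>x. a *\<^sub>R f x + b *\<^sub>R g x)"
    "(LINT x|M. (norm (a *\<^sub>R f x + b *\<^sub>R g x))\<^sup>2) =
       a\<^sup>2 * (LINT x|M. (norm (f x))\<^sup>2) + 2 * a * b * (LINT x|M. f x \<bullet> g x) + b\<^sup>2 * (LINT x|M. (norm (g x))\<^sup>2)"
proof -
  have eq: "(norm (a *\<^sub>R f x + b *\<^sub>R g x))\<^sup>2 = a\<^sup>2 * (norm (f x))\<^sup>2 + 2 * a * b * (f x \<bullet> g x) + b\<^sup>2 * (norm (g x))\<^sup>2" for x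
    unfolding power2_norm_eq_inner
    by (simp add: inner_add_left inner_add_right inner_commute power2_eq_square algebra_simps)
  show "square_integrable M (\<lambda>x. a *\<^sub>R f x + b *\<^sub>R g x)"
    using f g integrable_inner[OF f g] unfolding square_integrable_def eq by auto
  show "(LINT x|M. (norm (a *\<^sub>R f x + b *\<^sub>R g x))\<^sup>2) =
       a\<^sup>2 * (LINT x|M. (norm (f x))\<^sup>2) + 2 * a * b * (LINT x|M. f x \<bullet> g x) + b\<^sup>2 * (LINT x|M. (norm (g x))\<^sup>2)"
    using f g integrable_inner[OF f g] unfolding square_integrable_def eq by simp
qed

lemma square_integrable_diff:
  fixes f g :: "'x \<Rightarrow> 'b::euclidean_space"
  assumes f: "square_integrable M f" and g: "square_integrable M g"
  shows "square_integrable M (\<lambda>x. f x - g x)"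
  using square_integrable_lincomb(1)[OF f g, of 1 "- 1"] by simp

text \<open>The source of the Cauchy--Schwarz inequality for semidefinite forms, which is why $c = 0$ is included.\<close>

lemma quadratic_nonneg_imp_discriminant_le:
  fixes a b c :: real
  assumes "\<And>t. a + 2 * b * t + c * t\<^sup>2 \<ge> 0" "c \<ge> 0"
  shows "b\<^sup>2 \<le> a * c"
proof (cases "c = 0")
  case True
  have "b = 0"
  proof (rule ccontr)
    assume "b \<noteq> 0"
    have "0 \<le> a + 2 * b * (- (\<bar>a\<bar> + 1) / (2 * b))" using assms(1)[of "- (\<bar>a\<bar> + 1) / (2 * b)"] True by simp
    also have "\<dots> = a - (\<bar>a\<bar> + 1)" using \<open>b \<noteq> 0\<close> by (simp add: field_simps)
    finally show False by linarith
  qed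
  then show ?thesis using True by simp
next
  case False
  then have c: "c > 0" using assms(2) by simp
  have "0 \<le> c * (a + 2 * b * (- b / c) + c * (- b / c)\<^sup>2)" using assms(1)[of "- b / c"] c by simp
  also have "\<dots> = a * c - b\<^sup>2" using c by (simp add: field_simps power2_eq_square)
  finally show ?thesis by simp
qed

lemma Cauchy_Schwarz_integral:
  fixes f g :: "'x \<Rightarrow> 'b::euclidean_space"
  assumes f: "square_integrable M f" and g: "square_integrable M g"
  shows "(LINT x|M. f x \<bullet> g x)\<^sup>2 \<le> (LINT x|M. (norm (f x))\<^sup>2) * (LINT x|M. (norm (g x))\<^sup>2)"
proof (rule quadratic_nonneg_imp_discriminant_le)
  fix t :: real
  have "0 \<le> (LINT x|M. (norm (1 *\<^sub>R f x + t *\<^sub>R g x))\<^sup>2)" by simp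
  then show "0 \<le> (LINT x|M. (norm (f x))\<^sup>2) + 2 * (LINT x|M. f x \<bullet> g x) * t + (LINT x|M. (norm (g x))\<^sup>2) * t\<^sup>2"
    unfolding square_integrable_lincomb(2)[OF f g] by (simp add: mult_ac)
qed simp

lemma L2_tendsto_inner:
  fixes f :: "nat \<Rightarrow> 'x \<Rightarrow> 'b::euclidean_space"
  assumes f: "\<And>n. square_integrable M (f n)" "square_integrable M u" "(\<lambda>n. LINT x|M. (norm (f n x - u x))\<^sup>2) \<longlonglongrightarrow> 0"
    and h: "square_integrable M h"
  shows "(\<lambda>n. LINT x|M. f n x \<bullet> h x) \<longlonglongrightarrow> (LINT x|M. u x \<bullet> h x)"
proof -
  have "(\<lambda>n. (LINT x|M. (f n x - u x) \<bullet> h x)\<^sup>2) \<longlonglongrightarrow> 0"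
  proof (rule tendsto_sandwich[OF always_eventually always_eventually tendsto_const])
    show "\<forall>n. (LINT x|M. (f n x - u x) \<bullet> h x)\<^sup>2 \<le> (LINT x|M. (norm (f n x - u x))\<^sup>2) * (LINT x|M. (norm (h x))\<^sup>2)"
      using Cauchy_Schwarz_integral[OF square_integrable_diff[OF f(1,2)] h] by blast
    show "(\<lambda>n. (LINT x|M. (norm (f n x - u x))\<^sup>2) * (LINT x|M. (norm (h x))\<^sup>2)) \<longlonglongrightarrow> 0"
      using tendsto_mult_right[OF f(3)] by simp
  qed simp
  from tendsto_real_sqrt[OF this] have "(\<lambda>n. \<bar>LINT x|M. (f n x - u x) \<bullet> h x\<bar>) \<longlonglongrightarrow> 0" by simp
  then have "(\<lambda>n. LINT x|M. (f n x - u x) \<bullet> h x) \<longlonglongrightarrow> 0" by (simp only: tendsto_rabs_zero_iff)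
  moreover have "(LINT x|M. (f n x - u x) \<bullet> h x) = (LINT x|M. f n x \<bullet> h x) - (LINT x|M. u x \<bullet> h x)" for n
    using integrable_inner[OF f(1) h] integrable_inner[OF f(2) h] by (simp add: inner_diff_left)
  ultimately show ?thesis by (simp add: LIM_zero_iff)
qed

lemma L2_tendsto_norm:
  fixes f :: "nat \<Rightarrow> 'x \<Rightarrow> 'b::euclidean_space"
  assumes f: "\<And>n. square_integrable M (f n)" "square_integrable M u" "(\<lambda>n. LINT x|M. (norm (f n x - u x))\<^sup>2) \<longlonglongrightarrow> 0"
  shows "(\<lambda>n. LINT x|M. (norm (f n x))\<^sup>2) \<longlonglongrightarrow> (LINT x|M. (norm (u x))\<^sup>2)"
proof -
  have "(LINT x|M. (norm (f n x))\<^sup>2) = (LINT x|M. (norm (f n x - u x))\<^sup>2) + 2 * (LINT x|M. f n x \<bullet> u x) - (LINT x|M. (norm (u x))\<^sup>2)" for n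
    using square_integrable_lincomb(2)[OF f(1)[of n] f(2), of 1 "- 1"] by simp
  moreover have "(\<lambda>n. (LINT x|M. (norm (f n x - u x))\<^sup>2) + 2 * (LINT x|M. f n x \<bullet> u x) - (LINT x|M. (norm (u x))\<^sup>2))
      \<longlonglongrightarrow> 0 + 2 * (LINT x|M. u x \<bullet> u x) - (LINT x|M. (norm (u x))\<^sup>2)"
    by (intro tendsto_intros f(3) L2_tendsto_inner[OF f f(2)])
  ultimately show ?thesis by (simp add: power2_norm_eq_inner)
qed

lemma ennreal_le_suminf:
  fixes g :: "nat \<Rightarrow> ennreal"
  shows "g j \<le> (\<Sum>i. g i)"
  using sum_le_suminf[of g "{j}"] by simp

text \<open>Along a subsequence whose increments $\Delta_j$ have squared norm at most $16^{-j}$, the sum of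
  $4^j |\Delta_j|^2$ is finite almost everywhere. There the increments are dominated by a multiple of $2^{-j}$, so
  the subsequence converges. Fatou's lemma gives convergence of the whole sequence in the mean square.\<close>

lemma L2_complete:
  fixes f :: "nat \<Rightarrow> 'x \<Rightarrow> 'b::euclidean_space"
  assumes f: "\<And>n. square_integrable M (f n)"
    and Cauchy: "\<And>e. e > 0 \<Longrightarrow> \<exists>N. \<forall>m\<ge>N. \<forall>n\<ge>N. (LINT x|M. (norm (f m x - f n x))\<^sup>2) < e"
  obtains u where "square_integrable M u" "(\<lambda>n. LINT x|M. (norm (f n x - u x))\<^sup>2) \<longlonglongrightarrow> 0"
proof -
  have "\<exists>N. \<forall>m\<ge>N. \<forall>n\<ge>N. (LINT x|M. (norm (f m x - f n x))\<^sup>2) < (1/16)^j" for j :: nat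
    by (rule Cauchy) simp
  then obtain N where N: "\<And>j m n. m \<ge> N j \<Longrightarrow> n \<ge> N j \<Longrightarrow> (LINT x|M. (norm (f m x - f n x))\<^sup>2) < (1/16)^j" by metis
  define r where "r = rec_nat (N 0) (\<lambda>j p. max (Suc p) (N (Suc j)))"
  have r: "r j \<ge> N j" "r (Suc j) > r j" for j
    by (cases j; simp add: r_def) (simp add: r_def)
  then have mono: "strict_mono r" by (simp add: strict_mono_Suc_iff)
  define \<Delta> where "\<Delta> = (\<lambda>j x. norm (f (r (Suc j)) x - f (r j) x))"
  have m[measurable]: "f n \<in> borel_measurable M" for n using f by (simp add: square_integrable_def)
  have int: "integrable M (\<lambda>x. (norm (f m x - f n x))\<^sup>2)" for m n
    using square_integrable_diff[OF f f] by (simp add: square_integrable_def)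
  have \<Delta>: "(\<integral>\<^sup>+x. ennreal ((\<Delta> j x)\<^sup>2) \<partial>M) \<le> ennreal ((1/16)^j)" for j
  proof -
    have "r (Suc j) \<ge> N j" using r[of j] by linarith
    then have "(LINT x|M. (\<Delta> j x)\<^sup>2) \<le> (1/16)^j" using N[of j "r (Suc j)" "r j"] r(1)[of j] by (simp add: \<Delta>_def)
    then show ?thesis using nn_integral_eq_integral[OF int, of "r (Suc j)" "r j"] by (simp add: \<Delta>_def ennreal_leI)
  qed
  have "(\<integral>\<^sup>+x. (\<Sum>j. ennreal (4^j * (\<Delta> j x)\<^sup>2)) \<partial>M) = (\<Sum>j. \<integral>\<^sup>+x. ennreal (4^j * (\<Delta> j x)\<^sup>2) \<partial>M)"
    by (rule nn_integral_suminf) (simp add: \<Delta>_def)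
  also have "\<dots> \<le> (\<Sum>j. ennreal ((1/4)^j))"
  proof (rule suminf_le)
    fix j
    have "(\<integral>\<^sup>+x. ennreal (4^j * (\<Delta> j x)\<^sup>2) \<partial>M) = ennreal (4^j) * (\<integral>\<^sup>+x. ennreal ((\<Delta> j x)\<^sup>2) \<partial>M)"
      by (subst nn_integral_cmult[symmetric]) (auto simp: \<Delta>_def ennreal_mult)
    also have "\<dots> \<le> ennreal (4^j) * ennreal ((1/16)^j)" by (rule mult_left_mono[OF \<Delta>]) simp
    also have "\<dots> = ennreal ((1/4)^j)"
    proof -
      have "(4::real) ^ j * (1/16) ^ j = (1/4) ^ j" by (simp only: power_mult_distrib[symmetric]) simp
      then show ?thesis by (simp only: ennreal_mult[symmetric] zero_le_power zero_le_numeral zero_le_divide_1_iff)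
    qed
    finally show "(\<integral>\<^sup>+x. ennreal (4^j * (\<Delta> j x)\<^sup>2) \<partial>M) \<le> ennreal ((1/4)^j)" .
  qed auto
  also have "\<dots> = ennreal (\<Sum>j. (1/4)^j)" by (rule suminf_ennreal2) (auto intro: summable_geometric)
  also have "\<dots> < \<infinity>" by simp
  finally have "AE x in M. (\<Sum>j. ennreal (4^j * (\<Delta> j x)\<^sup>2)) \<noteq> \<infinity>"
    by (intro nn_integral_noteq_infinite) (auto simp: \<Delta>_def)
  then have conv: "AE x in M. convergent (\<lambda>j. f (r j) x)"
  proof eventually_elim
    case (elim x)
    define T where "T = enn2real (\<Sum>j. ennreal (4^j * (\<Delta> j x)\<^sup>2))"
    have T: "(\<Sum>j. ennreal (4^j * (\<Delta> j x)\<^sup>2)) = ennreal T" "T \<ge> 0" using elim by (auto simp: T_def less_top)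
    have b: "\<Delta> j x \<le> sqrt T * (1/2)^j" for j
    proof -
      have "ennreal (4^j * (\<Delta> j x)\<^sup>2) \<le> (\<Sum>j. ennreal (4^j * (\<Delta> j x)\<^sup>2))"
        by (rule ennreal_le_suminf)
      then have "4^j * (\<Delta> j x)\<^sup>2 \<le> T" unfolding T(1) by (simp only: ennreal_le_iff[OF T(2)])
      moreover have "(4::real) ^ j = (2 ^ j)\<^sup>2"
        using power_mult[of "2::real" 2 j] power_mult[of "2::real" j 2] by (simp add: mult.commute)
      ultimately have "(2^j * \<Delta> j x)\<^sup>2 \<le> T" by (simp only: power_mult_distrib)
      then have "2^j * \<Delta> j x \<le> sqrt T" by (rule real_le_rsqrt)
      then show ?thesis by (simp add: field_simps)
    qed
    have "summable (\<lambda>j. norm (f (r (Suc j)) x - f (r j) x))"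
    proof (rule summable_comparison_test'[where N = 0])
      show "summable (\<lambda>j. sqrt T * (1/2)^j)" by (intro summable_mult summable_geometric) simp
      show "norm (norm (f (r (Suc j)) x - f (r j) x)) \<le> sqrt T * (1/2)^j" if "j \<ge> 0" for j
        using b[of j] by (simp add: \<Delta>_def)
    qed
    then have "summable (\<lambda>j. f (r (Suc j)) x - f (r j) x)" by (rule summable_norm_cancel)
    then have "convergent (\<lambda>n. \<Sum>j<n. f (r (Suc j)) x - f (r j) x)" by (simp add: summable_iff_convergent)
    moreover have "(\<Sum>j<n. f (r (Suc j)) x - f (r j) x) = f (r n) x - f (r 0) x" for n
      by (rule sum_lessThan_telescope)
    ultimately have "convergent (\<lambda>n. f (r n) x - f (r 0) x)" by (simp only:)
    from convergent_add[OF this convergent_const[of "f (r 0) x"]] show ?case by simp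
  qed
  define u where "u = (\<lambda>x. lim (\<lambda>j. f (r j) x))"
  have um[measurable]: "u \<in> borel_measurable M" unfolding u_def by measurable
  have ulim: "AE x in M. (\<lambda>j. f (r j) x) \<longlonglongrightarrow> u x"
    using conv by eventually_elim (simp add: u_def convergent_LIMSEQ_iff)
  have fatou: "(\<integral>\<^sup>+x. ennreal ((norm (f n x - u x))\<^sup>2) \<partial>M) \<le> ennreal e" if e: "e > 0"
    and n: "\<forall>m\<ge>N'. \<forall>n\<ge>N'. (LINT x|M. (norm (f m x - f n x))\<^sup>2) < e" "n \<ge> N'" for e n N'
  proof -
    have "(\<integral>\<^sup>+x. ennreal ((norm (f n x - u x))\<^sup>2) \<partial>M) = (\<integral>\<^sup>+x. liminf (\<lambda>j. ennreal ((norm (f n x - f (r j) x))\<^sup>2)) \<partial>M)"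
    proof (rule nn_integral_cong_AE)
      show "AE x in M. ennreal ((norm (f n x - u x))\<^sup>2) = liminf (\<lambda>j. ennreal ((norm (f n x - f (r j) x))\<^sup>2))"
        using ulim
      proof eventually_elim
        case (elim x)
        then have "(\<lambda>j. ennreal ((norm (f n x - f (r j) x))\<^sup>2)) \<longlonglongrightarrow> ennreal ((norm (f n x - u x))\<^sup>2)"
          by (intro tendsto_intros)
        from lim_imp_Liminf[OF _ this] show ?case by simp
      qed
    qed
    also have "\<dots> \<le> liminf (\<lambda>j. \<integral>\<^sup>+x. ennreal ((norm (f n x - f (r j) x))\<^sup>2) \<partial>M)"
      by (rule nn_integral_liminf) simp
    also have "\<dots> \<le> ennreal e"
    proof (rule order_trans[OF Liminf_mono[of _ "\<lambda>_. ennreal e"]])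
      show "\<forall>\<^sub>F j in sequentially. (\<integral>\<^sup>+x. ennreal ((norm (f n x - f (r j) x))\<^sup>2) \<partial>M) \<le> ennreal e"
      proof (rule eventually_sequentiallyI[of N'])
        fix j assume "j \<ge> N'"
        then have "r j \<ge> N'" using strict_mono_imp_increasing[OF mono, of j] by linarith
        then have "(LINT x|M. (norm (f n x - f (r j) x))\<^sup>2) \<le> e" using n less_imp_le by blast
        then show "(\<integral>\<^sup>+x. ennreal ((norm (f n x - f (r j) x))\<^sup>2) \<partial>M) \<le> ennreal e"
          using nn_integral_eq_integral[OF int, of n "r j"] by (simp add: ennreal_leI)
      qed
    qed (simp add: Liminf_const)
    finally show ?thesis .
  qed
  have intu: "\<exists>N'. \<forall>n\<ge>N'. integrable M (\<lambda>x. (norm (f n x - u x))\<^sup>2) \<and> (LINT x|M. (norm (f n x - u x))\<^sup>2) \<le> e" if e: "e > 0" for e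
  proof -
    obtain N' where N': "\<forall>m\<ge>N'. \<forall>n\<ge>N'. (LINT x|M. (norm (f m x - f n x))\<^sup>2) < e" using Cauchy[OF e] by blast
    show ?thesis
    proof (intro exI[of _ N'] allI impI)
      fix n assume "n \<ge> N'"
      from fatou[OF e N' this] have le: "(\<integral>\<^sup>+x. ennreal ((norm (f n x - u x))\<^sup>2) \<partial>M) \<le> ennreal e" .
      have i: "integrable M (\<lambda>x. (norm (f n x - u x))\<^sup>2)"
        by (rule integrableI_bounded) (use le in \<open>auto simp: top_unique less_top[symmetric]\<close>)
      moreover have "(LINT x|M. (norm (f n x - u x))\<^sup>2) \<le> e"
        using le nn_integral_eq_integral[OF i] e by (simp add: ennreal_le_iff)
      ultimately show "integrable M (\<lambda>x. (norm (f n x - u x))\<^sup>2) \<and> (LINT x|M. (norm (f n x - u x))\<^sup>2) \<le> e" ..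
    qed
  qed
  obtain n where n: "integrable M (\<lambda>x. (norm (f n x - u x))\<^sup>2)" using intu[of 1] by auto
  have "square_integrable M (\<lambda>x. f n x - u x)" using n by (simp add: square_integrable_def)
  from square_integrable_diff[OF f[of n] this] have u: "square_integrable M u" by simp
  have "(\<lambda>n. LINT x|M. (norm (f n x - u x))\<^sup>2) \<longlonglongrightarrow> 0"
  proof (rule LIMSEQ_I)
    fix e :: real assume "e > 0"
    then obtain N' where "\<forall>n\<ge>N'. (LINT x|M. (norm (f n x - u x))\<^sup>2) \<le> e / 2" using intu[of "e / 2"] by auto
    then show "\<exists>no. \<forall>n\<ge>no. norm ((LINT x|M. (norm (f n x - u x))\<^sup>2) - 0) < e"
      using \<open>e > 0\<close> by (intro exI[of _ N']) (auto intro: le_less_trans)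
  qed
  then show ?thesis using that u by blast
qed

section \<open>Compactness of families with bounded gradients\<close>

lemma square_integrable_compact_support:
  fixes f :: "'a::euclidean_space \<Rightarrow> 'b::euclidean_space"
  assumes "continuous_on UNIV f" "compact K" "\<And>x. x \<notin> K \<Longrightarrow> f x = 0"
  shows "square_integrable lborel f"
  unfolding square_integrable_def
proof
  show "f \<in> borel_measurable lborel" using borel_measurable_continuous_onI[OF assms(1)] by simp
  show "integrable lborel (\<lambda>x. (norm (f x))\<^sup>2)"
    by (rule integrable_continuous_compact_support[OF _ assms(2)])
       (use assms in \<open>auto intro!: continuous_intros\<close>)
qed

lemma nn_integral_translation:
  fixes f :: "'a::euclidean_space \<Rightarrow> ennreal"
  assumes "f \<in> borel_measurable borel"
  shows "(\<integral>\<^sup>+x. f (x + h) \<partial>lborel) = (\<integral>\<^sup>+x. f x \<partial>lborel)"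
proof -
  have "(\<integral>\<^sup>+x. f x \<partial>lborel) = (\<integral>\<^sup>+x. f x \<partial>distr lborel borel ((+) h))"
    by (simp add: lborel_distr_plus)
  also have "\<dots> = (\<integral>\<^sup>+x. f (h + x) \<partial>lborel)"
    by (rule nn_integral_distr) (use assms in auto)
  finally show ?thesis by (simp add: add.commute)
qed

text \<open>The fundamental theorem of calculus along the segment, followed by the Cauchy--Schwarz inequality.
  The bound is a nonnegative integral, ready for Tonelli's theorem.\<close>

lemma difference_square_le_segment:
  fixes f :: "'a::euclidean_space \<Rightarrow> real"
  assumes f: "Ck_on 1 UNIV f"
  shows "ennreal ((f (x + h) - f x)\<^sup>2) \<le> (\<integral>\<^sup>+t. ennreal (indicator {0..1} t * (grad f (x + t *\<^sub>R h) \<bullet> h)\<^sup>2) \<partial>lborel)"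
proof -
  note F = Ck_on_1_grad[OF f]
  define g where "g = (\<lambda>t. grad f (x + t *\<^sub>R h) \<bullet> h)"
  have cg: "continuous_on S g" for S unfolding g_def
    by (intro continuous_intros continuous_on_compose2[OF F(3)]) auto
  have d: "((\<lambda>t. f (x + t *\<^sub>R h)) has_vector_derivative g t) (at t)" for t
  proof -
    have "((\<lambda>t. x + t *\<^sub>R h) has_derivative (\<lambda>s. s *\<^sub>R h)) (at t)" by (auto intro!: derivative_eq_intros)
    from has_derivative_compose[OF this F(1)] show ?thesis
      unfolding has_vector_derivative_def g_def by simp
  qed
  have ftc: "(LINT t|lborel. indicator {0..1} t *\<^sub>R g t) = f (x + h) - f x"
    using integral_FTC_atLeastAtMost[of 0 1 "\<lambda>t. f (x + t *\<^sub>R h)" g] cg d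
    by (simp add: has_vector_derivative_at_within)
  have i2: "integrable lborel (\<lambda>t. indicator {0..1} t *\<^sub>R (g t)\<^sup>2)"
    by (rule borel_integrable_compact) (auto intro!: continuous_intros cg)
  have gm[measurable]: "g \<in> borel_measurable borel" by (rule borel_measurable_continuous_onI[OF cg])
  have e1: "(norm (indicator {0..1} t * g t :: real))\<^sup>2 = indicator {0..1} t *\<^sub>R (g t)\<^sup>2" for t
    by (simp add: indicator_def)
  have sg: "square_integrable lborel (\<lambda>t. indicator {0..1} t * g t :: real)"
    unfolding square_integrable_def e1 using i2 by simp
  have e2: "(norm (indicator {0..1} t :: real))\<^sup>2 = indicator {0..1} t" for t :: real
    by (simp add: indicator_def)
  have si: "square_integrable lborel (indicator {0..1} :: real \<Rightarrow> real)"
    unfolding square_integrable_def e2 by simp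
  have "(f (x + h) - f x)\<^sup>2 = (LINT t|lborel. (indicator {0..1} t * g t) \<bullet> (indicator {0..1} t :: real))\<^sup>2"
    unfolding ftc[symmetric] by (rule arg_cong[where f = "\<lambda>x. x\<^sup>2"], rule Bochner_Integration.integral_cong) (auto simp: indicator_def)
  also have "\<dots> \<le> (LINT t|lborel. indicator {0..1} t *\<^sub>R (g t)\<^sup>2) * (LINT t|lborel. indicator {0..1} (t::real))"
    using Cauchy_Schwarz_integral[OF sg si] unfolding e1 e2 .
  also have "\<dots> = (LINT t|lborel. indicator {0..1} t *\<^sub>R (g t)\<^sup>2)" by simp
  finally have "ennreal ((f (x + h) - f x)\<^sup>2) \<le> ennreal (LINT t|lborel. indicator {0..1} t *\<^sub>R (g t)\<^sup>2)" by (rule ennreal_leI)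
  also have "\<dots> = (\<integral>\<^sup>+t. ennreal (indicator {0..1} t *\<^sub>R (g t)\<^sup>2) \<partial>lborel)"
    by (rule nn_integral_eq_integral[symmetric, OF i2]) simp
  finally show ?thesis by (simp add: g_def)
qed

text \<open>Integrate \<open>difference_square_le_segment\<close> over \<open>x\<close> and interchange the integrals; then the inner
  integral does not depend on the position on the segment.\<close>

lemma translation_estimate:
  fixes f :: "'a::euclidean_space \<Rightarrow> real"
  assumes f: "Ck_on 1 UNIV f" and K: "compact K" "\<And>x. x \<notin> K \<Longrightarrow> f x = 0"
  shows "(\<integral>\<^sup>+x. ennreal ((f (x + h) - f x)\<^sup>2) \<partial>lborel) \<le> ennreal ((norm h)\<^sup>2 * (LINT x|lborel. (norm (grad f x))\<^sup>2))"
proof -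
  note F = Ck_on_1_grad[OF f]
  have gm[measurable]: "grad f \<in> borel_measurable borel" by (rule borel_measurable_continuous_onI[OF F(3)])
  have sq: "square_integrable lborel (grad f)"
    by (rule square_integrable_compact_support[OF F(3) K(1) grad_eq_0[OF _ K(2)]]) (use K(1) compact_imp_closed in auto)
  define Q where "Q = (LINT x|lborel. (norm (grad f x))\<^sup>2)"
  have "(\<integral>\<^sup>+x. ennreal ((f (x + h) - f x)\<^sup>2) \<partial>lborel)
    \<le> (\<integral>\<^sup>+x. \<integral>\<^sup>+t. ennreal (indicator {0..1} t * (grad f (x + t *\<^sub>R h) \<bullet> h)\<^sup>2) \<partial>lborel \<partial>lborel)"
    by (rule nn_integral_mono) (rule difference_square_le_segment[OF f])
  also have "\<dots> = (\<integral>\<^sup>+t. \<integral>\<^sup>+x. ennreal (indicator {0..1} t * (grad f (x + t *\<^sub>R h) \<bullet> h)\<^sup>2) \<partial>lborel \<partial>lborel)"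
    by (rule lborel_pair.Fubini'[symmetric]) measurable
  also have "\<dots> \<le> (\<integral>\<^sup>+t. ennreal ((norm h)\<^sup>2 * Q) * indicator {0..1::real} t \<partial>lborel)"
  proof (rule nn_integral_mono)
    fix t :: real
    have "(\<integral>\<^sup>+x. ennreal (indicator {0..1} t * (grad f (x + t *\<^sub>R h) \<bullet> h)\<^sup>2) \<partial>lborel)
      = (\<integral>\<^sup>+x. ennreal (indicator {0..1} t * (grad f x \<bullet> h)\<^sup>2) \<partial>lborel)"
      by (rule nn_integral_translation) measurable
    also have "\<dots> \<le> (\<integral>\<^sup>+x. ennreal ((norm h)\<^sup>2 * (norm (grad f x))\<^sup>2) * indicator {0..1} t \<partial>lborel)"
    proof (rule nn_integral_mono)
      fix x
      have "(grad f x \<bullet> h)\<^sup>2 \<le> (norm h)\<^sup>2 * (norm (grad f x))\<^sup>2"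
        using Cauchy_Schwarz_ineq[of "grad f x" h] by (simp add: power2_norm_eq_inner mult.commute)
      then show "ennreal (indicator {0..1} t * (grad f x \<bullet> h)\<^sup>2) \<le> ennreal ((norm h)\<^sup>2 * (norm (grad f x))\<^sup>2) * indicator {0..1} t"
        by (auto simp: indicator_def intro: ennreal_leI)
    qed
    also have "\<dots> = (\<integral>\<^sup>+x. ennreal ((norm h)\<^sup>2 * (norm (grad f x))\<^sup>2) \<partial>lborel) * indicator {0..1} t"
      by (rule nn_integral_multc) measurable
    also have "(\<integral>\<^sup>+x. ennreal ((norm h)\<^sup>2 * (norm (grad f x))\<^sup>2) \<partial>lborel) = ennreal (LINT x|lborel. (norm h)\<^sup>2 * (norm (grad f x))\<^sup>2)"
      by (rule nn_integral_eq_integral) (use sq in \<open>auto simp: square_integrable_def\<close>)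
    finally show "(\<integral>\<^sup>+x. ennreal (indicator {0..1} t * (grad f (x + t *\<^sub>R h) \<bullet> h)\<^sup>2) \<partial>lborel) \<le> ennreal ((norm h)\<^sup>2 * Q) * indicator {0..1} t"
      by (simp add: Q_def)
  qed
  also have "\<dots> = ennreal ((norm h)\<^sup>2 * Q)" by (simp add: nn_integral_cmult)
  finally show ?thesis by (simp add: Q_def)
qed

text \<open>By the Cauchy--Schwarz inequality for the weight \<open>\<rho>\<close>, the squared error of the average is at most the
  average of the squared errors of the translates.\<close>

lemma mollification_estimate:
  fixes f \<rho> :: "'a::euclidean_space \<Rightarrow> real"
  assumes f: "Ck_on 1 UNIV f" and K: "compact K" "\<And>x. x \<notin> K \<Longrightarrow> f x = 0"
    and \<rho>: "continuous_on UNIV \<rho>" "\<And>x. \<rho> x \<ge> 0" "\<And>x. norm x \<ge> \<delta> \<Longrightarrow> \<rho> x = 0" "(LINT x|lborel. \<rho> x) = 1"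
    and \<delta>: "\<delta> > 0"
  shows "(\<integral>\<^sup>+x. ennreal (((LINT y|lborel. \<rho> y * f (y + x)) - f x)\<^sup>2) \<partial>lborel) \<le> ennreal (\<delta>\<^sup>2 * (LINT x|lborel. (norm (grad f x))\<^sup>2))"
proof -
  note F = Ck_on_1_grad[OF f]
  have [measurable]: "f \<in> borel_measurable borel" by (rule borel_measurable_continuous_onI[OF F(2)])
  have [measurable]: "\<rho> \<in> borel_measurable borel" by (rule borel_measurable_continuous_onI[OF \<rho>(1)])
  define Q where "Q = (LINT x|lborel. (norm (grad f x))\<^sup>2)"
  have Q: "Q \<ge> 0" by (simp add: Q_def)
  have int: "integrable lborel (\<lambda>y. \<rho> y * h y)" if "continuous_on UNIV h" for h
    by (rule integrable_continuous_compact_support[of _ "cball 0 \<delta>"]) (use \<rho> that in \<open>auto intro!: continuous_intros\<close>)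
  have i1: "integrable lborel \<rho>" using int[of "\<lambda>_. 1"] by (simp add: continuous_on_const)
  have pt: "ennreal (((LINT y|lborel. \<rho> y * f (y + x)) - f x)\<^sup>2) \<le> (\<integral>\<^sup>+y. ennreal (\<rho> y * (f (x + y) - f x)\<^sup>2) \<partial>lborel)" for x
  proof -
    have cf: "continuous_on UNIV (\<lambda>y. f (x + y))" by (rule continuous_on_compose2[OF F(2)]) (auto intro!: continuous_intros)
    define d where "d = (\<lambda>y. f (x + y) - f x)"
    have cd: "continuous_on UNIV d" unfolding d_def by (intro continuous_intros cf)
    have "(LINT y|lborel. \<rho> y * f (y + x)) - f x = (LINT y|lborel. \<rho> y * f (x + y)) - (LINT y|lborel. \<rho> y * f x)"
      using \<rho>(4) by (simp add: add.commute)
    also have "\<dots> = (LINT y|lborel. \<rho> y * d y)" using int[OF cf] i1 by (simp add: d_def right_diff_distrib)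
    also have "\<dots> = (LINT y|lborel. sqrt (\<rho> y) \<bullet> (sqrt (\<rho> y) * d y))"
      using \<rho>(2) by (intro Bochner_Integration.integral_cong) (auto simp: mult.assoc[symmetric])
    finally have e: "(LINT y|lborel. \<rho> y * f (y + x)) - f x = (LINT y|lborel. sqrt (\<rho> y) \<bullet> (sqrt (\<rho> y) * d y))" .
    have n1: "(norm (sqrt (\<rho> y)))\<^sup>2 = \<rho> y" for y using \<rho>(2) by simp
    have n2: "(norm (sqrt (\<rho> y) * d y))\<^sup>2 = \<rho> y * (d y)\<^sup>2" for y using \<rho>(2) by (simp add: power_mult_distrib)
    have i2: "integrable lborel (\<lambda>y. \<rho> y * (d y)\<^sup>2)" by (intro int continuous_intros cd)
    have [measurable]: "d \<in> borel_measurable borel" by (rule borel_measurable_continuous_onI[OF cd])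
    have s1: "square_integrable lborel (\<lambda>y. sqrt (\<rho> y))" unfolding square_integrable_def n1 using i1 by simp
    have s2: "square_integrable lborel (\<lambda>y. sqrt (\<rho> y) * d y)" unfolding square_integrable_def n2 using i2 by simp
    have "((LINT y|lborel. \<rho> y * f (y + x)) - f x)\<^sup>2 \<le> (LINT y|lborel. \<rho> y * (d y)\<^sup>2)"
      using Cauchy_Schwarz_integral[OF s1 s2] unfolding n1 n2 e[symmetric] \<rho>(4) by simp
    then have "ennreal (((LINT y|lborel. \<rho> y * f (y + x)) - f x)\<^sup>2) \<le> ennreal (LINT y|lborel. \<rho> y * (d y)\<^sup>2)" by (rule ennreal_leI)
    also have "\<dots> = (\<integral>\<^sup>+y. ennreal (\<rho> y * (d y)\<^sup>2) \<partial>lborel)"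
      by (rule nn_integral_eq_integral[symmetric, OF i2]) (use \<rho>(2) in simp)
    finally show ?thesis by (simp add: d_def)
  qed
  have "(\<integral>\<^sup>+x. ennreal (((LINT y|lborel. \<rho> y * f (y + x)) - f x)\<^sup>2) \<partial>lborel)
    \<le> (\<integral>\<^sup>+x. \<integral>\<^sup>+y. ennreal (\<rho> y * (f (x + y) - f x)\<^sup>2) \<partial>lborel \<partial>lborel)"
    by (rule nn_integral_mono) (rule pt)
  also have "\<dots> = (\<integral>\<^sup>+y. \<integral>\<^sup>+x. ennreal (\<rho> y * (f (x + y) - f x)\<^sup>2) \<partial>lborel \<partial>lborel)"
    by (rule lborel_pair.Fubini'[symmetric]) measurable
  also have "\<dots> \<le> (\<integral>\<^sup>+y. ennreal (\<rho> y * (\<delta>\<^sup>2 * Q)) \<partial>lborel)"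
  proof (rule nn_integral_mono)
    fix y
    have "(\<integral>\<^sup>+x. ennreal (\<rho> y * (f (x + y) - f x)\<^sup>2) \<partial>lborel) = ennreal (\<rho> y) * (\<integral>\<^sup>+x. ennreal ((f (x + y) - f x)\<^sup>2) \<partial>lborel)"
      using \<rho>(2) by (subst nn_integral_cmult[symmetric]) (auto simp: ennreal_mult)
    also have "\<dots> \<le> ennreal (\<rho> y) * ennreal ((norm y)\<^sup>2 * Q)"
      unfolding Q_def by (rule mult_left_mono[OF translation_estimate[OF f K] zero_le])
    also have "\<dots> = ennreal (\<rho> y * ((norm y)\<^sup>2 * Q))" using \<rho>(2) Q by (simp add: ennreal_mult)
    also have "\<dots> \<le> ennreal (\<rho> y * (\<delta>\<^sup>2 * Q))"
    proof (rule ennreal_leI, cases "norm y < \<delta>")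
      case True
      then show "\<rho> y * ((norm y)\<^sup>2 * Q) \<le> \<rho> y * (\<delta>\<^sup>2 * Q)"
        using \<rho>(2) Q by (intro mult_left_mono mult_right_mono power_mono) auto
    qed (use \<rho>(3) in auto)
    finally show "(\<integral>\<^sup>+x. ennreal (\<rho> y * (f (x + y) - f x)\<^sup>2) \<partial>lborel) \<le> ennreal (\<rho> y * (\<delta>\<^sup>2 * Q))" .
  qed
  also have "\<dots> = ennreal (LINT y|lborel. \<rho> y * (\<delta>\<^sup>2 * Q))"
    by (rule nn_integral_eq_integral) (use i1 \<rho>(2) Q in auto)
  also have "\<dots> = ennreal (\<delta>\<^sup>2 * Q)" using \<rho>(4) by simp
  finally show ?thesis by (simp add: Q_def)
qed

lemma square_integrable_if_nn_integral_le:
  fixes f :: "'x \<Rightarrow> 'b::euclidean_space"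
  assumes "f \<in> borel_measurable M" "(\<integral>\<^sup>+x. ennreal ((norm (f x))\<^sup>2) \<partial>M) \<le> ennreal c" "c \<ge> 0"
  shows "square_integrable M f" "(LINT x|M. (norm (f x))\<^sup>2) \<le> c"
proof -
  have [measurable]: "f \<in> borel_measurable M" by fact
  have i: "integrable M (\<lambda>x. (norm (f x))\<^sup>2)"
    by (rule integrableI_bounded) (use assms(2) in \<open>auto simp: top_unique less_top[symmetric]\<close>)
  then show "square_integrable M f" by (simp add: square_integrable_def)
  show "(LINT x|M. (norm (f x))\<^sup>2) \<le> c"
    using assms(2,3) nn_integral_eq_integral[OF i] by (simp add: ennreal_le_iff)
qed

text \<open>The Rellich--Kondrachov theorem. At a fixed scale the mollified functions are uniformly bounded and
  equicontinuous, so a diagonal subsequence converges pointwise at all scales $\delta_N$, and in the mean square by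
  dominated convergence. Mollification at the scale $\delta_N$ moves \<open>f n\<close> by at most $\delta_N \sqrt Q$ in the mean
  square, for all \<open>n\<close> at once.\<close>

theorem compact_embedding:
  fixes f :: "nat \<Rightarrow> 'a::euclidean_space \<Rightarrow> real"
  assumes f: "\<And>n. Ck_on 1 UNIV (f n)" and supp: "\<And>n x. norm x > R \<Longrightarrow> f n x = 0"
    and A: "\<And>n. (LINT x|lborel. (f n x)\<^sup>2) \<le> A" and Q: "\<And>n. (LINT x|lborel. (norm (grad (f n) x))\<^sup>2) \<le> Q"
  obtains r :: "nat \<Rightarrow> nat" where "strict_mono r"
    "\<And>e. e > 0 \<Longrightarrow> \<exists>N. \<forall>m\<ge>N. \<forall>n\<ge>N. (LINT x|lborel. (f (r m) x - f (r n) x)\<^sup>2) < e"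
proof -
  define B where "B = cball (0::'a) R"
  have B: "compact B" "\<And>n x. x \<notin> B \<Longrightarrow> f n x = 0" using supp by (auto simp: B_def)
  have cf: "continuous_on UNIV (f n)" for n by (rule Ck_on_1_grad[OF f])
  have sf: "square_integrable lborel (f n)" for n by (rule square_integrable_compact_support[OF cf B])
  have if2: "integrable lborel (\<lambda>x. (f n x)\<^sup>2)" for n using sf[of n] by (simp add: square_integrable_def)
  have if1: "integrable lborel (\<lambda>x. \<bar>f n x\<bar>)" for n
    using integrable_norm[OF integrable_continuous_compact_support[OF cf B]] by simp
  have Q0: "Q \<ge> 0" using order_trans[OF _ Q[of 0]] by simp
  have A0: "A \<ge> 0" using order_trans[OF _ A[of 0]] by simp
  define L where "L = measure lborel B + A"
  have L0: "L \<ge> 0" using A0 by (simp add: L_def)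
  have L: "(LINT x|lborel. \<bar>f n x\<bar>) \<le> L" for n
  proof -
    have iB: "integrable lborel (indicator B :: 'a \<Rightarrow> real)"
      using borel_integrable_compact[OF B(1), of "\<lambda>_. 1::real"] by simp
    have "(LINT x|lborel. \<bar>f n x\<bar>) \<le> (LINT x|lborel. indicator B x + (f n x)\<^sup>2)"
    proof (rule integral_mono[OF if1 Bochner_Integration.integrable_add[OF iB if2]])
      fix x
      have "2 * \<bar>f n x\<bar> * 1 \<le> 1\<^sup>2 + \<bar>f n x\<bar>\<^sup>2" using zero_le_power2[of "1 - \<bar>f n x\<bar>"] by (simp add: power2_diff)
      then have "\<bar>f n x\<bar> \<le> 1 + (f n x)\<^sup>2" using zero_le_power2[of "f n x"] by simp
      then show "\<bar>f n x\<bar> \<le> indicator B x + (f n x)\<^sup>2" using B(2)[of x n] by (auto simp: indicator_def)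
    qed
    also have "\<dots> = measure lborel B + (LINT x|lborel. (f n x)\<^sup>2)"
      using iB if2 B(1) by (simp add: compact_imp_closed)
    finally show ?thesis using A[of n] by (simp add: L_def)
  qed
  define \<delta> where "\<delta> = (\<lambda>N::nat. 1 / (real N + 1))"
  have \<delta>: "\<delta> N > 0" "\<delta> N \<le> 1" for N by (auto simp: \<delta>_def)
  have "\<forall>N. \<exists>\<rho> :: 'a \<Rightarrow> real. continuous_on UNIV \<rho> \<and> (\<forall>x. \<rho> x \<ge> 0) \<and> (\<forall>x. norm x \<ge> \<delta> N \<longrightarrow> \<rho> x = 0) \<and> (LINT x|lborel. \<rho> x) = 1"
  proof
    fix N
    obtain \<rho> :: "'a \<Rightarrow> real" where "\<And>m. Ck_on m UNIV \<rho>" "\<And>x. \<rho> x \<ge> 0" "\<And>x. norm x \<ge> \<delta> N \<Longrightarrow> \<rho> x = 0" "(LINT x|lborel. \<rho> x) = 1"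
      using mollifier_exists[OF \<delta>(1)] by blast
    then show "\<exists>\<rho> :: 'a \<Rightarrow> real. continuous_on UNIV \<rho> \<and> (\<forall>x. \<rho> x \<ge> 0) \<and> (\<forall>x. norm x \<ge> \<delta> N \<longrightarrow> \<rho> x = 0) \<and> (LINT x|lborel. \<rho> x) = 1"
      by (metis Ck_on.simps(1))
  qed
  then obtain \<rho> :: "nat \<Rightarrow> 'a \<Rightarrow> real" where \<rho>: "\<And>N. continuous_on UNIV (\<rho> N)" "\<And>N x. \<rho> N x \<ge> 0"
    "\<And>N x. norm x \<ge> \<delta> N \<Longrightarrow> \<rho> N x = 0" "\<And>N. (LINT x|lborel. \<rho> N x) = 1" by metis
  have \<rho>0: "\<rho> N x = 0" if "x \<notin> cball 0 1" for N x using that \<rho>(3)[of N x] \<delta>(2)[of N] by simp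
  have "\<exists>S\<ge>0. \<forall>x. \<bar>\<rho> N x\<bar> \<le> S" for N
  proof -
    have "compact (\<rho> N ` cball 0 1)" by (rule compact_continuous_image[OF continuous_on_subset[OF \<rho>(1)]]) auto
    then obtain S where "S > 0" "\<And>x. x \<in> cball 0 1 \<Longrightarrow> \<bar>\<rho> N x\<bar> \<le> S"
      using compact_imp_bounded bounded_pos by (metis imageI real_norm_def)
    then show ?thesis using \<rho>0[of _ N] by (intro exI[of _ S]) (metis abs_zero less_imp_le)
  qed
  then obtain S where S: "\<And>N. S N \<ge> 0" "\<And>N x. \<bar>\<rho> N x\<bar> \<le> S N" by metis
  define F where "F = (\<lambda>N n x. LINT y|lborel. \<rho> N y * f n (y + x))"
  have F_eq: "F N n x = (LINT y|lborel. f n y * \<rho> N (y - x))" for N n x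
  proof -
    have m: "(\<lambda>y. f n y * \<rho> N (y - x)) \<in> borel_measurable borel"
      by (rule borel_measurable_continuous_onI) (intro continuous_intros cf continuous_on_compose2[OF \<rho>(1)], auto)
    show ?thesis using integral_translation[OF m, of x] by (simp add: F_def mult.commute)
  qed
  have int: "integrable lborel (\<lambda>y. f n y * h y)" if "continuous_on UNIV h" for n h
    by (rule integrable_continuous_compact_support[OF _ B(1)]) (use B cf that in \<open>auto intro!: continuous_intros\<close>)
  have c\<rho>: "continuous_on UNIV (\<lambda>y. \<rho> N (y - x))" for N x by (rule continuous_on_compose2[OF \<rho>(1)]) (auto intro!: continuous_intros)
  have F_bound: "\<bar>F N n x\<bar> \<le> S N * L" for N n x
  proof -
    have "\<bar>F N n x\<bar> \<le> (LINT y|lborel. \<bar>f n y\<bar> * S N)"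
      unfolding F_eq
      by (rule order_trans[OF integral_abs_bound integral_mono[OF integrable_abs[OF int[OF c\<rho>]]]])
         (use if1 S in \<open>auto simp: abs_mult intro!: mult_left_mono\<close>)
    also have "\<dots> \<le> L * S N" using L S(1) by (simp add: mult_right_mono)
    finally show ?thesis by (simp add: mult.commute)
  qed
  have equi: "\<exists>d>0. \<forall>n x x'. dist x x' < d \<longrightarrow> \<bar>F N n x - F N n x'\<bar> \<le> e" if e: "e > 0" for N e
  proof -
    have "e / (L + 1) > 0" using e L0 by simp
    then obtain d where d: "d > 0" "\<And>p q. dist p q < d \<Longrightarrow> dist (\<rho> N p) (\<rho> N q) < e / (L + 1)"
      using compact_support_uniformly_continuous[OF \<rho>(1) compact_cball \<rho>0] by blast
    have "\<bar>F N n x - F N n x'\<bar> \<le> e" if "dist x x' < d" for n x x'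
    proof -
      have "F N n x - F N n x' = (LINT y|lborel. f n y * (\<rho> N (y - x) - \<rho> N (y - x')))"
        unfolding F_eq using int[OF c\<rho>] by (simp add: right_diff_distrib)
      also have "\<bar>\<dots>\<bar> \<le> (LINT y|lborel. \<bar>f n y\<bar> * (e / (L + 1)))"
      proof (rule order_trans[OF integral_abs_bound integral_mono])
        fix y
        have "dist (y - x) (y - x') < d" using that by (simp add: dist_norm norm_minus_commute)
        then have "\<bar>\<rho> N (y - x) - \<rho> N (y - x')\<bar> \<le> e / (L + 1)" using d(2) by (simp add: dist_real_def less_imp_le)
        then show "\<bar>f n y * (\<rho> N (y - x) - \<rho> N (y - x'))\<bar> \<le> \<bar>f n y\<bar> * (e / (L + 1))"
          unfolding abs_mult by (rule mult_left_mono) simp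
      next
        show "integrable lborel (\<lambda>y. \<bar>f n y * (\<rho> N (y - x) - \<rho> N (y - x'))\<bar>)"
          by (intro integrable_abs int continuous_intros c\<rho>)
      qed (use if1 in auto)
      also have "\<dots> = (LINT y|lborel. \<bar>f n y\<bar>) * (e / (L + 1))" by (rule integral_mult_left_zero)
      also have "\<dots> \<le> L * (e / (L + 1))" using e L0 by (intro mult_right_mono[OF L]) simp
      also have "\<dots> \<le> e" using e L0 by (simp add: field_simps)
      finally show ?thesis .
    qed
    then show ?thesis using d(1) by blast
  qed
  obtain D :: "'a set" where D: "countable D" "\<And>X. open X \<Longrightarrow> X \<noteq> {} \<Longrightarrow> \<exists>d\<in>D. d \<in> X"
    using countable_dense_exists by metis
  (* There are countably many pairs of a scale and a point of a dense set, so one diagonal subsequence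
     serves all of them. Dividing by S N * L + 1 brings all values into the same bounded interval. *)
  obtain r where r: "strict_mono (r :: nat \<Rightarrow> nat)"
    "\<And>p. p \<in> UNIV \<times> D \<Longrightarrow> \<exists>l. (\<lambda>n. F (fst p) (r n) (snd p) / (S (fst p) * L + 1)) \<longlonglongrightarrow> l"
  proof (rule function_convergent_subsequence[of "UNIV \<times> D" "\<lambda>n p. F (fst p) n (snd p) / (S (fst p) * L + 1)" 1])
    show "countable ((UNIV :: nat set) \<times> D)" using D(1) by simp
    show "norm (F (fst p) n (snd p) / (S (fst p) * L + 1)) \<le> 1" for p n
    proof -
      have "S (fst p) * L \<ge> 0" using S(1) L0 by simp
      then show ?thesis using F_bound[of "fst p" n "snd p"] by (simp add: field_simps abs_of_nonneg)
    qed
    fix k :: "nat \<Rightarrow> nat"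
    assume "strict_mono k" and "\<And>x. x \<in> UNIV \<times> D \<Longrightarrow> \<exists>l. (\<lambda>n. F (fst x) (k n) (snd x) / (S (fst x) * L + 1)) \<longlonglongrightarrow> l"
    then show thesis by (rule that)
  qed
  have conv: "convergent (\<lambda>n. F N (r n) x)" for N x
  proof (rule Cauchy_convergent, rule CauchyI)
    fix e :: real assume "e > 0"
    then have e: "e / 4 > 0" by simp
    obtain d where d: "d > 0" "\<And>n x x'. dist x x' < d \<Longrightarrow> \<bar>F N n x - F N n x'\<bar> \<le> e / 4" using equi[OF e] by blast
    obtain q where q: "q \<in> D" "dist x q < d" using D(2)[of "ball x d"] d(1) by auto
    have pos: "S N * L + 1 > 0" using S(1)[of N] L0 by (intro add_nonneg_pos mult_nonneg_nonneg) auto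
    obtain l where "(\<lambda>n. F N (r n) q / (S N * L + 1)) \<longlonglongrightarrow> l" using r(2)[of "(N, q)"] q(1) by auto
    from tendsto_mult_right[OF this, of "S N * L + 1"] have "(\<lambda>n. F N (r n) q) \<longlonglongrightarrow> l * (S N * L + 1)" using pos by simp
    then have "Cauchy (\<lambda>n. F N (r n) q)" by (rule LIMSEQ_imp_Cauchy)
    then obtain M where M: "\<And>m n. m \<ge> M \<Longrightarrow> n \<ge> M \<Longrightarrow> norm (F N (r m) q - F N (r n) q) < e / 4" using CauchyD[OF _ e] by metis
    have "norm (F N (r m) x - F N (r n) x) < e" if "m \<ge> M" "n \<ge> M" for m n
      using M[OF that] d(2)[OF q(2), of "r m"] d(2)[OF q(2), of "r n"] e unfolding real_norm_def by linarith
    then show "\<exists>M. \<forall>m\<ge>M. \<forall>n\<ge>M. norm (F N (r m) x - F N (r n) x) < e" by blast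
  qed
  define G where "G = (\<lambda>N x. lim (\<lambda>n. F N (r n) x))"
  have G: "(\<lambda>n. F N (r n) x) \<longlonglongrightarrow> G N x" for N x unfolding G_def using conv convergent_LIMSEQ_iff by blast
  have cF: "continuous_on UNIV (F N n)" for N n
    unfolding continuous_on_iff
  proof (intro ballI allI impI)
    fix x and e :: real assume "e > 0"
    then obtain d where d: "d > 0" "\<And>n x x'. dist x x' < d \<Longrightarrow> \<bar>F N n x - F N n x'\<bar> \<le> e / 2" using equi[of "e / 2" N] by auto
    show "\<exists>d>0. \<forall>x'\<in>UNIV. dist x' x < d \<longrightarrow> dist (F N n x') (F N n x) < e"
    proof (intro exI[of _ d] conjI ballI impI d(1))
      fix x' assume "dist x' x < d"
      then show "dist (F N n x') (F N n x) < e" using d(2)[of x' x n] \<open>e > 0\<close> by (simp add: dist_real_def)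
    qed
  qed
  have F0: "F N n x = 0" if "x \<notin> cball 0 (R + 1)" for N n x
  proof -
    have "\<rho> N y * f n (y + x) = 0" for y
    proof (cases "norm y < 1")
      case True
      have "norm x \<le> norm (y + x) + norm y" by (metis add_diff_cancel_left' norm_triangle_ineq4)
      then have "norm (y + x) > R" using that True by simp
      then show ?thesis using supp by simp
    next
      case False
      then show ?thesis using \<rho>(3)[of N y] \<delta>(2)[of N] by simp
    qed
    then have "(\<lambda>y. \<rho> N y * f n (y + x)) = (\<lambda>_. 0)" by (rule ext)
    then show ?thesis by (simp only: F_def integral_zero)
  qed
  have Gm[measurable]: "G N \<in> borel_measurable borel" for N
    by (rule borel_measurable_LIMSEQ_metric[OF _ G]) (rule borel_measurable_continuous_onI[OF cF])
  have Fm[measurable]: "F N n \<in> borel_measurable borel" for N n by (rule borel_measurable_continuous_onI[OF cF])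
  define W where "W = (\<lambda>N n x. (F N (r n) x - G N x)\<^sup>2)"
  have G_bound: "\<bar>G N x\<bar> \<le> S N * L" for N x
    by (rule tendsto_upperbound[OF tendsto_rabs[OF G]]) (use F_bound in auto)
  have G0: "G N x = 0" if "x \<notin> cball 0 (R + 1)" for N x
    using G[of N x] F0[OF that] by (simp add: LIMSEQ_const_iff)
  have iw: "integrable lborel (\<lambda>x. indicator (cball (0::'a) (R + 1)) x *\<^sub>R (2 * (S N * L))\<^sup>2)" for N
    by (rule borel_integrable_compact) auto
  have wb: "norm (W N n x) \<le> indicator (cball 0 (R + 1)) x *\<^sub>R (2 * (S N * L))\<^sup>2" for N n x
  proof (cases "x \<in> cball 0 (R + 1)")
    case True
    have "\<bar>F N (r n) x - G N x\<bar> \<le> 2 * (S N * L)" using F_bound[of N "r n" x] G_bound[of N x] by linarith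
    then have "\<bar>F N (r n) x - G N x\<bar>\<^sup>2 \<le> (2 * (S N * L))\<^sup>2" by (rule power_mono) simp
    then show ?thesis using True by (simp add: W_def)
  next
    case False then show ?thesis using F0[OF False] G0[OF False] by (simp add: W_def)
  qed
  have Wm: "W N n \<in> borel_measurable lborel" for N n unfolding W_def by measurable
  have iW: "integrable lborel (W N n)" for N n
    by (rule Bochner_Integration.integrable_bound[OF iw[of N] Wm]) (use wb in auto)
  have W0: "(\<lambda>n. LINT x|lborel. W N n x) \<longlonglongrightarrow> 0" for N
  proof -
    have "(\<lambda>n. LINT x|lborel. W N n x) \<longlonglongrightarrow> (LINT x|(lborel :: 'a measure). (0::real))"
    proof (rule integral_dominated_convergence[where w = "\<lambda>x. indicator (cball (0::'a) (R + 1)) x *\<^sub>R (2 * (S N * L))\<^sup>2"])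
      show "AE x in lborel. (\<lambda>n. W N n x) \<longlonglongrightarrow> 0"
      proof (rule AE_I2)
        fix x
        have "(\<lambda>n. (F N (r n) x - G N x)\<^sup>2) \<longlonglongrightarrow> (G N x - G N x)\<^sup>2" by (intro tendsto_intros G)
        then show "(\<lambda>n. W N n x) \<longlonglongrightarrow> 0" by (simp add: W_def)
      qed
    qed (use wb Wm iw[of N] in auto)
    then show ?thesis by simp
  qed
  have moll: "(LINT x|lborel. (F N n x - f n x)\<^sup>2) \<le> (\<delta> N)\<^sup>2 * Q" and smoll: "square_integrable lborel (\<lambda>x. F N n x - f n x)" for N n
  proof -
    have [measurable]: "f n \<in> borel_measurable borel" by (rule borel_measurable_continuous_onI[OF cf])
    have "(\<integral>\<^sup>+x. ennreal ((F N n x - f n x)\<^sup>2) \<partial>lborel) \<le> ennreal ((\<delta> N)\<^sup>2 * (LINT x|lborel. (norm (grad (f n) x))\<^sup>2))"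
      unfolding F_def by (rule mollification_estimate[OF f B \<rho> \<delta>(1)])
    also have "\<dots> \<le> ennreal ((\<delta> N)\<^sup>2 * Q)" by (intro ennreal_leI mult_left_mono Q) simp
    finally have le: "(\<integral>\<^sup>+x. ennreal ((norm (F N n x - f n x))\<^sup>2) \<partial>lborel) \<le> ennreal ((\<delta> N)\<^sup>2 * Q)" by simp
    have m: "(\<lambda>x. F N n x - f n x) \<in> borel_measurable lborel" by measurable
    show "(LINT x|lborel. (F N n x - f n x)\<^sup>2) \<le> (\<delta> N)\<^sup>2 * Q" "square_integrable lborel (\<lambda>x. F N n x - f n x)"
      using square_integrable_if_nn_integral_le[OF m le] Q0 by simp_all
  qed
  show ?thesis
  proof (rule that[OF r(1)])
    fix e :: real assume e: "e > 0"
    obtain N :: nat where N: "(\<delta> N)\<^sup>2 * Q < e / 16"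
    proof -
      obtain N :: nat where N: "real N > 16 * Q / e" using reals_Archimedean2 by blast
      have "(\<delta> N)\<^sup>2 * Q \<le> \<delta> N * 1 * Q"
        unfolding power2_eq_square using \<delta>[of N] Q0 by (intro mult_right_mono mult_left_mono) auto
      also have "\<dots> < e / 16" using N e Q0 by (simp add: \<delta>_def field_simps)
      finally show ?thesis using that by blast
    qed
    have "e / 64 > 0" using e by simp
    from LIMSEQ_D[OF W0[of N] this] obtain M where M: "\<And>n. n \<ge> M \<Longrightarrow> \<bar>LINT x|lborel. W N n x\<bar> < e / 64" by auto
    have "(LINT x|lborel. (f (r m) x - f (r n) x)\<^sup>2) < e" if mn: "m \<ge> M" "n \<ge> M" for m n
    proof -
      let ?g = "\<lambda>x. 4 * (F N (r m) x - f (r m) x)\<^sup>2 + 4 * (F N (r n) x - f (r n) x)\<^sup>2 + 4 * W N m x + 4 * W N n x"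
      have i: "integrable lborel (\<lambda>x. (F N n x - f n x)\<^sup>2)" for n using smoll[of N n] by (simp add: square_integrable_def)
      have "(LINT x|lborel. (f (r m) x - f (r n) x)\<^sup>2) \<le> (LINT x|lborel. ?g x)"
      proof (rule integral_mono)
        show "integrable lborel (\<lambda>x. (f (r m) x - f (r n) x)\<^sup>2)"
          using square_integrable_diff[OF sf sf, of "r m" "r n"] by (simp add: square_integrable_def)
        show "integrable lborel ?g" using i iW by auto
        fix x
        have four: "(a + b + c + d)\<^sup>2 \<le> 4 * a\<^sup>2 + 4 * b\<^sup>2 + 4 * c\<^sup>2 + 4 * d\<^sup>2" for a b c d :: real
        proof -
          have "4 * a\<^sup>2 + 4 * b\<^sup>2 + 4 * c\<^sup>2 + 4 * d\<^sup>2 - (a + b + c + d)\<^sup>2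
            = (a - b)\<^sup>2 + (a - c)\<^sup>2 + (a - d)\<^sup>2 + (b - c)\<^sup>2 + (b - d)\<^sup>2 + (c - d)\<^sup>2"
            by (simp add: power2_eq_square algebra_simps)
          then show ?thesis by (smt (verit) zero_le_power2)
        qed
        show "(f (r m) x - f (r n) x)\<^sup>2 \<le> ?g x"
          using four[of "- (F N (r m) x - f (r m) x)" "F N (r n) x - f (r n) x" "F N (r m) x - G N x" "- (F N (r n) x - G N x)"]
          by (simp add: W_def algebra_simps power2_commute)
      qed
      also have "\<dots> = 4 * (LINT x|lborel. (F N (r m) x - f (r m) x)\<^sup>2) + 4 * (LINT x|lborel. (F N (r n) x - f (r n) x)\<^sup>2)
          + 4 * (LINT x|lborel. W N m x) + 4 * (LINT x|lborel. W N n x)"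
        using i iW by simp
      also have "\<dots> < e"
        using moll[where N = N and n = "r m"] moll[where N = N and n = "r n"] N M[OF mn(1)] M[OF mn(2)] by (simp add: abs_less_iff)
      finally show ?thesis .
    qed
    then show "\<exists>N. \<forall>m\<ge>N. \<forall>n\<ge>N. (LINT x|lborel. (f (r m) x - f (r n) x)\<^sup>2) < e" by blast
  qed
qed

section \<open>The variational bound for the first Dirichlet eigenvalue\<close>

lemma L2_limit_if_nn_integral_limit:
  fixes f :: "nat \<Rightarrow> 'x \<Rightarrow> 'b::euclidean_space"
  assumes f: "\<And>n. square_integrable M (f n)" and h: "h \<in> borel_measurable M"
    and lim: "(\<lambda>n. \<integral>\<^sup>+x. ennreal ((norm (f n x - h x))\<^sup>2) \<partial>M) \<longlonglongrightarrow> 0"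
  shows "square_integrable M h" "(\<lambda>n. LINT x|M. (norm (f n x - h x))\<^sup>2) \<longlonglongrightarrow> 0"
proof -
  have m: "(\<lambda>x. f n x - h x) \<in> borel_measurable M" for n
    using f[of n] h by (intro borel_measurable_diff) (auto simp: square_integrable_def)
  have ev: "\<forall>\<^sub>F n in sequentially. square_integrable M (\<lambda>x. f n x - h x) \<and> (LINT x|M. (norm (f n x - h x))\<^sup>2) \<le> e" if "e > 0" for e
  proof -
    have "ennreal e > 0" using that by simp
    from order_tendstoD(2)[OF lim this] show ?thesis
    proof eventually_elim
      case (elim n)
      then show ?case using square_integrable_if_nn_integral_le[OF m, of n e] that by auto
    qed
  qed
  obtain n where "square_integrable M (\<lambda>x. f n x - h x)"
    using eventually_happens'[OF _ ev[of 1]] by auto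
  from square_integrable_diff[OF f[of n] this] show "square_integrable M h" by simp
  show "(\<lambda>n. LINT x|M. (norm (f n x - h x))\<^sup>2) \<longlonglongrightarrow> 0"
  proof (rule tendstoI)
    fix e :: real assume "e > 0"
    then have "\<forall>\<^sub>F n in sequentially. (LINT x|M. (norm (f n x - h x))\<^sup>2) \<le> e / 2" using ev[of "e / 2"] by (auto elim: eventually_mono)
    then show "\<forall>\<^sub>F n in sequentially. dist (LINT x|M. (norm (f n x - h x))\<^sup>2) 0 < e"
      by eventually_elim (use \<open>e > 0\<close> in \<open>auto simp: dist_real_def\<close>)
  qed
qed

lemma test_function_properties:
  fixes f :: "'a::euclidean_space \<Rightarrow> real"
  assumes "test_function U f"
  shows "Ck_on 1 UNIV f" "square_integrable lborel f" "square_integrable lborel (grad f)"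
    "\<And>x. x \<notin> U \<Longrightarrow> f x = 0" "\<And>x. x \<notin> U \<Longrightarrow> grad f x = 0" "continuous_on UNIV f"
proof -
  obtain K where K: "compact K" "K \<subseteq> U" "\<And>x. x \<notin> K \<Longrightarrow> f x = 0" using assms unfolding test_function_iff by blast
  show C: "Ck_on 1 UNIV f" using assms unfolding test_function_iff by blast
  note F = Ck_on_1_grad[OF C]
  have cK: "closed K" using K(1) compact_imp_closed by blast
  note g0 = grad_eq_0[OF cK K(3)]
  show "square_integrable lborel f" by (rule square_integrable_compact_support[OF F(2) K(1,3)])
  show "square_integrable lborel (grad f)" by (rule square_integrable_compact_support[OF F(3) K(1) g0])
  show "f x = 0" if "x \<notin> U" for x using K that by blast
  show "grad f x = 0" if "x \<notin> U" for x
    by (rule grad_eq_0[OF cK]) (use K(2,3) that in auto)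
  show "continuous_on UNIV f" by (rule F(2))
qed

lemma test_function_lincomb:
  assumes f: "test_function U f" and g: "test_function U g"
  shows "test_function U (\<lambda>x. a * f x + b * g x)"
    "grad (\<lambda>x. a * f x + b * g x) = (\<lambda>x. a *\<^sub>R grad f x + b *\<^sub>R grad g x)"
proof -
  obtain K where K: "compact K" "K \<subseteq> U" "\<And>x. x \<notin> K \<Longrightarrow> f x = 0" using f unfolding test_function_iff by blast
  obtain L where L: "compact L" "L \<subseteq> U" "\<And>x. x \<notin> L \<Longrightarrow> g x = 0" using g unfolding test_function_iff by blast
  show "test_function U (\<lambda>x. a * f x + b * g x)"
    unfolding test_function_iff
  proof (intro conjI allI exI[of _ "K \<union> L"])
    show "Ck_on m UNIV (\<lambda>x. a * f x + b * g x)" for m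
      by (intro Ck_on_add Ck_on_mult Ck_on_const) (use f g in \<open>auto simp: test_function_iff\<close>)
  qed (use K L in auto)
  note F = Ck_on_1_grad[OF test_function_properties(1)[OF f]] and G = Ck_on_1_grad[OF test_function_properties(1)[OF g]]
  show "grad (\<lambda>x. a * f x + b * g x) = (\<lambda>x. a *\<^sub>R grad f x + b *\<^sub>R grad g x)"
  proof
    fix x
    have d: "((\<lambda>x. a * f x + b * g x) has_derivative (\<lambda>v. a * (grad f x \<bullet> v) + b * (grad g x \<bullet> v))) (at x)"
      by (intro derivative_intros F(1) G(1))
    show "grad (\<lambda>x. a * f x + b * g x) x = a *\<^sub>R grad f x + b *\<^sub>R grad g x"
      by (rule euclidean_eqI) (simp add: grad_inner[OF d] inner_add_left)
  qed
qed

lemma set_integral_eq_cutoff: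
  fixes u :: "'a::euclidean_space \<Rightarrow> 'b::euclidean_space"
  assumes "\<And>x. x \<notin> U \<Longrightarrow> h x = 0"
  shows "(LINT x:U|lborel. u x \<bullet> h x) = (LINT x|lborel. (indicator U x *\<^sub>R u x) \<bullet> h x)"
  unfolding set_lebesgue_integral_def by simp

text \<open>Testing the equation with the test functions that approximate the eigenfunction \<open>u\<close> gives
  $\int |g|^2 = \mu \int u^2$ in the limit. So the infimum in \<open>first_dirichlet_eigenvalue\<close> is over a set that is
  bounded below.\<close>

lemma dirichlet_eigenvalue_nonneg:
  fixes U :: "'a::euclidean_space set"
  assumes U: "open U" and ev: "dirichlet_eigenvalue U \<mu>"
  shows "\<mu> \<ge> 0"
proof -
  from ev obtain u g where H: "in_H10 U u g" and nz: "\<not> (AE x in lborel. x \<in> U \<longrightarrow> u x = 0)"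
    and weak: "\<And>f. test_function U f \<Longrightarrow> (LINT x:U|lborel. g x \<bullet> grad f x) = \<mu> * (LINT x:U|lborel. u x * f x)"
    unfolding dirichlet_eigenvalue_def by blast
  from H obtain f :: "nat \<Rightarrow> 'a \<Rightarrow> real" where um[measurable]: "u \<in> borel_measurable borel" "g \<in> borel_measurable borel"
    and f: "\<And>n. test_function U (f n)"
    and lu: "(\<lambda>n. \<integral>\<^sup>+x\<in>U. ennreal ((f n x - u x)\<^sup>2) \<partial>lborel) \<longlonglongrightarrow> 0"
    and lg: "(\<lambda>n. \<integral>\<^sup>+x\<in>U. ennreal ((norm (grad (f n) x - g x))\<^sup>2) \<partial>lborel) \<longlonglongrightarrow> 0"
    unfolding in_H10_def by blast
  have Um[measurable]: "U \<in> sets borel" using U by simp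
  note ff = test_function_properties[OF f]
  define u' where "u' = (\<lambda>x. indicator U x *\<^sub>R u x)"
  define g' where "g' = (\<lambda>x. indicator U x *\<^sub>R g x)"
  have u'm: "u' \<in> borel_measurable lborel" "g' \<in> borel_measurable lborel" unfolding u'_def g'_def by measurable
  have eu: "(\<integral>\<^sup>+x\<in>U. ennreal ((f n x - u x)\<^sup>2) \<partial>lborel) = (\<integral>\<^sup>+x. ennreal ((norm (f n x - u' x))\<^sup>2) \<partial>lborel)" for n
    by (rule nn_integral_cong) (use ff(4)[of _ n] in \<open>auto simp: u'_def indicator_def\<close>)
  have eg: "(\<integral>\<^sup>+x\<in>U. ennreal ((norm (grad (f n) x - g x))\<^sup>2) \<partial>lborel) = (\<integral>\<^sup>+x. ennreal ((norm (grad (f n) x - g' x))\<^sup>2) \<partial>lborel)" for n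
    by (rule nn_integral_cong) (use ff(5)[of _ n] in \<open>auto simp: g'_def indicator_def\<close>)
  note Lu = L2_limit_if_nn_integral_limit[OF ff(2) u'm(1) lu[unfolded eu]]
  note Lg = L2_limit_if_nn_integral_limit[OF ff(3) u'm(2) lg[unfolded eg]]
  have w: "(LINT x|lborel. grad (f n) x \<bullet> g' x) = \<mu> * (LINT x|lborel. f n x \<bullet> u' x)" for n
  proof -
    have "(LINT x:U|lborel. g x \<bullet> grad (f n) x) = (LINT x|lborel. g' x \<bullet> grad (f n) x)"
      unfolding g'_def by (rule set_integral_eq_cutoff) (rule ff(5))
    moreover have "(LINT x:U|lborel. u x \<bullet> f n x) = (LINT x|lborel. u' x \<bullet> f n x)"
      unfolding u'_def by (rule set_integral_eq_cutoff) (rule ff(4))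
    ultimately show ?thesis using weak[OF f[of n]] by (simp add: inner_commute mult.commute)
  qed
  have "(\<lambda>n. LINT x|lborel. grad (f n) x \<bullet> g' x) \<longlonglongrightarrow> (LINT x|lborel. g' x \<bullet> g' x)"
    by (rule L2_tendsto_inner[OF ff(3) Lg Lg(1)])
  moreover have "(\<lambda>n. \<mu> * (LINT x|lborel. f n x \<bullet> u' x)) \<longlonglongrightarrow> \<mu> * (LINT x|lborel. u' x \<bullet> u' x)"
    by (intro tendsto_mult_left L2_tendsto_inner[OF ff(2) Lu Lu(1)])
  ultimately have eq: "(LINT x|lborel. g' x \<bullet> g' x) = \<mu> * (LINT x|lborel. u' x \<bullet> u' x)"
    unfolding w by (rule LIMSEQ_unique)
  have "(LINT x|lborel. u' x \<bullet> u' x) \<noteq> 0"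
  proof
    assume "(LINT x|lborel. u' x \<bullet> u' x) = 0"
    then have "AE x in lborel. u' x \<bullet> u' x = 0"
      using integral_nonneg_eq_0_iff_AE[OF integrable_inner[OF Lu(1) Lu(1)]] by simp
    then have "AE x in lborel. x \<in> U \<longrightarrow> u x = 0" by eventually_elim (auto simp: u'_def)
    then show False using nz by simp
  qed
  moreover have "(LINT x|lborel. u' x \<bullet> u' x) \<ge> 0" by (rule Bochner_Integration.integral_nonneg) simp
  moreover have "(LINT x|lborel. g' x \<bullet> g' x) \<ge> 0" by (rule Bochner_Integration.integral_nonneg) simp
  ultimately show ?thesis using eq by (metis less_eq_real_def mult_neg_pos not_le)
qed

text \<open>The infimum \<open>\<mu>\<close> of the Rayleigh quotient is an eigenvalue. A normalised minimising sequence $h_n$ of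
  test functions converges in the mean square by \<open>compact_embedding\<close>. The form
  $E(f, g) = \int \nabla f \cdot \nabla g - \mu \int f g$ is positive semidefinite and $E(h_n, h_n)$ tends to zero; this
  forces the gradients to converge, and the Cauchy--Schwarz inequality for $E$ gives the weak equation in the
  limit.\<close>

lemma dirichlet_eigenvalue_le_Rayleigh_quotient:
  fixes U :: "'a::euclidean_space set"
  assumes U: "open U" "bounded U" and f0: "test_function U f0" and nz: "(LINT x|lborel. (f0 x)\<^sup>2) \<noteq> 0"
  obtains \<mu> where "dirichlet_eigenvalue U \<mu>"
    "\<mu> \<le> (LINT x|lborel. (norm (grad f0 x))\<^sup>2) / (LINT x|lborel. (f0 x)\<^sup>2)"
proof -
  define A where "A = (\<lambda>f g :: 'a \<Rightarrow> real. LINT x|lborel. f x \<bullet> g x)"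
  define B where "B = (\<lambda>f g :: 'a \<Rightarrow> real. LINT x|lborel. grad f x \<bullet> grad g x)"
  have AA: "A f f = (LINT x|lborel. (f x)\<^sup>2)" for f by (simp add: A_def power2_eq_square)
  have BB: "B f f = (LINT x|lborel. (norm (grad f x))\<^sup>2)" for f by (simp add: B_def power2_norm_eq_inner)
  have A0: "A f f \<ge> 0" and B0: "B f f \<ge> 0" for f unfolding AA BB by simp_all
  note T = test_function_properties and TL = test_function_lincomb
  have Alin: "A (\<lambda>x. a * f x + b * g x) (\<lambda>x. a * f x + b * g x) = a\<^sup>2 * A f f + 2 * a * b * A f g + b\<^sup>2 * A g g"
    if "test_function U f" "test_function U g" for f g a b
    using square_integrable_lincomb(2)[OF T(2)[OF that(1)] T(2)[OF that(2)], of a b] unfolding AA unfolding A_def by simp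
  have Blin: "B (\<lambda>x. a * f x + b * g x) (\<lambda>x. a * f x + b * g x) = a\<^sup>2 * B f f + 2 * a * b * B f g + b\<^sup>2 * B g g"
    if "test_function U f" "test_function U g" for f g a b
    using square_integrable_lincomb(2)[OF T(3)[OF that(1)] T(3)[OF that(2)], of a b] unfolding BB TL(2)[OF that] unfolding B_def by simp
  define S where "S = {B f f / A f f | f. test_function U f \<and> A f f \<noteq> 0}"
  define \<mu> where "\<mu> = Inf S"
  have S0: "s \<ge> 0" if "s \<in> S" for s using that A0 B0 by (auto simp: S_def)
  have bdd: "bdd_below S" using S0 by (rule bdd_belowI)
  have f0S: "B f0 f0 / A f0 f0 \<in> S" using f0 nz by (auto simp: S_def AA)
  have \<mu>0: "\<mu> \<ge> 0" unfolding \<mu>_def by (rule cInf_greatest) (use f0S S0 in auto)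
  define E where "E = (\<lambda>f g. B f g - \<mu> * A f g)"
  have E0: "E f f \<ge> 0" if "test_function U f" for f
  proof (cases "A f f = 0")
    case True then show ?thesis using B0 by (simp add: E_def)
  next
    case False
    then have "\<mu> \<le> B f f / A f f" unfolding \<mu>_def using that by (intro cInf_lower bdd) (auto simp: S_def)
    then show ?thesis using False A0[of f] by (simp add: E_def field_simps)
  qed
  have Elin: "E (\<lambda>x. a * f x + b * g x) (\<lambda>x. a * f x + b * g x) = a\<^sup>2 * E f f + 2 * a * b * E f g + b\<^sup>2 * E g g"
    if "test_function U f" "test_function U g" for f g a b
    unfolding E_def Alin[OF that] Blin[OF that] by (simp add: algebra_simps)
  have "\<exists>f. test_function U f \<and> A f f = 1 \<and> E f f < 1 / (real n + 1)" for n :: nat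
  proof -
    have "\<mu> < \<mu> + 1 / (real n + 1)" by simp
    then obtain s where "s \<in> S" "s < \<mu> + 1 / (real n + 1)"
      using cInf_lessD[of S "\<mu> + 1 / (real n + 1)"] f0S unfolding \<mu>_def by blast
    then obtain f where f: "test_function U f" "A f f \<noteq> 0" "B f f / A f f < \<mu> + 1 / (real n + 1)" by (auto simp: S_def)
    have Af: "A f f > 0" using f(2) A0[of f] by simp
    let ?a = "1 / sqrt (A f f)"
    have a2: "?a\<^sup>2 = 1 / A f f" using Af by (simp add: power_divide)
    have "A (\<lambda>x. ?a * f x + 0 * f x) (\<lambda>x. ?a * f x + 0 * f x) = 1" unfolding Alin[OF f(1) f(1)] a2 using Af by simp
    moreover have "E (\<lambda>x. ?a * f x + 0 * f x) (\<lambda>x. ?a * f x + 0 * f x) < 1 / (real n + 1)"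
      unfolding Elin[OF f(1) f(1)] a2 using f(3) Af by (simp add: E_def diff_divide_distrib)
    ultimately show ?thesis using TL(1)[OF f(1) f(1)] by blast
  qed
  then obtain f where f: "\<And>n::nat. test_function U (f n)" "\<And>n. A (f n) (f n) = 1" "\<And>n. E (f n) (f n) < 1 / (real n + 1)" by metis
  obtain R where R: "\<And>x. x \<in> U \<Longrightarrow> norm x \<le> R" using U(2) bounded_iff by metis
  have Bf: "B (f n) (f n) \<le> \<mu> + 1" for n
  proof -
    have "1 / (real n + 1) \<le> 1" by simp
    then show ?thesis using f(3)[of n] unfolding E_def f(2) mult_1_right by linarith
  qed
  obtain r :: "nat \<Rightarrow> nat" where r: "strict_mono r" and rC: "\<And>e. e > 0 \<Longrightarrow> \<exists>N. \<forall>m\<ge>N. \<forall>n\<ge>N. (LINT x|lborel. (f (r m) x - f (r n) x)\<^sup>2) < e"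
  proof (rule compact_embedding[of f R 1 "\<mu> + 1"])
    show "Ck_on 1 UNIV (f n)" for n by (rule T(1)[OF f(1)])
    show "f n x = 0" if "norm x > R" for n x using R[of x] that T(4)[OF f(1)] by force
    show "(LINT x|lborel. (f n x)\<^sup>2) \<le> 1" for n using f(2)[of n] by (simp add: AA)
    show "(LINT x|lborel. (norm (grad (f n) x))\<^sup>2) \<le> \<mu> + 1" for n using Bf[of n] by (simp add: BB)
  next
    fix r :: "nat \<Rightarrow> nat"
    assume "strict_mono r" "\<And>e. e > 0 \<Longrightarrow> \<exists>N. \<forall>m\<ge>N. \<forall>n\<ge>N. (LINT x|lborel. (f (r m) x - f (r n) x)\<^sup>2) < e"
    then show thesis by (rule that)
  qed
  define h where "h = (\<lambda>n. f (r n))"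
  have h: "test_function U (h n)" "A (h n) (h n) = 1" for n using f by (simp_all add: h_def)
  have Eh: "E (h n) (h n) < 1 / (real n + 1)" for n
  proof -
    have "n \<le> r n" by (rule strict_mono_imp_increasing[OF r])
    then have "1 / (real (r n) + 1) \<le> 1 / (real n + 1)" by (intro divide_left_mono) auto
    then show ?thesis using f(3)[of "r n"] by (simp add: h_def)
  qed
  have Ehlim: "(\<lambda>n. E (h n) (h n)) \<longlonglongrightarrow> 0"
  proof (rule tendsto_sandwich[OF always_eventually always_eventually tendsto_const])
    show "(\<lambda>n. 1 / (real n + 1)) \<longlonglongrightarrow> 0" using lim_1_over_n[THEN LIMSEQ_Suc] by (simp add: add.commute)
  qed (use E0[OF h(1)] Eh less_imp_le in auto)
  have Cauchy1: "\<exists>N. \<forall>m\<ge>N. \<forall>n\<ge>N. (LINT x|lborel. (norm (h m x - h n x))\<^sup>2) < e" if "e > 0" for e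
    using rC[OF that] by (simp add: h_def)
  (* The parallelogram identity for E bounds E on h m - h n by 2 E(h m, h m) + 2 E(h n, h n). *)
  have Cauchy2: "\<exists>N. \<forall>m\<ge>N. \<forall>n\<ge>N. (LINT x|lborel. (norm (grad (h m) x - grad (h n) x))\<^sup>2) < e" if e: "e > 0" for e
  proof -
    have "e / (2 * (\<mu> + 1)) > 0" using e \<mu>0 by simp
    then obtain N1 where N1: "\<And>m n. m \<ge> N1 \<Longrightarrow> n \<ge> N1 \<Longrightarrow> (LINT x|lborel. (norm (h m x - h n x))\<^sup>2) < e / (2 * (\<mu> + 1))"
      using Cauchy1 by meson
    have "e / 8 > 0" using e by simp
    from LIMSEQ_D[OF Ehlim this] obtain N2 where N2: "\<And>n. n \<ge> N2 \<Longrightarrow> norm (E (h n) (h n) - 0) < e / 8" by blast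
    have "(LINT x|lborel. (norm (grad (h m) x - grad (h n) x))\<^sup>2) < e" if mn: "m \<ge> max N1 N2" "n \<ge> max N1 N2" for m n
    proof -
      let ?d = "\<lambda>x. 1 * h m x + (- 1) * h n x"
      have gd: "grad ?d = (\<lambda>x. 1 *\<^sub>R grad (h m) x + (- 1) *\<^sub>R grad (h n) x)" by (rule TL(2)[OF h(1) h(1)])
      have Bd: "(LINT x|lborel. (norm (grad (h m) x - grad (h n) x))\<^sup>2) = B ?d ?d" unfolding BB gd by simp
      have Ad: "A ?d ?d = (LINT x|lborel. (norm (h m x - h n x))\<^sup>2)" unfolding AA by simp
      have "E ?d ?d + E (\<lambda>x. 1 * h m x + 1 * h n x) (\<lambda>x. 1 * h m x + 1 * h n x) = 2 * E (h m) (h m) + 2 * E (h n) (h n)"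
        unfolding Elin[OF h(1) h(1)] by simp
      then have "E ?d ?d \<le> 2 * E (h m) (h m) + 2 * E (h n) (h n)" using E0[OF TL(1)[OF h(1) h(1)], of 1 m 1 n] by linarith
      also have "\<dots> < e / 2" using N2[of m] N2[of n] mn by (simp add: abs_less_iff)
      finally have e1: "E ?d ?d < e / 2" .
      have "\<mu> * A ?d ?d \<le> (\<mu> + 1) * A ?d ?d" using A0[of ?d] by (intro mult_right_mono) auto
      also have "\<dots> \<le> (\<mu> + 1) * (e / (2 * (\<mu> + 1)))"
        unfolding Ad using N1[of m n] mn \<mu>0 by (intro mult_left_mono) auto
      also have "\<dots> = e / 2" using \<mu>0 by (simp add: field_simps)
      finally have "\<mu> * A ?d ?d \<le> e / 2" .
      moreover have "B ?d ?d = E ?d ?d + \<mu> * A ?d ?d" by (simp add: E_def)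
      ultimately show ?thesis unfolding Bd using e1 by linarith
    qed
    then show ?thesis by blast
  qed
  obtain u where u: "square_integrable lborel u" "(\<lambda>n. LINT x|lborel. (norm (h n x - u x))\<^sup>2) \<longlonglongrightarrow> 0"
    by (rule L2_complete[OF T(2)[OF h(1)] Cauchy1])
  obtain g where g: "square_integrable lborel g" "(\<lambda>n. LINT x|lborel. (norm (grad (h n) x - g x))\<^sup>2) \<longlonglongrightarrow> 0"
    by (rule L2_complete[OF T(3)[OF h(1)] Cauchy2])
  have Um[measurable]: "U \<in> sets borel" using U by simp
  (* The limits are determined up to null sets only; the representatives that vanish off U are chosen. *)
  have cutoff: "square_integrable lborel (\<lambda>x. indicator U x *\<^sub>R w x) \<and>
      (\<lambda>n. LINT x|lborel. (norm (p n x - indicator U x *\<^sub>R w x))\<^sup>2) \<longlonglongrightarrow> 0"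
    if w: "square_integrable lborel w" and p: "\<And>n. square_integrable lborel (p n)" "\<And>n x. x \<notin> U \<Longrightarrow> p n x = 0"
      and lim: "(\<lambda>n. LINT x|lborel. (norm (p n x - w x))\<^sup>2) \<longlonglongrightarrow> 0" for w :: "'a \<Rightarrow> 'b::euclidean_space" and p
  proof -
    have [measurable]: "w \<in> borel_measurable borel" using w by (simp add: square_integrable_def)
    have s: "square_integrable lborel (\<lambda>x. indicator U x *\<^sub>R w x)" unfolding square_integrable_def
    proof
      show "(\<lambda>x. indicat_real U x *\<^sub>R w x) \<in> borel_measurable lborel" by measurable
      show "integrable lborel (\<lambda>x. (norm (indicat_real U x *\<^sub>R w x))\<^sup>2)"
        by (rule Bochner_Integration.integrable_bound[of _ "\<lambda>x. (norm (w x))\<^sup>2"])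
           (use w in \<open>auto simp: square_integrable_def indicator_def\<close>)
    qed
    have "(\<lambda>n. LINT x|lborel. (norm (p n x - indicator U x *\<^sub>R w x))\<^sup>2) \<longlonglongrightarrow> 0"
    proof (rule tendsto_sandwich[OF always_eventually always_eventually tendsto_const lim])
      show "\<forall>n. (LINT x|lborel. (norm (p n x - indicator U x *\<^sub>R w x))\<^sup>2) \<le> (LINT x|lborel. (norm (p n x - w x))\<^sup>2)"
      proof (rule allI, rule integral_mono)
        fix n x
        show "(norm (p n x - indicator U x *\<^sub>R w x))\<^sup>2 \<le> (norm (p n x - w x))\<^sup>2"
          using p(2)[of x n] by (cases "x \<in> U") auto
      qed (use square_integrable_diff[OF p(1) s] square_integrable_diff[OF p(1) w] in \<open>auto simp: square_integrable_def\<close>)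
    qed simp
    then show ?thesis using s by blast
  qed
  define u' where "u' = (\<lambda>x. indicat_real U x *\<^sub>R u x)"
  define g' where "g' = (\<lambda>x. indicat_real U x *\<^sub>R g x)"
  have u': "square_integrable lborel u'" "(\<lambda>n. LINT x|lborel. (norm (h n x - u' x))\<^sup>2) \<longlonglongrightarrow> 0"
    using cutoff[OF u(1) T(2)[OF h(1)] T(4)[OF h(1)] u(2)] by (simp_all add: u'_def)
  have g': "square_integrable lborel g'" "(\<lambda>n. LINT x|lborel. (norm (grad (h n) x - g' x))\<^sup>2) \<longlonglongrightarrow> 0"
    using cutoff[OF g(1) T(3)[OF h(1)] T(5)[OF h(1)] g(2)] by (simp_all add: g'_def)
  have u'1: "(LINT x|lborel. (norm (u' x))\<^sup>2) = 1"
  proof -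
    have "(\<lambda>n. LINT x|lborel. (norm (h n x))\<^sup>2) \<longlonglongrightarrow> (LINT x|lborel. (norm (u' x))\<^sup>2)"
      by (rule L2_tendsto_norm[OF T(2)[OF h(1)] u'])
    moreover have "(LINT x|lborel. (norm (h n x))\<^sup>2) = 1" for n using h(2)[of n] by (simp add: AA)
    ultimately show ?thesis by (simp add: LIMSEQ_const_iff)
  qed
  have nn: "(\<lambda>n. \<integral>\<^sup>+x\<in>U. ennreal ((norm (p n x - w x))\<^sup>2) \<partial>lborel) \<longlonglongrightarrow> 0"
    if p: "\<And>n. square_integrable lborel (p n)" "square_integrable lborel w" and lim: "(\<lambda>n. LINT x|lborel. (norm (p n x - w x))\<^sup>2) \<longlonglongrightarrow> 0"
    for p and w :: "'a \<Rightarrow> 'b::euclidean_space"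
  proof -
    have "(\<lambda>n. ennreal (LINT x|lborel. (norm (p n x - w x))\<^sup>2)) \<longlonglongrightarrow> ennreal 0" using lim by (rule tendsto_ennrealI)
    then have l0: "(\<lambda>n. ennreal (LINT x|lborel. (norm (p n x - w x))\<^sup>2)) \<longlonglongrightarrow> 0" by simp
    show ?thesis
    proof (rule tendsto_sandwich[OF always_eventually always_eventually tendsto_const l0])
      show "\<forall>n. (\<integral>\<^sup>+x\<in>U. ennreal ((norm (p n x - w x))\<^sup>2) \<partial>lborel) \<le> ennreal (LINT x|lborel. (norm (p n x - w x))\<^sup>2)"
      proof
        fix n
        have "(\<integral>\<^sup>+x\<in>U. ennreal ((norm (p n x - w x))\<^sup>2) \<partial>lborel) \<le> (\<integral>\<^sup>+x. ennreal ((norm (p n x - w x))\<^sup>2) \<partial>lborel)"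
          by (rule nn_integral_mono) (auto simp: indicator_def)
        also have "\<dots> = ennreal (LINT x|lborel. (norm (p n x - w x))\<^sup>2)"
          by (rule nn_integral_eq_integral) (use square_integrable_diff[OF p(1) p(2)] in \<open>auto simp: square_integrable_def\<close>)
        finally show "(\<integral>\<^sup>+x\<in>U. ennreal ((norm (p n x - w x))\<^sup>2) \<partial>lborel) \<le> ennreal (LINT x|lborel. (norm (p n x - w x))\<^sup>2)" .
      qed
    qed simp
  qed
  have "dirichlet_eigenvalue U \<mu>"
    unfolding dirichlet_eigenvalue_def
  proof (intro exI[of _ u'] exI[of _ g'] conjI allI impI)
    show "in_H10 U u' g'"
      unfolding in_H10_def
    proof (intro conjI exI[of _ h] allI)
      show "u' \<in> borel_measurable borel" "g' \<in> borel_measurable borel" using u'(1) g'(1) by (simp_all add: square_integrable_def)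
      show "test_function U (h n)" for n by (rule h(1))
      show "(\<lambda>n. \<integral>\<^sup>+x\<in>U. ennreal ((h n x - u' x)\<^sup>2) \<partial>lborel) \<longlonglongrightarrow> 0"
        using nn[OF T(2)[OF h(1)] u'] by simp
      show "(\<lambda>n. \<integral>\<^sup>+x\<in>U. ennreal ((norm (grad (h n) x - g' x))\<^sup>2) \<partial>lborel) \<longlonglongrightarrow> 0"
        by (rule nn[OF T(3)[OF h(1)] g'])
    qed
    show "\<not> (AE x in lborel. x \<in> U \<longrightarrow> u' x = 0)"
    proof
      assume "AE x in lborel. x \<in> U \<longrightarrow> u' x = 0"
      then have "AE x in lborel. (norm (u' x))\<^sup>2 = 0" by eventually_elim (auto simp: u'_def)
      then have "(LINT x|lborel. (norm (u' x))\<^sup>2) = 0" by (rule integral_eq_zero_AE)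
      then show False using u'1 by simp
    qed
    fix \<phi> assume \<phi>: "test_function U \<phi>"
    have "(\<lambda>n. (E (h n) \<phi>)\<^sup>2) \<longlonglongrightarrow> 0"
    proof (rule tendsto_sandwich[OF always_eventually always_eventually tendsto_const])
      show "\<forall>n. (E (h n) \<phi>)\<^sup>2 \<le> E (h n) (h n) * E \<phi> \<phi>"
      proof (intro allI quadratic_nonneg_imp_discriminant_le E0[OF \<phi>])
        fix n t
        have "0 \<le> E (\<lambda>x. 1 * h n x + t * \<phi> x) (\<lambda>x. 1 * h n x + t * \<phi> x)" by (rule E0[OF TL(1)[OF h(1) \<phi>]])
        then show "0 \<le> E (h n) (h n) + 2 * E (h n) \<phi> * t + E \<phi> \<phi> * t\<^sup>2"
          unfolding Elin[OF h(1) \<phi>] by (simp add: mult_ac)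
      qed
      show "(\<lambda>n. E (h n) (h n) * E \<phi> \<phi>) \<longlonglongrightarrow> 0" using tendsto_mult_right[OF Ehlim] by simp
    qed simp
    from tendsto_real_sqrt[OF this] have "(\<lambda>n. \<bar>E (h n) \<phi>\<bar>) \<longlonglongrightarrow> 0" by simp
    then have "(\<lambda>n. E (h n) \<phi>) \<longlonglongrightarrow> 0" by (simp only: tendsto_rabs_zero_iff)
    moreover have "(\<lambda>n. E (h n) \<phi>) \<longlonglongrightarrow> (LINT x|lborel. g' x \<bullet> grad \<phi> x) - \<mu> * (LINT x|lborel. u' x \<bullet> \<phi> x)"
      unfolding E_def A_def B_def
      by (intro tendsto_diff tendsto_mult_left L2_tendsto_inner[OF T(3)[OF h(1)] g' T(3)[OF \<phi>]] L2_tendsto_inner[OF T(2)[OF h(1)] u' T(2)[OF \<phi>]])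
    ultimately have e: "(LINT x|lborel. g' x \<bullet> grad \<phi> x) = \<mu> * (LINT x|lborel. u' x \<bullet> \<phi> x)"
      using LIMSEQ_unique by fastforce
    have "(LINT x:U|lborel. g' x \<bullet> grad \<phi> x) = (LINT x|lborel. (indicator U x *\<^sub>R g' x) \<bullet> grad \<phi> x)"
      by (rule set_integral_eq_cutoff) (rule T(5)[OF \<phi>])
    also have "\<dots> = (LINT x|lborel. g' x \<bullet> grad \<phi> x)"
      by (rule Bochner_Integration.integral_cong) (auto simp: g'_def indicator_def)
    finally have e1: "(LINT x:U|lborel. g' x \<bullet> grad \<phi> x) = (LINT x|lborel. g' x \<bullet> grad \<phi> x)" .
    have "(LINT x:U|lborel. u' x \<bullet> \<phi> x) = (LINT x|lborel. (indicator U x *\<^sub>R u' x) \<bullet> \<phi> x)"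
      by (rule set_integral_eq_cutoff) (rule T(4)[OF \<phi>])
    also have "\<dots> = (LINT x|lborel. u' x \<bullet> \<phi> x)"
      by (rule Bochner_Integration.integral_cong) (auto simp: u'_def indicator_def)
    finally have e2: "(LINT x:U|lborel. u' x \<bullet> \<phi> x) = (LINT x|lborel. u' x \<bullet> \<phi> x)" .
    show "(LINT x:U|lborel. g' x \<bullet> grad \<phi> x) = \<mu> * (LINT x:U|lborel. u' x * \<phi> x)"
      using e e1 e2 by simp
  qed
  moreover have "\<mu> \<le> (LINT x|lborel. (norm (grad f0 x))\<^sup>2) / (LINT x|lborel. (f0 x)\<^sup>2)"
    using cInf_lower[OF f0S bdd] by (simp add: \<mu>_def AA BB)
  ultimately show ?thesis by (rule that)
qed

text \<open>For test functions this is the minimality of the first eigenvalue. The extension by approximation to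
  functions with one continuous derivative is what a truncated solution requires.\<close>

theorem first_dirichlet_eigenvalue_inequality:
  fixes U :: "'a::euclidean_space set"
  assumes U: "open U" "bounded U" and lam: "l \<le> first_dirichlet_eigenvalue U"
    and f: "Ck_on 1 UNIV f" and K: "compact K" "K \<subseteq> U" "\<And>x. x \<notin> K \<Longrightarrow> f x = 0"
  shows "l * (LINT x|lborel. (f x)\<^sup>2) \<le> (LINT x|lborel. (norm (grad f x))\<^sup>2)"
proof -
  have test: "l * (LINT x|lborel. (h x)\<^sup>2) \<le> (LINT x|lborel. (norm (grad h x))\<^sup>2)" if h: "test_function U h" for h
  proof (cases "(LINT x|lborel. (h x)\<^sup>2) = 0")
    case True
    then show ?thesis by simp
  next
    case False
    then obtain \<mu> where \<mu>: "dirichlet_eigenvalue U \<mu>" "\<mu> \<le> (LINT x|lborel. (norm (grad h x))\<^sup>2) / (LINT x|lborel. (h x)\<^sup>2)"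
      by (rule dirichlet_eigenvalue_le_Rayleigh_quotient[OF U h])
    have "bdd_below {\<mu>. dirichlet_eigenvalue U \<mu>}"
      using dirichlet_eigenvalue_nonneg[OF U(1)] by (intro bdd_belowI[of _ 0]) auto
    then have "first_dirichlet_eigenvalue U \<le> \<mu>" unfolding first_dirichlet_eigenvalue_def
      using \<mu>(1) by (intro cInf_lower) auto
    then have "l \<le> (LINT x|lborel. (norm (grad h x))\<^sup>2) / (LINT x|lborel. (h x)\<^sup>2)" using lam \<mu>(2) by linarith
    moreover have "(LINT x|lborel. (h x)\<^sup>2) > 0" using False by (simp add: less_le)
    ultimately show ?thesis by (simp add: pos_le_divide_eq)
  qed
  note F = Ck_on_1_grad[OF f]
  obtain K' where K': "compact K'" "K \<subseteq> K'"
    and ap: "\<And>e. e > 0 \<Longrightarrow> \<exists>h. test_function U h \<and> (\<forall>x. x \<notin> K' \<longrightarrow> h x = 0) \<and> (\<forall>x. \<bar>h x - f x\<bar> \<le> e \<and> norm (grad h x - grad f x) \<le> e)"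
    using test_function_approximation[OF U(1) f K] by metis
  have "\<exists>h. test_function U h \<and> (\<forall>x. x \<notin> K' \<longrightarrow> h x = 0) \<and> (\<forall>x. \<bar>h x - f x\<bar> \<le> 1 / (real n + 1) \<and> norm (grad h x - grad f x) \<le> 1 / (real n + 1))" for n
    by (rule ap) simp
  then obtain h where h: "\<And>n. test_function U (h n)" "\<And>n x. x \<notin> K' \<Longrightarrow> h n x = 0"
    "\<And>n x. \<bar>h n x - f x\<bar> \<le> 1 / (real n + 1)" "\<And>n x. norm (grad (h n) x - grad f x) \<le> 1 / (real n + 1)" by metis
  have cK: "closed K" "closed K'" using K(1) K'(1) compact_imp_closed by auto
  have sf: "square_integrable lborel f" "square_integrable lborel (grad f)"
    by (rule square_integrable_compact_support[OF F(2) K(1,3)] square_integrable_compact_support[OF F(3) K(1) grad_eq_0[OF cK(1) K(3)]], assumption)+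
  note T = test_function_properties[OF h(1)]
  have conv: "(\<lambda>n. LINT x|lborel. (norm (p n x - w x))\<^sup>2) \<longlonglongrightarrow> 0"
    if p: "\<And>n. square_integrable lborel (p n)" "square_integrable lborel w" "\<And>n x. x \<notin> K' \<Longrightarrow> p n x - w x = 0"
      "\<And>n x. norm (p n x - w x) \<le> 1 / (real n + 1)" for p and w :: "'a \<Rightarrow> 'b::euclidean_space"
  proof (rule tendsto_sandwich[OF always_eventually always_eventually tendsto_const])
    have iK: "integrable lborel (indicator K' :: 'a \<Rightarrow> real)"
      using borel_integrable_compact[OF K'(1), of "\<lambda>_. 1::real"] by simp
    show "\<forall>n. (LINT x|lborel. (norm (p n x - w x))\<^sup>2) \<le> measure lborel K' * (1 / (real n + 1))\<^sup>2"
    proof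
      fix n
      have "(LINT x|lborel. (norm (p n x - w x))\<^sup>2) \<le> (LINT x|lborel. indicator K' x * (1 / (real n + 1))\<^sup>2)"
      proof (rule integral_mono)
        show "(norm (p n x - w x))\<^sup>2 \<le> indicator K' x * (1 / (real n + 1))\<^sup>2" for x
          using p(3)[of x n] power_mono[OF p(4)[of n x] norm_ge_zero, of 2] by (cases "x \<in> K'") auto
      qed (use square_integrable_diff[OF p(1) p(2)] iK in \<open>auto simp: square_integrable_def\<close>)
      also have "\<dots> = measure lborel K' * (1 / (real n + 1))\<^sup>2" using cK by simp
      finally show "(LINT x|lborel. (norm (p n x - w x))\<^sup>2) \<le> measure lborel K' * (1 / (real n + 1))\<^sup>2" .
    qed
    have "(\<lambda>n. 1 / (real n + 1)) \<longlonglongrightarrow> 0" using lim_1_over_n[THEN LIMSEQ_Suc] by (simp add: add.commute)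
    then have "(\<lambda>n. measure lborel K' * (1 / (real n + 1))\<^sup>2) \<longlonglongrightarrow> measure lborel K' * 0\<^sup>2"
      by (intro tendsto_intros)
    then show "(\<lambda>n. measure lborel K' * (1 / (real n + 1))\<^sup>2) \<longlonglongrightarrow> 0" by simp
  qed simp
  have c1: "(\<lambda>n. LINT x|lborel. (norm (h n x - f x))\<^sup>2) \<longlonglongrightarrow> 0"
  proof (rule conv[OF T(2) sf(1)])
    fix n x assume "x \<notin> K'"
    moreover from this have "x \<notin> K" using K'(2) by blast
    ultimately show "h n x - f x = 0" using h(2) K(3) by simp
  qed (use h(3) in simp)
  have c2: "(\<lambda>n. LINT x|lborel. (norm (grad (h n) x - grad f x))\<^sup>2) \<longlonglongrightarrow> 0"
  proof (rule conv[OF T(3) sf(2)])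
    fix n x assume x: "x \<notin> K'"
    have "grad (h n) x = 0" by (rule grad_eq_0[OF cK(2) h(2) x])
    moreover have "grad f x = 0" by (rule grad_eq_0[OF cK(1) K(3)]) (use x K'(2) in auto)
    ultimately show "grad (h n) x - grad f x = 0" by simp
  qed (rule h(4))
  have l1: "(\<lambda>n. LINT x|lborel. (h n x)\<^sup>2) \<longlonglongrightarrow> (LINT x|lborel. (f x)\<^sup>2)"
    using L2_tendsto_norm[OF T(2) sf(1) c1] by simp
  have l2: "(\<lambda>n. LINT x|lborel. (norm (grad (h n) x))\<^sup>2) \<longlonglongrightarrow> (LINT x|lborel. (norm (grad f x))\<^sup>2)"
    by (rule L2_tendsto_norm[OF T(3) sf(2) c2])
  show ?thesis
    by (rule LIMSEQ_le[OF tendsto_mult_left[OF l1] l2]) (use test[OF h(1)] in auto)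
qed

section \<open>Energy inequalities in a cylinder\<close>

text \<open>Assembles a point from its coordinate along the axis of the cylinder and its position in the
  cross-section.\<close>

definition slice :: "real \<times> (real^2) \<Rightarrow> real^3" where
  "slice p = vector [fst p, snd p $ 1, snd p $ 2]"

lemma slice_nth [simp]: "slice p $ 1 = fst p" "slice p $ 2 = snd p $ 1" "slice p $ 3 = snd p $ 2"
  by (simp_all add: slice_def)

lemma bounded_linear_slice: "bounded_linear slice"
  by (rule linear_conv_bounded_linear[THEN iffD1], rule linearI)
     (simp_all add: vec_eq_iff forall_3)

lemma prod_Basis_cart: "(\<Prod>b\<in>(Basis :: (real^'n) set). f b) = (\<Prod>i\<in>UNIV. f (axis i 1))"
proof -
  have B: "(Basis :: (real^'n) set) = (\<lambda>i. axis i 1) ` UNIV" by (auto simp: Basis_vec_def)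
  have inj: "inj (\<lambda>i::'n. axis i (1::real))" by (rule injI) (simp add: axis_eq_axis)
  show ?thesis unfolding B by (subst prod.reindex[OF inj]) simp
qed

lemma prod_UNIV_3: "prod f (UNIV::3 set) = f 1 * f 2 * f 3"
  unfolding UNIV_3 by (simp add: ac_simps)

lemma prod_UNIV_2: "prod f (UNIV::2 set) = f 1 * f 2"
  unfolding UNIV_2 by (simp add: ac_simps)

lemma lborel_eq_distr_slice: "(lborel :: (real^3) measure) = distr lborel borel slice"
proof (rule lborel_eqI)
  fix l u :: "real^3"
  assume le: "\<And>b. b \<in> Basis \<Longrightarrow> l \<bullet> b \<le> u \<bullet> b"
  have le': "l $ i \<le> u $ i" for i using le[of "axis i 1"] by (simp add: cart_eq_inner_axis)
  have [measurable]: "slice \<in> borel_measurable borel"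
    by (rule borel_measurable_continuous_onI) (rule linear_continuous_on[OF bounded_linear_slice])
  define l2 u2 :: "real^2" where "l2 = vector [l $ 2, l $ 3]" and "u2 = vector [u $ 2, u $ 3]"
  have pre: "slice -` box l u = {l $ 1 <..< u $ 1} \<times> box l2 u2"
    by (auto simp: mem_box_cart forall_3 forall_2 l2_def u2_def)
  have le2: "l2 \<bullet> b \<le> u2 \<bullet> b" if "b \<in> Basis" for b
  proof -
    obtain i where i: "b = axis i 1" using \<open>b \<in> Basis\<close> by (auto simp: Basis_vec_def)
    have "l2 $ i \<le> u2 $ i" using exhaust_2[of i] le' by (auto simp: l2_def u2_def)
    then show ?thesis by (simp add: i inner_axis)
  qed
  have "emeasure (distr lborel borel slice) (box l u) = emeasure lborel ({l $ 1 <..< u $ 1} \<times> box l2 u2)"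
    by (simp add: emeasure_distr pre)
  also have "\<dots> = emeasure (lborel \<Otimes>\<^sub>M lborel) ({l $ 1 <..< u $ 1} \<times> box l2 u2)" by (simp add: lborel_prod)
  also have "\<dots> = emeasure lborel {l $ 1 <..< u $ 1} * emeasure lborel (box l2 u2)"
    by (rule lborel.emeasure_pair_measure_Times) auto
  also have "emeasure lborel (box l2 u2) = ennreal ((u $ 2 - l $ 2) * (u $ 3 - l $ 3))"
  proof -
    have "emeasure lborel (box l2 u2) = (\<Prod>b\<in>Basis. (u2 - l2) \<bullet> b)" by (rule emeasure_lborel_box) (rule le2)
    then show ?thesis unfolding prod_Basis_cart prod_UNIV_2 by (simp add: inner_axis l2_def u2_def)
  qed
  also have "emeasure lborel {l $ 1 <..< u $ 1} = ennreal (u $ 1 - l $ 1)" using le' by simp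
  also have "ennreal (u $ 1 - l $ 1) * ennreal ((u $ 2 - l $ 2) * (u $ 3 - l $ 3)) = ennreal (\<Prod>b\<in>Basis. (u - l) \<bullet> b)"
    unfolding prod_Basis_cart prod_UNIV_3 using le' by (simp add: inner_axis ennreal_mult[symmetric] mult.assoc)
  finally show "emeasure (distr lborel borel slice) (box l u) = ennreal (\<Prod>b\<in>Basis. (u - l) \<bullet> b)" .
qed simp

lemma integral_slices:
  fixes h :: "real^3 \<Rightarrow> real"
  assumes h: "continuous_on UNIV h" "compact K" "\<And>x. x \<notin> K \<Longrightarrow> h x = 0"
  shows "integrable lborel (\<lambda>t. LINT y|lborel. h (slice (t, y)))"
    "(LINT x|lborel. h x) = (LINT t|lborel. LINT y|lborel. h (slice (t, y)))"
proof -
  have [measurable]: "slice \<in> borel_measurable borel"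
    by (rule borel_measurable_continuous_onI) (rule linear_continuous_on[OF bounded_linear_slice])
  have [measurable]: "h \<in> borel_measurable borel" by (rule borel_measurable_continuous_onI[OF h(1)])
  have "integrable lborel h" by (rule integrable_continuous_compact_support[OF h])
  then have "integrable lborel (\<lambda>p. h (slice p))"
    by (subst (asm) lborel_eq_distr_slice, subst (asm) integrable_distr_eq) auto
  then have i: "integrable (lborel \<Otimes>\<^sub>M lborel) (\<lambda>p. h (slice p))" by (simp add: lborel_prod)
  show "integrable lborel (\<lambda>t. LINT y|lborel. h (slice (t, y)))" by (rule lborel_pair.integrable_fst'[OF i])
  have "(LINT x|lborel. h x) = (LINT p|lborel. h (slice p))"
    by (subst lborel_eq_distr_slice, subst integral_distr) auto
  also have "\<dots> = (LINT p|(lborel \<Otimes>\<^sub>M lborel). h (slice p))" by (simp add: lborel_prod)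
  also have "\<dots> = (LINT t|lborel. LINT y|lborel. h (slice (t, y)))" by (rule lborel_pair.integral_fst'[OF i, symmetric])
  finally show "(LINT x|lborel. h x) = (LINT t|lborel. LINT y|lborel. h (slice (t, y)))" .
qed

text \<open>The inequality on the cross-section, applied on every plane perpendicular to the axis and integrated
  along the axis.\<close>

lemma cylinder_inequality:
  fixes f :: "real^3 \<Rightarrow> real"
  assumes U: "\<And>\<phi> K. Ck_on 1 UNIV \<phi> \<Longrightarrow> compact K \<Longrightarrow> K \<subseteq> U \<Longrightarrow> \<forall>x. x \<notin> K \<longrightarrow> \<phi> x = 0 \<Longrightarrow>
      l * (LINT x|lborel. (\<phi> x)\<^sup>2) \<le> (LINT x|lborel. (norm (grad \<phi> x))\<^sup>2)"
    and f: "Ck_on 1 UNIV f" and K: "compact K" "K \<subseteq> cylinder U" "\<And>x. x \<notin> K \<Longrightarrow> f x = 0"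
  shows "l * (LINT x|lborel. (f x)\<^sup>2) \<le> (LINT x|lborel. (grad f x $ 2)\<^sup>2 + (grad f x $ 3)\<^sup>2)"
proof -
  note F = Ck_on_1_grad[OF f]
  have cK: "closed K" using K(1) compact_imp_closed by blast
  have g0: "grad f x = 0" if "x \<notin> K" for x by (rule grad_eq_0[OF cK _ that]) (rule K(3))
  have inner: "l * (LINT y|lborel. (f (slice (t, y)))\<^sup>2) \<le> (LINT y|lborel. (grad f (slice (t, y)) $ 2)\<^sup>2 + (grad f (slice (t, y)) $ 3)\<^sup>2)" for t
  proof -
    define \<phi> where "\<phi> = (\<lambda>y. f (slice (t, y)))"
    have c: "continuous_on UNIV (\<lambda>y. slice (t, y))"
      by (rule continuous_on_compose2[OF linear_continuous_on[OF bounded_linear_slice], of UNIV]) (auto intro!: continuous_intros)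
    have d: "(\<phi> has_derivative (\<lambda>v. grad f (slice (t, y)) \<bullet> slice (0, v))) (at y)" for y
    proof -
      have "((\<lambda>y. slice (t, y)) has_derivative (\<lambda>v. slice (0, v))) (at y)"
        by (rule bounded_linear.has_derivative[OF bounded_linear_slice]) (auto intro!: derivative_eq_intros)
      from has_derivative_compose[OF this F(1)] show ?thesis by (simp add: \<phi>_def)
    qed
    have C: "Ck_on 1 UNIV \<phi>"
      unfolding One_nat_def by (rule Ck_on_UNIV_Suc[OF d])
         (auto intro!: continuous_intros continuous_on_compose2[OF F(3) c])
    define L where "L = {y. slice (t, y) \<in> K}"
    have L: "compact L"
    proof (rule compact_eq_bounded_closed[THEN iffD2, OF conjI])
      have "closed ((\<lambda>y. slice (t, y)) -` K)" by (rule closed_vimage[OF cK]) (rule c)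
      then show "closed L" by (simp add: L_def vimage_def)
      obtain R where R: "\<And>x. x \<in> K \<Longrightarrow> norm x \<le> R" using K(1) compact_imp_bounded bounded_iff by metis
      have "norm y \<le> 2 * R" if "y \<in> L" for y
      proof -
        have "norm y \<le> \<bar>y $ 1\<bar> + \<bar>y $ 2\<bar>" using norm_le_l1_cart[of y] by (simp add: sum_2)
        moreover have "\<bar>slice (t, y) $ 2\<bar> \<le> norm (slice (t, y))" "\<bar>slice (t, y) $ 3\<bar> \<le> norm (slice (t, y))" by (rule component_le_norm_cart)+
        ultimately show ?thesis using R[of "slice (t, y)"] that by (simp add: L_def)
      qed
      then show "bounded L" unfolding bounded_iff by blast
    qed
    have LU: "L \<subseteq> U"
    proof
      fix y assume "y \<in> L"
      then have "slice (t, y) \<in> cylinder U" using K(2) by (auto simp: L_def)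
      moreover have "vector [y $ 1, y $ 2] = y" by (simp add: vec_eq_iff forall_2)
      ultimately show "y \<in> U" by (simp add: cylinder_def)
    qed
    have le: "l * (LINT y|lborel. (\<phi> y)\<^sup>2) \<le> (LINT y|lborel. (norm (grad \<phi> y))\<^sup>2)"
      by (rule U[OF C L LU]) (auto simp: L_def \<phi>_def K(3))
    have n: "(norm (grad \<phi> y))\<^sup>2 = (grad f (slice (t, y)) $ 2)\<^sup>2 + (grad f (slice (t, y)) $ 3)\<^sup>2" for y
    proof -
      have e: "grad \<phi> y $ i = grad f (slice (t, y)) \<bullet> slice (0, axis i 1)" for i
        using grad_inner[OF d, of y "axis i 1"] by (simp add: cart_eq_inner_axis)
      have "grad \<phi> y $ 1 = grad f (slice (t, y)) $ 2" "grad \<phi> y $ 2 = grad f (slice (t, y)) $ 3"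
        unfolding e by (simp_all add: inner_vec_def sum_3 axis_def)
      then show ?thesis by (simp only: power2_norm_eq_inner inner_vec_def sum_2) (simp add: power2_eq_square)
    qed
    show ?thesis using le unfolding n unfolding \<phi>_def .
  qed
  have c1: "continuous_on UNIV (\<lambda>x. (f x)\<^sup>2)" by (intro continuous_intros F(2))
  have c2: "continuous_on UNIV (\<lambda>x. (grad f x $ 2)\<^sup>2 + (grad f x $ 3)\<^sup>2)" by (intro continuous_intros F(3))
  note s1 = integral_slices[OF c1 K(1)] and s2 = integral_slices[OF c2 K(1)]
  have "l * (LINT x|lborel. (f x)\<^sup>2) = (LINT t|lborel. l * (LINT y|lborel. (f (slice (t, y)))\<^sup>2))"
    using s1(2) K(3) by simp
  also have "\<dots> \<le> (LINT t|lborel. LINT y|lborel. (grad f (slice (t, y)) $ 2)\<^sup>2 + (grad f (slice (t, y)) $ 3)\<^sup>2)"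
    by (rule integral_mono) (use s1(1) s2(1) K(3) g0 inner in auto)
  also have "\<dots> = (LINT x|lborel. (grad f x $ 2)\<^sup>2 + (grad f x $ 3)\<^sup>2)" using s2(2) g0 by simp
  finally show ?thesis .
qed

text \<open>Integrating the derivative of $(x \cdot b) f^2$ in the direction \<open>b\<close> gives
  $\int f^2 = -2 \int (x \cdot b) f\, \partial_b f$, and the right-hand side is at most
  $\frac{1}{2} \int f^2 + 2 R^2 \int (\partial_b f)^2$.\<close>

lemma Poincare_inequality:
  fixes f :: "'a::euclidean_space \<Rightarrow> real"
  assumes f: "Ck_on 1 UNIV f" and K: "compact K" "\<And>x. x \<notin> K \<Longrightarrow> f x = 0" "\<And>x. x \<in> K \<Longrightarrow> norm x \<le> R"
    and b: "b \<in> Basis"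
  shows "(LINT x|lborel. (f x)\<^sup>2) \<le> 4 * R\<^sup>2 * (LINT x|lborel. (grad f x \<bullet> b)\<^sup>2)"
proof -
  note F = Ck_on_1_grad[OF f]
  have cK: "closed K" using K(1) compact_imp_closed by blast
  have g0: "grad f x = 0" if "x \<notin> K" for x by (rule grad_eq_0[OF cK _ that]) (rule K(2))
  define d where "d = (\<lambda>x. grad f x \<bullet> b)"
  have cd: "continuous_on UNIV d" unfolding d_def by (intro continuous_intros F(3))
  have int: "integrable lborel h" if "continuous_on UNIV h" "\<And>x. x \<notin> K \<Longrightarrow> h x = 0" for h :: "'a \<Rightarrow> real"
    using integrable_continuous_compact_support[OF that(1) K(1) that(2)] .
  define H' where "H' = (\<lambda>x v. (v \<bullet> b) * (f x)\<^sup>2 + (x \<bullet> b) * (2 * f x * (grad f x \<bullet> v)))"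
  have "(LINT x:K|lborel. H' x b) = 0"
  proof (rule set_integral_derivative_compact_support[OF open_UNIV K(1) subset_UNIV])
    show "(x \<bullet> b) * (f x)\<^sup>2 = 0" if "x \<notin> K" for x using K(2)[OF that] by simp
    show "((\<lambda>x. (x \<bullet> b) * (f x)\<^sup>2) has_derivative H' x) (at x)" for x
      unfolding H'_def power2_eq_square by (auto intro!: derivative_eq_intros F(1) simp: algebra_simps)
    show "continuous_on UNIV (\<lambda>x. H' x b)" unfolding H'_def by (intro continuous_intros F(2,3))
  qed
  also have "(LINT x:K|lborel. H' x b) = (LINT x|lborel. (f x)\<^sup>2 + 2 * ((x \<bullet> b) * f x * d x))"
    unfolding set_lebesgue_integral_def
    by (rule Bochner_Integration.integral_cong) (use K(2) b in \<open>auto simp: H'_def d_def indicator_def\<close>)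
  also have "\<dots> = (LINT x|lborel. (f x)\<^sup>2) + 2 * (LINT x|lborel. (x \<bullet> b) * f x * d x)"
    by (subst Bochner_Integration.integral_add)
       (auto intro!: int continuous_intros F cd simp: K(2))
  finally have e: "(LINT x|lborel. (f x)\<^sup>2) = - 2 * (LINT x|lborel. (x \<bullet> b) * f x * d x)" by simp
  have i1: "integrable lborel (\<lambda>x. (f x)\<^sup>2)" by (intro int continuous_intros F) (simp add: K(2))
  have i2: "integrable lborel (\<lambda>x. (d x)\<^sup>2)" by (intro int continuous_intros cd) (simp add: d_def g0)
  have i3: "integrable lborel (\<lambda>x. (x \<bullet> b) * f x * d x)" by (intro int continuous_intros cd F) (simp add: K(2))
  have "- 2 * (LINT x|lborel. (x \<bullet> b) * f x * d x) = (LINT x|lborel. - 2 * ((x \<bullet> b) * f x * d x))" by simp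
  also have "\<dots> \<le> (LINT x|lborel. (f x)\<^sup>2 / 2 + 2 * R\<^sup>2 * (d x)\<^sup>2)"
  proof (rule integral_mono)
    show "integrable lborel (\<lambda>x. - 2 * ((x \<bullet> b) * f x * d x))" using i3 by auto
    show "integrable lborel (\<lambda>x. (f x)\<^sup>2 / 2 + 2 * R\<^sup>2 * (d x)\<^sup>2)" using i1 i2 by auto
    fix x
    show "- 2 * ((x \<bullet> b) * f x * d x) \<le> (f x)\<^sup>2 / 2 + 2 * R\<^sup>2 * (d x)\<^sup>2"
    proof (cases "x \<in> K")
      case True
      have "\<bar>x \<bullet> b\<bar> \<le> R" using K(3)[OF True] Basis_le_norm[OF b, of x] by linarith
      then have "(x \<bullet> b)\<^sup>2 \<le> R\<^sup>2" using power_mono[of "\<bar>x \<bullet> b\<bar>" R 2] by simp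
      then have "(x \<bullet> b)\<^sup>2 * (d x)\<^sup>2 \<le> R\<^sup>2 * (d x)\<^sup>2" by (rule mult_right_mono) simp
      moreover have "0 \<le> (f x + 2 * (x \<bullet> b) * d x)\<^sup>2" by simp
      ultimately show ?thesis by (simp add: power2_sum power_mult_distrib algebra_simps)
    qed (use K(2) in simp)
  qed
  also have "\<dots> = (LINT x|lborel. (f x)\<^sup>2) / 2 + 2 * R\<^sup>2 * (LINT x|lborel. (d x)\<^sup>2)" using i1 i2 by simp
  finally show ?thesis unfolding e[symmetric] by (simp add: d_def)
qed

section \<open>Uniqueness for the Dirichlet problem in bounded subsets of a cylinder\<close>

text \<open>A continuously differentiable substitute for the positive part, equal to zero for $t \le \epsilon$
  and to $(t - \epsilon)^2/t = t - 2\epsilon + \epsilon^2/t$ for $t > \epsilon$.\<close>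

definition smooth_truncation :: "real \<Rightarrow> real \<Rightarrow> real" where
  "smooth_truncation \<epsilon> t = (max 0 (t - \<epsilon>))\<^sup>2 / max \<epsilon> t"

definition smooth_truncation' :: "real \<Rightarrow> real \<Rightarrow> real" where
  "smooth_truncation' \<epsilon> t = 1 - \<epsilon>\<^sup>2 / (max \<epsilon> t)\<^sup>2"

lemma smooth_truncation_deriv:
  assumes e: "\<epsilon> > 0"
  shows "(smooth_truncation \<epsilon> has_real_derivative smooth_truncation' \<epsilon> t) (at t)"
proof -
  consider "t > \<epsilon>" | "t < \<epsilon>" | "t = \<epsilon>" by linarith
  then show ?thesis
  proof cases
    case 1
    have "((\<lambda>t. (t - \<epsilon>)\<^sup>2 / t) has_real_derivative 1 - \<epsilon>\<^sup>2 / t\<^sup>2) (at t)"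
      using 1 e by (auto intro!: derivative_eq_intros simp: field_simps power2_eq_square)
    then have "(smooth_truncation \<epsilon> has_real_derivative 1 - \<epsilon>\<^sup>2 / t\<^sup>2) (at t)"
      by (rule has_field_derivative_transform_within_open[of _ _ _ "{\<epsilon><..}"]) (use 1 in \<open>auto simp: smooth_truncation_def\<close>)
    then show ?thesis using 1 by (simp add: smooth_truncation'_def)
  next
    case 2
    have "((\<lambda>t. 0) has_real_derivative 0) (at t)" by simp
    then have "(smooth_truncation \<epsilon> has_real_derivative 0) (at t)"
      by (rule has_field_derivative_transform_within_open[of _ _ _ "{..<\<epsilon>}"]) (use 2 in \<open>auto simp: smooth_truncation_def\<close>)
    then show ?thesis using 2 e by (simp add: smooth_truncation'_def)
  next
    case 3
    have "((\<lambda>h. smooth_truncation \<epsilon> (\<epsilon> + h) / h) \<longlongrightarrow> 0) (at 0)"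
    proof (rule Lim_null_comparison)
      show "((\<lambda>h::real. \<bar>h\<bar> / \<epsilon>) \<longlongrightarrow> 0) (at 0)"
        by (rule tendsto_eq_intros | use e in simp)+
      show "\<forall>\<^sub>F h in at 0. norm (smooth_truncation \<epsilon> (\<epsilon> + h) / h) \<le> \<bar>h\<bar> / \<epsilon>"
      proof (rule always_eventually, rule allI)
        fix h :: real
        show "norm (smooth_truncation \<epsilon> (\<epsilon> + h) / h) \<le> \<bar>h\<bar> / \<epsilon>"
        proof (cases "h > 0")
          case True
          have "smooth_truncation \<epsilon> (\<epsilon> + h) / h = h / (\<epsilon> + h)"
            using True e by (simp add: smooth_truncation_def power2_eq_square)
          moreover have "h / (\<epsilon> + h) \<le> h / \<epsilon>" using True e by (intro divide_left_mono) auto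
          ultimately show ?thesis using True e by simp
        next
          case False
          then have "smooth_truncation \<epsilon> (\<epsilon> + h) = 0" by (simp add: smooth_truncation_def)
          then show ?thesis using e by simp
        qed
      qed
    qed
    then have "(smooth_truncation \<epsilon> has_real_derivative 0) (at \<epsilon>)" unfolding DERIV_def by (simp add: smooth_truncation_def)
    then show ?thesis using 3 e by (simp add: smooth_truncation'_def)
  qed
qed

lemma smooth_truncation_properties:
  assumes e: "\<epsilon> > 0"
  shows "continuous_on S (smooth_truncation' \<epsilon>)" "0 \<le> smooth_truncation' \<epsilon> t" "smooth_truncation' \<epsilon> t \<le> 1"
    "t \<le> \<epsilon> \<Longrightarrow> smooth_truncation \<epsilon> t = 0" "t \<le> \<epsilon> \<Longrightarrow> smooth_truncation' \<epsilon> t = 0"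
    "0 \<le> smooth_truncation \<epsilon> t" "smooth_truncation \<epsilon> t \<le> max 0 t" "max 0 t - 2 * \<epsilon> \<le> smooth_truncation \<epsilon> t"
proof -
  have m: "max \<epsilon> t \<ge> \<epsilon>" "max \<epsilon> t > 0" for t using e by auto
  show "continuous_on S (smooth_truncation' \<epsilon>)"
  proof -
    have "(max \<epsilon> t)\<^sup>2 \<noteq> 0" for t using m(2)[of t] by simp
    then show ?thesis unfolding smooth_truncation'_def[abs_def] by (intro continuous_intros) auto
  qed
  have "\<epsilon>\<^sup>2 \<le> (max \<epsilon> t)\<^sup>2" using m[of t] e by (intro power_mono) auto
  then have "\<epsilon>\<^sup>2 / (max \<epsilon> t)\<^sup>2 \<le> 1" using m(2)[of t] by (simp add: divide_le_eq)
  then show "0 \<le> smooth_truncation' \<epsilon> t" by (simp add: smooth_truncation'_def)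
  show "smooth_truncation' \<epsilon> t \<le> 1" by (simp add: smooth_truncation'_def)
  show "t \<le> \<epsilon> \<Longrightarrow> smooth_truncation \<epsilon> t = 0" "t \<le> \<epsilon> \<Longrightarrow> smooth_truncation' \<epsilon> t = 0"
    using e by (auto simp: smooth_truncation_def smooth_truncation'_def)
  show "0 \<le> smooth_truncation \<epsilon> t" using m(2)[of t] by (simp add: smooth_truncation_def)
  show "smooth_truncation \<epsilon> t \<le> max 0 t" "max 0 t - 2 * \<epsilon> \<le> smooth_truncation \<epsilon> t"
  proof -
    have "smooth_truncation \<epsilon> t \<le> max 0 t \<and> max 0 t - 2 * \<epsilon> \<le> smooth_truncation \<epsilon> t"
    proof (cases "t > \<epsilon>")
      case True
      then have eq: "smooth_truncation \<epsilon> t = t - 2 * \<epsilon> + \<epsilon>\<^sup>2 / t"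
        using e by (simp add: smooth_truncation_def field_simps power2_eq_square)
      have "\<epsilon>\<^sup>2 / t \<le> \<epsilon>" using True e by (simp add: field_simps power2_eq_square)
      moreover have "\<epsilon>\<^sup>2 / t \<ge> 0" using True e by simp
      ultimately show ?thesis using True e unfolding eq by (auto simp: max_def)
    next
      case False
      then show ?thesis using e by (auto simp: smooth_truncation_def max_def)
    qed
    then show "smooth_truncation \<epsilon> t \<le> max 0 t" "max 0 t - 2 * \<epsilon> \<le> smooth_truncation \<epsilon> t" by auto
  qed
qed

text \<open>The boundary of \<open>V\<close> may be arbitrarily irregular, but the set where $u \ge \epsilon$ is a compact subset
  of \<open>V\<close>, so the truncation $f = F(u)$ is an admissible test function. Integration by parts gives
  $\int F'(u) |\nabla u|^2 = l \int u f$, which bounds $\int |\nabla f|^2$ because $0 \le F' \le 1$. On the other hand, the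
  derivatives across the axis contribute at least $l \int f^2$ to $\int |\nabla f|^2$, and the derivative along the
  axis contributes at least $\int f^2/(4R^2)$, because \<open>V\<close> is bounded.\<close>

lemma truncated_energy_estimate:
  fixes u :: "real^3 \<Rightarrow> real"
  assumes U: "\<And>\<phi> K. Ck_on 1 UNIV \<phi> \<Longrightarrow> compact K \<Longrightarrow> K \<subseteq> U \<Longrightarrow> \<forall>x. x \<notin> K \<longrightarrow> \<phi> x = 0 \<Longrightarrow>
      l * (LINT x|lborel. (\<phi> x)\<^sup>2) \<le> (LINT x|lborel. (norm (grad \<phi> x))\<^sup>2)"
    and V: "open V" "\<And>x. x \<in> V \<Longrightarrow> norm x \<le> R" "R > 0" "V \<subseteq> cylinder U"
    and u: "Ck_on 2 V u" "\<And>x. x \<in> V \<Longrightarrow> laplacian u x + l * u x = 0"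
      "continuous_on (closure V) u" "\<And>x. x \<in> frontier V \<Longrightarrow> u x = 0" and \<epsilon>: "\<epsilon> > 0"
  defines "f \<equiv> \<lambda>x. if x \<in> V then smooth_truncation \<epsilon> (u x) else 0"
  shows "(l + 1 / (4 * R\<^sup>2)) * (LINT x|lborel. (f x)\<^sup>2) \<le> l * (LINT x|lborel. u x * f x)"
    "integrable lborel (\<lambda>x. (f x)\<^sup>2)" "integrable lborel (\<lambda>x. u x * f x)"
proof -
  note F = smooth_truncation_properties[OF \<epsilon>]
  define F0 where "F0 = smooth_truncation \<epsilon>"
  define F1 where "F1 = smooth_truncation' \<epsilon>"
  define K where "K = {x \<in> closure V. \<epsilon> \<le> u x}"
  have bV: "bounded V" using V(2) unfolding bounded_iff by blast
  have K: "compact K"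
  proof (rule compact_eq_bounded_closed[THEN iffD2, OF conjI])
    show "bounded K" using bounded_subset[OF bounded_closure[OF bV]] by (auto simp: K_def)
    have "closed (closure V \<inter> u -` {\<epsilon>..})" by (rule continuous_closed_preimage[OF u(3)]) auto
    moreover have "closure V \<inter> u -` {\<epsilon>..} = K" by (auto simp: K_def)
    ultimately show "closed K" by simp
  qed
  have KV: "K \<subseteq> V"
  proof
    fix x assume "x \<in> K"
    then have "x \<in> closure V" "u x \<noteq> 0" using \<epsilon> by (auto simp: K_def)
    then show "x \<in> V" using u(4)[of x] V(1) by (auto simp: frontier_def interior_open)
  qed
  have off: "F0 (u x) = 0" "F1 (u x) = 0" if "x \<notin> K" "x \<in> V" for x
  proof -
    have "u x \<le> \<epsilon>" using that closure_subset[of V] by (force simp: K_def)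
    then show "F0 (u x) = 0" "F1 (u x) = 0" using F by (simp_all add: F0_def F1_def)
  qed
  define du where "du = (\<lambda>x. frechet_derivative u (at x))"
  define ddu where "ddu = (\<lambda>b x. frechet_derivative (\<lambda>y. du y b) (at x))"
  have du: "(u has_derivative du x) (at x)" "((\<lambda>y. du y b) has_derivative ddu b x) (at x)" if "x \<in> V" for x b
    using Ck_on_2[OF u(1) that] by (simp_all add: du_def ddu_def)
  have cu: "continuous_on V u" "continuous_on V (\<lambda>x. du x b)" "continuous_on V (\<lambda>x. ddu b x v)" for b v
    using Ck_on_2_continuous[OF u(1)] by (simp_all add: du_def ddu_def)
  have dF: "((\<lambda>x. F0 (u x)) has_derivative (\<lambda>v. F1 (u x) * du x v)) (at x)" if "x \<in> V" for x
    unfolding F0_def F1_def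
    using has_derivative_compose[OF du(1)[OF that] smooth_truncation_deriv[OF \<epsilon>, unfolded has_field_derivative_def]] by simp
  have cF: "continuous_on V (\<lambda>x. F0 (u x))" using dF by (meson continuous_at_imp_continuous_on has_derivative_continuous)
  have cF1: "continuous_on V (\<lambda>x. F1 (u x))" unfolding F1_def
    by (rule continuous_on_compose2[OF F(1) cu(1)]) auto
  have oK: "open (- K)" using K by (simp add: compact_imp_closed open_Compl)
  have UN: "V \<union> - K = UNIV" using KV by auto
  have f0: "f x = 0" if "x \<notin> K" for x using off(1)[OF that] by (simp add: f_def F0_def)
  have df: "(f has_derivative (\<lambda>v. if x \<in> V then F1 (u x) * du x v else 0)) (at x)" for x
  proof (cases "x \<in> V")
    case True
    have "(f has_derivative (\<lambda>v. F1 (u x) * du x v)) (at x)"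
      by (rule has_derivative_transform_within_open[OF dF[OF True] V(1) True]) (simp add: f_def F0_def)
    then show ?thesis using True by simp
  next
    case False
    have "((\<lambda>_. 0) has_derivative (\<lambda>_. 0)) (at x)" by simp
    then have "(f has_derivative (\<lambda>_. 0)) (at x)"
      by (rule has_derivative_transform_within_open[OF _ oK]) (use False KV f0 in auto)
    then show ?thesis using False by simp
  qed
  have Cf: "Ck_on 1 UNIV f"
    unfolding One_nat_def
  proof (rule Ck_on_UNIV_Suc[OF df])
    fix v
    have "continuous_on (V \<union> - K) (\<lambda>x. if x \<in> V then F1 (u x) * du x v else 0)"
    proof (rule continuous_on_open_Un[OF V(1) oK])
      show "continuous_on V (\<lambda>x. if x \<in> V then F1 (u x) * du x v else 0)"
        by (rule continuous_on_eq[of _ "\<lambda>x. F1 (u x) * du x v"]) (auto intro!: continuous_intros cF1 cu)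
      show "continuous_on (- K) (\<lambda>x. if x \<in> V then F1 (u x) * du x v else 0)"
        by (rule continuous_on_eq[of _ "\<lambda>_. 0"]) (use off(2) in auto)
    qed
    then show "Ck_on 0 UNIV (\<lambda>x. if x \<in> V then F1 (u x) * du x v else 0)" by (simp only: UN Ck_on.simps)
  qed
  note G = Ck_on_1_grad[OF Cf]
  have gf: "grad f x \<bullet> b = (if x \<in> V then F1 (u x) * du x b else 0)" for x b by (rule grad_inner[OF df])
  have cK: "closed K" using K compact_imp_closed by blast
  have g0: "grad f x = 0" if "x \<notin> K" for x by (rule grad_eq_0[OF cK _ that]) (rule f0)
  have int: "integrable lborel h" if "continuous_on UNIV h" "\<And>x. x \<notin> K \<Longrightarrow> h x = 0" for h :: "real^3 \<Rightarrow> real"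
    using integrable_continuous_compact_support[OF that(1) K that(2)] .
  show i1: "integrable lborel (\<lambda>x. (f x)\<^sup>2)" by (intro int continuous_intros G) (simp add: f0)
  have cuf: "continuous_on UNIV (\<lambda>x. u x * f x)"
  proof -
    have "continuous_on (V \<union> - K) (\<lambda>x. u x * f x)"
    proof (rule continuous_on_open_Un[OF V(1) oK])
      show "continuous_on V (\<lambda>x. u x * f x)" by (intro continuous_intros cu continuous_on_subset[OF G(2)]) auto
      show "continuous_on (- K) (\<lambda>x. u x * f x)" by (rule continuous_on_eq[of _ "\<lambda>_. 0"]) (use f0 in auto)
    qed
    then show ?thesis by (simp only: UN)
  qed
  show i2: "integrable lborel (\<lambda>x. u x * f x)" by (rule int[OF cuf]) (simp add: f0)
  define T where "T = (\<lambda>b x. ddu b x b * F0 (u x) + du x b * (F1 (u x) * du x b))"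
  have cT: "continuous_on V (T b)" for b unfolding T_def by (intro continuous_intros cu cF cF1)
  have iT: "integrable lborel (\<lambda>x. indicator K x *\<^sub>R T b x)" for b
    by (rule borel_integrable_compact[OF K continuous_on_subset[OF cT KV]])
  have T0: "(LINT x|lborel. indicator K x *\<^sub>R T b x) = 0" for b
  proof -
    define H' where "H' = (\<lambda>x v. ddu b x v * F0 (u x) + du x b * (F1 (u x) * du x v))"
    have "(LINT x:K|lborel. H' x b) = 0"
    proof (rule set_integral_derivative_compact_support[OF V(1) K KV])
      show "(if x \<in> V then du x b * F0 (u x) else 0) = 0" if "x \<notin> K" for x using off[OF that] by simp
      show "((\<lambda>x. if x \<in> V then du x b * F0 (u x) else 0) has_derivative H' x) (at x)" if x: "x \<in> V" for x
      proof -
        have "((\<lambda>x. du x b * F0 (u x)) has_derivative H' x) (at x)"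
          unfolding H'_def using du(2)[OF x] dF[OF x] by (auto intro!: derivative_eq_intros simp: fun_eq_iff algebra_simps)
        then show ?thesis by (rule has_derivative_transform_within_open[OF _ V(1) x]) simp
      qed
      show "continuous_on V (\<lambda>x. H' x b)" using cT[of b] by (simp add: T_def H'_def)
    qed
    then show ?thesis by (simp add: set_lebesgue_integral_def T_def H'_def)
  qed
  have "(LINT x|lborel. (\<Sum>b\<in>Basis. indicator K x *\<^sub>R T b x)) = (\<Sum>b\<in>Basis. LINT x|lborel. indicator K x *\<^sub>R T b x)"
    by (rule Bochner_Integration.integral_sum) (rule iT)
  then have sumT: "(LINT x|lborel. (\<Sum>b\<in>Basis. indicator K x *\<^sub>R T b x)) = 0" using T0 by simp
  have isumT: "integrable lborel (\<lambda>x. \<Sum>b\<in>Basis. indicator K x *\<^sub>R T b x)"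
    by (rule Bochner_Integration.integrable_sum) (rule iT)
  have norm_g: "(norm (grad f x))\<^sup>2 = (grad f x $ 1)\<^sup>2 + ((grad f x $ 2)\<^sup>2 + (grad f x $ 3)\<^sup>2)" for x
    by (simp only: power2_norm_eq_inner inner_vec_def sum_3) (simp add: power2_eq_square)
  have in1: "integrable lborel (\<lambda>x. (grad f x $ 1)\<^sup>2)" and in2: "integrable lborel (\<lambda>x. (grad f x $ 2)\<^sup>2 + (grad f x $ 3)\<^sup>2)"
    and in3: "integrable lborel (\<lambda>x. (norm (grad f x))\<^sup>2)"
    by (intro int continuous_intros G, simp add: g0)+
  have "(LINT x|lborel. (norm (grad f x))\<^sup>2) \<le> (LINT x|lborel. l * (u x * f x) + (\<Sum>b\<in>Basis. indicator K x *\<^sub>R T b x))"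
  proof (rule integral_mono)
    show "integrable lborel (\<lambda>x. l * (u x * f x) + (\<Sum>b\<in>Basis. indicator K x *\<^sub>R T b x))" using i2 isumT by auto
    fix x
    show "(norm (grad f x))\<^sup>2 \<le> l * (u x * f x) + (\<Sum>b\<in>Basis. indicator K x *\<^sub>R T b x)"
    proof (cases "x \<in> K")
      case True
      then have x: "x \<in> V" using KV by auto
      have lap: "(\<Sum>b\<in>Basis. ddu b x b) = - l * u x"
        using u(2)[OF x] by (simp add: laplacian_def ddu_def du_def add_eq_0_iff)
      have "(\<Sum>b\<in>Basis. indicator K x *\<^sub>R T b x) = (\<Sum>b\<in>Basis. ddu b x b) * F0 (u x) + (\<Sum>b\<in>Basis. F1 (u x) * (du x b)\<^sup>2)"
        using True by (simp add: T_def sum.distrib sum_distrib_left sum_distrib_right power2_eq_square mult_ac)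
      then have "l * (u x * f x) + (\<Sum>b\<in>Basis. indicator K x *\<^sub>R T b x) = (\<Sum>b\<in>Basis. F1 (u x) * (du x b)\<^sup>2)"
        unfolding lap using x by (simp add: f_def F0_def)
      moreover have "(norm (grad f x))\<^sup>2 = (\<Sum>b\<in>Basis. (F1 (u x))\<^sup>2 * (du x b)\<^sup>2)"
        unfolding power2_norm_eq_inner unfolding euclidean_inner[of "grad f x" "grad f x"] unfolding gf using x by (simp add: power2_eq_square mult_ac)
      moreover have "(\<Sum>b\<in>Basis. (F1 (u x))\<^sup>2 * (du x b)\<^sup>2) \<le> (\<Sum>b\<in>Basis. F1 (u x) * (du x b)\<^sup>2)"
      proof (rule sum_mono, rule mult_right_mono)
        have "F1 (u x) * F1 (u x) \<le> F1 (u x) * 1" using F(2,3) unfolding F1_def by (intro mult_left_mono) auto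
        then show "(F1 (u x))\<^sup>2 \<le> F1 (u x)" by (simp add: power2_eq_square)
      qed simp
      ultimately show ?thesis by simp
    qed (simp add: g0 f0)
  qed (rule in3)
  also have "\<dots> = l * (LINT x|lborel. u x * f x)" using i2 isumT sumT by simp
  finally have E1: "(LINT x|lborel. (norm (grad f x))\<^sup>2) \<le> l * (LINT x|lborel. u x * f x)" .
  have E2: "l * (LINT x|lborel. (f x)\<^sup>2) \<le> (LINT x|lborel. (grad f x $ 2)\<^sup>2 + (grad f x $ 3)\<^sup>2)"
    by (rule cylinder_inequality[of U l f K, OF U Cf K]) (use KV V(4) f0 in auto)
  have ax: "axis 1 1 \<in> (Basis :: (real^3) set)" by simp
  have "(LINT x|lborel. (f x)\<^sup>2) \<le> 4 * R\<^sup>2 * (LINT x|lborel. (grad f x \<bullet> axis 1 1)\<^sup>2)"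
    by (rule Poincare_inequality[OF Cf K _ _ ax]) (use f0 KV V(2) in auto)
  then have "(LINT x|lborel. (f x)\<^sup>2) / (4 * R\<^sup>2) \<le> (LINT x|lborel. (grad f x $ 1)\<^sup>2)"
    using V(3) by (simp add: cart_eq_inner_axis divide_le_eq mult.commute)
  moreover have "(LINT x|lborel. (norm (grad f x))\<^sup>2) = (LINT x|lborel. (grad f x $ 1)\<^sup>2) + (LINT x|lborel. (grad f x $ 2)\<^sup>2 + (grad f x $ 3)\<^sup>2)"
    unfolding norm_g using in1 in2 by simp
  ultimately show "(l + 1 / (4 * R\<^sup>2)) * (LINT x|lborel. (f x)\<^sup>2) \<le> l * (LINT x|lborel. u x * f x)"
    using E1 E2 by (simp add: ring_distribs)
qed

text \<open>As the truncation level tends to zero, both integrals in \<open>truncated_energy_estimate\<close> tend to the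
  integral of the square of the positive part of \<open>u\<close>. The gain $1/(4R^2)$ forces this integral to vanish. It is
  due to this gain that \<open>l\<close> may be equal to the first eigenvalue of the cross-section.\<close>

theorem Helmholtz_solution_nonpositive:
  fixes u :: "real^3 \<Rightarrow> real"
  assumes U: "\<And>\<phi> K. Ck_on 1 UNIV \<phi> \<Longrightarrow> compact K \<Longrightarrow> K \<subseteq> U \<Longrightarrow> \<forall>x. x \<notin> K \<longrightarrow> \<phi> x = 0 \<Longrightarrow>
      l * (LINT x|lborel. (\<phi> x)\<^sup>2) \<le> (LINT x|lborel. (norm (grad \<phi> x))\<^sup>2)"
    and V: "open V" "bounded V" "V \<subseteq> cylinder U"
    and u: "Ck_on 2 V u" "\<And>x. x \<in> V \<Longrightarrow> laplacian u x + l * u x = 0"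
      "continuous_on (closure V) u" "\<And>x. x \<in> frontier V \<Longrightarrow> u x = 0" and x: "x \<in> V"
  shows "u x \<le> 0"
proof -
  obtain R where R: "R > 0" "\<And>x. x \<in> V \<Longrightarrow> norm x \<le> R" using V(2) bounded_pos by metis
  define f where "f = (\<lambda>n x. if x \<in> V then smooth_truncation (1 / (real n + 1)) (u x) else 0)"
  have en: "1 / (real n + 1) > 0" for n by simp
  have E: "(l + 1 / (4 * R\<^sup>2)) * (LINT x|lborel. (f n x)\<^sup>2) \<le> l * (LINT x|lborel. u x * f n x)"
    "integrable lborel (\<lambda>x. (f n x)\<^sup>2)" "integrable lborel (\<lambda>x. u x * f n x)" for n
    unfolding f_def by (rule truncated_energy_estimate[OF U V(1) R(2,1) V(3) u en]; assumption)+
  define p where "p = (\<lambda>x. if x \<in> V then max 0 (u x) else 0)"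
  have f_bd: "0 \<le> f n x" "f n x \<le> p x" "p x - 2 * (1 / (real n + 1)) \<le> f n x" for n x
    using smooth_truncation_properties(6,7,8)[OF en[of n], of "u x"] by (auto simp: f_def p_def)
  have lim0: "(\<lambda>n. 1 / (real n + 1)) \<longlonglongrightarrow> 0" using lim_1_over_n[THEN LIMSEQ_Suc] by (simp add: add.commute)
  have flim: "(\<lambda>n. f n x) \<longlonglongrightarrow> p x" for x
  proof (rule tendsto_sandwich[OF always_eventually always_eventually _ tendsto_const])
    show "(\<lambda>n. p x - 2 * (1 / (real n + 1))) \<longlonglongrightarrow> p x"
      using tendsto_diff[OF tendsto_const tendsto_mult_left[OF lim0], of "p x" 2] by simp
  qed (use f_bd in auto)
  obtain M where M: "M > 0" "\<And>x. x \<in> closure V \<Longrightarrow> \<bar>u x\<bar> \<le> M"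
  proof -
    have "compact (u ` closure V)" by (rule compact_continuous_image[OF u(3)]) (use V(2) compact_closure in auto)
    then obtain M where "M > 0" "\<And>y. y \<in> u ` closure V \<Longrightarrow> \<bar>y\<bar> \<le> M"
      using compact_imp_bounded bounded_pos by (metis real_norm_def)
    then show ?thesis using that by blast
  qed
  have up: "u x * p x = (p x)\<^sup>2" for x by (auto simp: p_def power2_eq_square max_def)
  define W where "W = (\<lambda>x. indicator (cball (0::real^3) R) x *\<^sub>R M\<^sup>2)"
  have iW: "integrable lborel W" unfolding W_def by (rule borel_integrable_compact) auto
  have pb: "\<bar>p x\<bar> \<le> M" "\<bar>f n x\<bar> \<le> M" if "x \<in> V" for n x
    using M(2)[of x] closure_subset[of V] that f_bd(1,2)[of n x] by (auto simp: p_def)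
  have m1: "(\<lambda>x. (f n x)\<^sup>2) \<in> borel_measurable lborel" "(\<lambda>x. u x * f n x) \<in> borel_measurable lborel" for n
    by (rule borel_measurable_integrable[OF E(2)], rule borel_measurable_integrable[OF E(3)])
  have pm: "(\<lambda>x. (p x)\<^sup>2) \<in> borel_measurable lborel"
  proof (rule borel_measurable_LIMSEQ_metric[of "\<lambda>n x. (f n x)\<^sup>2"])
    show "(\<lambda>n. (f n x)\<^sup>2) \<longlonglongrightarrow> (p x)\<^sup>2" for x by (intro tendsto_intros flim)
  qed (rule m1)
  have b1: "norm ((f n x)\<^sup>2) \<le> W x" and b2: "norm (u x * f n x) \<le> W x" and b3: "norm ((p x)\<^sup>2) \<le> W x" for n x
  proof -
    have "norm ((f n x)\<^sup>2) \<le> W x \<and> norm (u x * f n x) \<le> W x \<and> norm ((p x)\<^sup>2) \<le> W x"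
    proof (cases "x \<in> V")
      case True
      then have "W x = M * M" using R(2) by (simp add: W_def power2_eq_square)
      moreover have "\<bar>u x\<bar> \<le> M" using M(2) True closure_subset by blast
      moreover have "\<bar>f n x\<bar> * \<bar>f n x\<bar> \<le> M * M" "\<bar>p x\<bar> * \<bar>p x\<bar> \<le> M * M"
        using M(1) by (intro mult_mono pb[OF True]; simp)+
      moreover have "\<bar>u x\<bar> * \<bar>f n x\<bar> \<le> M * M"
        using M(1) by (intro mult_mono pb[OF True] calculation(2); simp)
      ultimately show ?thesis by (simp add: power2_eq_square abs_mult)
    next
      case False
      then show ?thesis by (simp add: f_def p_def W_def)
    qed
    then show "norm ((f n x)\<^sup>2) \<le> W x" "norm (u x * f n x) \<le> W x" "norm ((p x)\<^sup>2) \<le> W x" by auto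
  qed
  have ip: "integrable lborel (\<lambda>x. (p x)\<^sup>2)"
    by (rule Bochner_Integration.integrable_bound[OF iW pm]) (use b3 in \<open>auto intro: order_trans[OF _ abs_ge_self]\<close>)
  have L1: "(\<lambda>n. LINT x|lborel. (f n x)\<^sup>2) \<longlonglongrightarrow> (LINT x|lborel. (p x)\<^sup>2)"
  proof (rule integral_dominated_convergence[where w = W])
    show "AE x in lborel. (\<lambda>n. (f n x)\<^sup>2) \<longlonglongrightarrow> (p x)\<^sup>2" by (rule AE_I2) (intro tendsto_intros flim)
  qed (use pm m1 iW b1 in auto)
  have L2: "(\<lambda>n. LINT x|lborel. u x * f n x) \<longlonglongrightarrow> (LINT x|lborel. (p x)\<^sup>2)"
  proof (rule integral_dominated_convergence[where w = W])
    show "AE x in lborel. (\<lambda>n. u x * f n x) \<longlonglongrightarrow> (p x)\<^sup>2"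
      unfolding up[symmetric] by (rule AE_I2) (intro tendsto_intros flim)
  qed (use pm m1 iW b2 in auto)
  have "(l + 1 / (4 * R\<^sup>2)) * (LINT x|lborel. (p x)\<^sup>2) \<le> l * (LINT x|lborel. (p x)\<^sup>2)"
    by (rule LIMSEQ_le[OF tendsto_mult_left[OF L1] tendsto_mult_left[OF L2]]) (use E(1) in auto)
  then have "1 / (4 * R\<^sup>2) * (LINT x|lborel. (p x)\<^sup>2) \<le> 0" by (simp add: ring_distribs)
  then have "(LINT x|lborel. (p x)\<^sup>2) \<le> 0" using R(1) by (simp add: divide_le_0_iff)
  then have "(LINT x|lborel. (p x)\<^sup>2) = 0" by (intro antisym Bochner_Integration.integral_nonneg) auto
  then have AE: "AE x in lborel. (p x)\<^sup>2 = 0" using integral_nonneg_eq_0_iff_AE[OF ip] by simp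
  define P where "P = V \<inter> u -` {0<..}"
  have cu: "continuous_on V u" using Ck_on_2_continuous(1)[OF u(1)] .
  have oP: "open P" unfolding P_def by (rule continuous_open_preimage[OF cu V(1)]) auto
  have "AE x in lborel. x \<notin> P" using AE by eventually_elim (auto simp: p_def P_def)
  then have "P \<in> null_sets lborel" using oP by (subst AE_iff_null_sets) auto
  then have "negligible P" unfolding negligible_iff_null_sets by (rule null_sets_completionI)
  then have "P = {}" using open_not_negligible[OF oP] by blast
  then show ?thesis using x by (force simp: P_def)
qed

section \<open>Boundaries of obstacles and total fields\<close>

lemma Ck_on_2I:
  assumes G: "open G" and d1: "\<And>x. x \<in> G \<Longrightarrow> (w has_derivative w' x) (at x)"
    and d2: "\<And>x b. x \<in> G \<Longrightarrow> ((\<lambda>x. w' x b) has_derivative w'' b x) (at x)"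
    and c: "\<And>b v. continuous_on G (\<lambda>x. w'' b x v)"
  shows "Ck_on 2 G w" "\<And>x. x \<in> G \<Longrightarrow> laplacian w x = (\<Sum>b\<in>Basis. w'' b x b)"
proof -
  have e1: "frechet_derivative w (at x) = w' x" if "x \<in> G" for x using frechet_derivative_at[OF d1[OF that]] by simp
  have d2': "((\<lambda>y. frechet_derivative w (at y) b) has_derivative w'' b x) (at x)" if "x \<in> G" for x b
    by (rule has_derivative_transform_within_open[OF d2[OF that] G that]) (simp add: e1)
  have e2: "frechet_derivative (\<lambda>y. frechet_derivative w (at y) b) (at x) = w'' b x" if "x \<in> G" for x b
    using frechet_derivative_at[OF d2'[OF that]] by simp
  have c': "continuous_on G (\<lambda>x. frechet_derivative (\<lambda>y. frechet_derivative w (at y) b) (at x) v)" for b v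
    by (rule continuous_on_eq[OF c]) (simp add: e2)
  show "Ck_on 2 G w"
    unfolding numeral_2_eq_2 Ck_on.simps using d1 d2' c' differentiableI by blast
  show "laplacian w x = (\<Sum>b\<in>Basis. w'' b x b)" if "x \<in> G" for x
    unfolding laplacian_def using e2[OF that] by simp
qed

lemma Ck_on_2_diff:
  assumes G: "open G" and u: "Ck_on 2 G u" and v: "Ck_on 2 G v"
  shows "Ck_on 2 G (\<lambda>x. u x - v x)" "\<And>x. x \<in> G \<Longrightarrow> laplacian (\<lambda>x. u x - v x) x = laplacian u x - laplacian v x"
proof -
  let ?d = "\<lambda>u x. frechet_derivative u (at x)"
  let ?dd = "\<lambda>u b x. frechet_derivative (\<lambda>y. frechet_derivative u (at y) b) (at x)"
  have 1: "((\<lambda>x. u x - v x) has_derivative (\<lambda>h. ?d u x h - ?d v x h)) (at x)" if "x \<in> G" for x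
    by (rule has_derivative_diff[OF Ck_on_2(1)[OF u that] Ck_on_2(1)[OF v that]])
  have 2: "((\<lambda>x. ?d u x b - ?d v x b) has_derivative (\<lambda>h. ?dd u b x h - ?dd v b x h)) (at x)" if "x \<in> G" for x b
    by (rule has_derivative_diff[OF Ck_on_2(2)[OF u that] Ck_on_2(2)[OF v that]])
  have 3: "continuous_on G (\<lambda>x. ?dd u b x h - ?dd v b x h)" for b h
    by (intro continuous_intros Ck_on_2_continuous(3)[OF u] Ck_on_2_continuous(3)[OF v])
  show "Ck_on 2 G (\<lambda>x. u x - v x)"
    by (rule Ck_on_2I(1)[OF G, where w' = "\<lambda>x h. ?d u x h - ?d v x h" and w'' = "\<lambda>b x h. ?dd u b x h - ?dd v b x h"])
       (use 1 2 3 in auto)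
  show "laplacian (\<lambda>x. u x - v x) x = laplacian u x - laplacian v x" if "x \<in> G" for x
    using Ck_on_2I(2)[OF G, where w' = "\<lambda>x h. ?d u x h - ?d v x h" and w'' = "\<lambda>b x h. ?dd u b x h - ?dd v b x h", OF 1 2 3 that]
    by (simp add: laplacian_def sum_subtractf)
qed

lemma Ck_on_2_bounded_linear:
  assumes L: "bounded_linear L" and G: "open G" and u: "Ck_on 2 G u"
  shows "Ck_on 2 G (\<lambda>x. L (u x))" "\<And>x. x \<in> G \<Longrightarrow> laplacian (\<lambda>x. L (u x)) x = L (laplacian u x)"
proof -
  let ?d = "\<lambda>x. frechet_derivative u (at x)"
  let ?dd = "\<lambda>b x. frechet_derivative (\<lambda>y. frechet_derivative u (at y) b) (at x)"
  have 1: "((\<lambda>x. L (u x)) has_derivative (\<lambda>h. L (?d x h))) (at x)" if "x \<in> G" for x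
    by (rule bounded_linear.has_derivative[OF L Ck_on_2(1)[OF u that]])
  have 2: "((\<lambda>x. L (?d x b)) has_derivative (\<lambda>h. L (?dd b x h))) (at x)" if "x \<in> G" for x b
    by (rule bounded_linear.has_derivative[OF L Ck_on_2(2)[OF u that]])
  have 3: "continuous_on G (\<lambda>x. L (?dd b x h))" for b h
    by (rule bounded_linear.continuous_on[OF L Ck_on_2_continuous(3)[OF u]])
  show "Ck_on 2 G (\<lambda>x. L (u x))"
    by (rule Ck_on_2I(1)[OF G, where w' = "\<lambda>x h. L (?d x h)" and w'' = "\<lambda>b x h. L (?dd b x h)"])
       (use 1 2 3 in auto)
  show "laplacian (\<lambda>x. L (u x)) x = L (laplacian u x)" if "x \<in> G" for x
    using Ck_on_2I(2)[OF G, where w' = "\<lambda>x h. L (?d x h)" and w'' = "\<lambda>b x h. L (?dd b x h)", OF 1 2 3 that]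
    by (simp add: laplacian_def linear_sum[OF bounded_linear.linear[OF L]])
qed

text \<open>Near a boundary point \<open>D\<close> lies on one side of a graph only, so there are points arbitrarily close
  on the other side, away from the closure of \<open>D\<close>.\<close>

lemma interior_closure_C2_boundary:
  assumes D: "open D" "C2_boundary D"
  shows "interior (closure D) = D"
proof
  show "D \<subseteq> interior (closure D)" using D(1) closure_subset interior_maximal by blast
  show "interior (closure D) \<subseteq> D"
  proof (rule ccontr)
    assume "\<not> interior (closure D) \<subseteq> D"
    then obtain p where p: "p \<in> interior (closure D)" "p \<notin> D" by auto
    then have "p \<in> frontier D" using D(1) interior_subset by (auto simp: frontier_def interior_open)
    then have "\<exists>r>0. \<exists>(T :: real^3 \<Rightarrow> real^3) (\<gamma> :: real^2 \<Rightarrow> real).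
        orthogonal_transformation T \<and> Ck_on 2 UNIV \<gamma> \<and>
        D \<inter> ball p r = {x \<in> ball p r. T x $ 3 > \<gamma> (vector [T x $ 1, T x $ 2])}"
      using D(2) unfolding C2_boundary_def by (rule bspec[rotated])
    then obtain r and T :: "real^3 \<Rightarrow> real^3" and \<gamma> :: "real^2 \<Rightarrow> real" where r: "r > 0"
      and T: "orthogonal_transformation T" and \<gamma>: "Ck_on 2 UNIV \<gamma>"
      and eq: "D \<inter> ball p r = {x \<in> ball p r. T x $ 3 > \<gamma> (vector [T x $ 1, T x $ 2])}"
      by (elim exE conjE)
    have lT: "linear T" using T by (simp add: orthogonal_transformation_def)
    have cT: "continuous_on UNIV T" using lT by (simp add: linear_continuous_on linear_conv_bounded_linear)
    have c\<gamma>: "continuous_on UNIV \<gamma>" by (rule Ck_on_2_continuous(1)[OF \<gamma>])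
    have Tp: "T p $ 3 \<le> \<gamma> (vector [T p $ 1, T p $ 2])"
    proof (rule ccontr)
      assume "\<not> T p $ 3 \<le> \<gamma> (vector [T p $ 1, T p $ 2])"
      then have "p \<in> D \<inter> ball p r" unfolding eq using r by simp
      then show False using p by simp
    qed
    obtain s where s: "s > 0" "ball p s \<subseteq> closure D"
      using p(1) by (meson interior_subset open_contains_ball open_interior subset_trans)
    define \<tau> where "\<tau> = min r s / 2"
    have \<tau>: "\<tau> > 0" "\<tau> < r" "\<tau> < s" using r s(1) by (auto simp: \<tau>_def)
    obtain e where e: "T e = axis 3 1" using orthogonal_transformation_surj[OF T] by (metis surjD)
    have ne: "norm e = 1"
      using orthogonal_transformation_norm[OF T, of e] by (simp add: e)
    define q where "q = p - \<tau> *\<^sub>R e"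
    have Tq: "T q = T p - \<tau> *\<^sub>R axis 3 1" unfolding q_def by (simp add: linear_diff[OF lT] linear_cmul[OF lT] e)
    have q: "dist p q = \<tau>" using \<tau>(1) ne by (simp add: q_def dist_norm)
    define g where "g = (\<lambda>x. T x $ 3 - \<gamma> (vector [T x $ 1, T x $ 2]))"
    have cv: "continuous_on UNIV (\<lambda>x. vector [T x $ 1, T x $ 2] :: real^2)"
    proof -
      have "continuous_on UNIV (\<lambda>x. \<chi> i. (vector [T x $ 1, T x $ 2] :: real^2) $ i)"
      proof (rule continuous_on_vec_lambda)
        fix i :: 2
        have "continuous_on UNIV (\<lambda>x. T x $ j)" for j by (intro continuous_intros cT)
        show "continuous_on UNIV (\<lambda>x. (vector [T x $ 1, T x $ 2] :: real^2) $ i)"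
          using exhaust_2[of i] \<open>\<And>j. continuous_on UNIV (\<lambda>x. T x $ j)\<close> by (elim disjE) simp_all
      qed
      then show ?thesis by simp
    qed
    have cg: "continuous_on UNIV g" unfolding g_def
      by (intro continuous_intros cT continuous_on_compose2[OF c\<gamma> cv]) auto
    have "T q $ 1 = T p $ 1" "T q $ 2 = T p $ 2" "T q $ 3 = T p $ 3 - \<tau>"
      unfolding Tq by (simp_all add: axis_def)
    then have gq: "g q < 0" using Tp \<tau>(1) by (simp add: g_def)
    define N where "N = {x. g x < 0} \<inter> ball p r"
    have "open N" unfolding N_def by (intro open_Int open_Collect_less cg continuous_on_const open_ball)
    moreover have "q \<in> N" using gq q \<tau>(2) by (simp add: N_def)
    moreover have "N \<inter> D = {}"
    proof (rule ccontr)
      assume "N \<inter> D \<noteq> {}"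
      then obtain x where x: "g x < 0" "x \<in> D \<inter> ball p r" unfolding N_def by blast
      have "T x $ 3 > \<gamma> (vector [T x $ 1, T x $ 2])" using x(2) unfolding eq by simp
      then show False using x(1) by (simp add: g_def)
    qed
    ultimately have "q \<notin> closure D" by (metis disjoint_iff open_Int_closure_eq_empty)
    moreover have "q \<in> closure D" using s(2) q \<tau>(3) by auto
    ultimately show False by simp
  qed
qed

lemma bigo_at_infinityD:
  fixes f :: "'a::real_normed_vector \<Rightarrow> complex"
  assumes "f \<in> O[at_infinity](\<lambda>x. of_real (1 / (norm x)\<^sup>2))"
  obtains c b where "c > 0" "\<And>x. norm x \<ge> b \<Longrightarrow> norm (f x) \<le> c / (norm x)\<^sup>2"
proof -
  from assms obtain c where c: "c > 0" "\<forall>\<^sub>F x in at_infinity. norm (f x) \<le> c * norm (complex_of_real (1 / (norm x)\<^sup>2))"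
    by (rule landau_o.bigE)
  then obtain b where "\<And>x. norm x \<ge> b \<Longrightarrow> norm (f x) \<le> c * norm (complex_of_real (1 / (norm x)\<^sup>2))"
    unfolding eventually_at_infinity by blast
  then show ?thesis using that[OF c(1), of b] by (simp add: norm_divide norm_power)
qed

text \<open>Far from the obstacle the scattered wave is small, whereas the plane wave has modulus one.\<close>

lemma total_field_nonzero:
  assumes "bounded D" and FF: "(\<lambda>x. (u x - plane_wave d k x)
      - exp (\<i> * of_real (k * norm x)) / of_real (norm x) * F (sgn x)) \<in> O[at_infinity](\<lambda>x. of_real (1 / (norm x)\<^sup>2))"
  obtains x where "x \<notin> closure D" "u x \<noteq> 0"
proof -
  obtain c b where c: "c > 0" "\<And>x. norm x \<ge> b \<Longrightarrow> norm ((u x - plane_wave d k x)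
      - exp (\<i> * of_real (k * norm x)) / of_real (norm x) * F (sgn x)) \<le> c / (norm x)\<^sup>2"
    using bigo_at_infinityD[OF FF] by blast
  obtain R where R: "\<And>x. x \<in> closure D \<Longrightarrow> norm x \<le> R"
    using assms(1) bounded_closure bounded_iff by metis
  define e :: "real^3" where "e = axis 1 1"
  define r where "r = \<bar>b\<bar> + \<bar>R\<bar> + norm (F e) + c + 2"
  have r: "r > 1" "r \<ge> b" "r > R" "r > norm (F e) + c"
    unfolding r_def using c(1) norm_ge_zero[of "F e"] by linarith+
  define x where "x = r *\<^sub>R e"
  have nx: "norm x = r" using r(1) by (simp add: x_def e_def)
  have sx: "sgn x = e" using r(1) by (simp add: x_def sgn_div_norm e_def)
  have "x \<notin> closure D" using R nx r(3) by force
  moreover have "u x \<noteq> 0"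
  proof
    assume u0: "u x = 0"
    have pw: "norm (plane_wave d k x) = 1" by (simp add: plane_wave_def)
    have "norm (- plane_wave d k x - exp (\<i> * of_real (k * r)) / of_real r * F e) \<le> c / r\<^sup>2"
      using c(2)[of x] u0 nx sx r(2) by simp
    moreover have "norm (exp (\<i> * of_real (k * r)) / of_real r * F e) = norm (F e) / r"
      using r(1) by (simp add: norm_mult norm_divide flip: of_real_mult)
    moreover have "norm (plane_wave d k x) \<le> norm (- plane_wave d k x - exp (\<i> * of_real (k * r)) / of_real r * F e) + norm (exp (\<i> * of_real (k * r)) / of_real r * F e)"
      by (metis add.commute diff_add_cancel norm_minus_cancel norm_triangle_ineq)
    ultimately have "1 \<le> c / r\<^sup>2 + norm (F e) / r" using pw by linarith
    also have "c / r\<^sup>2 \<le> c / r" using r(1) c(1) by (intro divide_left_mono) (auto simp: power2_eq_square)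
    finally have "1 \<le> (c + norm (F e)) / r" by (simp add: add_divide_distrib)
    then show False using r(1,4) by (simp add: field_simps)
  qed
  ultimately show ?thesis by (rule that)
qed

section \<open>Uniqueness of the obstacle\<close>

text \<open>A line is connected and unbounded, so one that avoids \<open>C\<close> lies in an unbounded component of the
  complement of \<open>C\<close>.\<close>

lemma line_in_outside:
  fixes x v :: "'a::euclidean_space"
  assumes "v \<noteq> 0" "\<And>t. x + t *\<^sub>R v \<notin> C"
  shows "x \<in> outside C"
proof -
  define L where "L = range (\<lambda>t. x + t *\<^sub>R v)"
  have "connected L" unfolding L_def
    by (rule connected_continuous_image) (auto intro!: continuous_intros)
  moreover have "x \<in> L" unfolding L_def by (rule range_eqI[of _ _ 0]) simp
  moreover have "L \<subseteq> - C" using assms(2) by (auto simp: L_def)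
  ultimately have sub: "L \<subseteq> connected_component_set (- C) x" by (intro connected_component_maximal)
  have "\<not> bounded L"
  proof
    assume "bounded L"
    then obtain B where B: "\<And>y. y \<in> L \<Longrightarrow> norm y \<le> B" using bounded_iff by metis
    define t where "t = (\<bar>B\<bar> + norm x + 1) / norm v"
    have t: "norm (t *\<^sub>R v) = \<bar>B\<bar> + norm x + 1" using assms(1) by (simp add: t_def)
    have "norm (t *\<^sub>R v) \<le> norm (x + t *\<^sub>R v) + norm x"
      by (metis add_diff_cancel_left' norm_triangle_ineq4)
    moreover have "norm (x + t *\<^sub>R v) \<le> B" by (rule B) (unfold L_def, rule rangeI)
    ultimately show False using t by linarith
  qed
  then have "\<not> bounded (connected_component_set (- C) x)" using sub bounded_subset by blast
  moreover have "x \<notin> C" using assms(2)[of 0] by simp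
  ultimately show ?thesis by (simp add: outside_def)
qed

text \<open>Let $G$ be the outside of the union. If the claim fails, the open set $V$ of the points that belong
  neither to the closure of \<open>D\<close> nor to that of $G$ is nonempty. It lies in the cylinder, because a line parallel to
  the axis that misses the cylinder is contained in $G$. On the frontier of $V$ the field \<open>u\<close> vanishes, either as a
  boundary value on the frontier of \<open>D\<close> or because it agrees with the boundary value of \<open>v\<close> on the frontier of \<open>E\<close>.
  Hence \<open>u\<close> vanishes in $V$, and by unique continuation everywhere outside \<open>D\<close>, contrary to
  \<open>total_field_nonzero\<close>.\<close>

lemma complement_subset_outside:
  fixes U :: "(real^2) set" and u v :: "real^3 \<Rightarrow> complex"
  assumes U: "bounded U" "open U" and k: "k > 0" "k\<^sup>2 \<le> first_dirichlet_eigenvalue U"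
    and D: "obstacle D" "closure D \<subseteq> cylinder U" and E: "obstacle E" "closure E \<subseteq> cylinder U"
    and u: "total_field D d k u" and v: "total_field E d k v"
    and FF: "(\<lambda>x. (u x - plane_wave d k x)
      - exp (\<i> * of_real (k * norm x)) / of_real (norm x) * F (sgn x)) \<in> O[at_infinity](\<lambda>x. of_real (1 / (norm x)\<^sup>2))"
    and eq: "\<And>x. x \<in> outside (closure D \<union> closure E) \<Longrightarrow> u x = v x"
  shows "- closure D \<subseteq> outside (closure D \<union> closure E)"
proof (rule ccontr)
  define G where "G = outside (closure D \<union> closure E)"
  assume "\<not> - closure D \<subseteq> outside (closure D \<union> closure E)"
  then have nsub: "- closure D - G \<noteq> {}" by (auto simp: G_def)
  have oD: "open D" "open E" and bD: "bounded (closure D \<union> closure E)" and conn: "connected (- closure D)"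
    using D(1) E(1) by (auto simp: obstacle_def bounded_closure)
  have cl: "closed (closure D \<union> closure E)" by (intro closed_Un closed_closure)
  have oG: "open G" unfolding G_def by (rule open_outside[OF cl])
  have GC: "G \<inter> (closure D \<union> closure E) = {}" by (auto simp: G_def outside_def)
  obtain R where R: "\<And>x. x \<in> closure D \<union> closure E \<Longrightarrow> norm x \<le> R" using bD bounded_iff by metis
  have far: "x \<in> G" if "norm x > R" for x
  proof -
    have "- cball 0 R \<subseteq> outside (closure D \<union> closure E)" by (rule outside_subset_convex) (use R in auto)
    then show ?thesis using that by (auto simp: G_def)
  qed
  have frG: "frontier G \<subseteq> closure D \<union> closure E" unfolding G_def by (rule frontier_outside_subset[OF cl])
  have clGE: "closure G \<inter> E = {}" and clGD: "closure G \<inter> D = {}"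
    using oD GC closure_subset[of D] closure_subset[of E] open_Int_closure_eq_empty[of E G] open_Int_closure_eq_empty[of D G] by blast+
  have cu: "continuous_on (- D) u" and cv: "continuous_on (- E) v" using u v by (auto simp: total_field_def)
  have uv: "u x - v x = 0" if "x \<in> closure G" for x
  proof (rule continuous_constant_on_closure[OF _ _ that])
    show "continuous_on (closure G) (\<lambda>x. u x - v x)"
      by (intro continuous_intros continuous_on_subset[OF cu] continuous_on_subset[OF cv]) (use clGE clGD in auto)
  qed (use eq in \<open>simp add: G_def\<close>)
  define V where "V = - closure D - closure G"
  have oV: "open V" unfolding V_def by (intro open_Diff open_Compl closed_closure)
  have bV: "bounded V"
  proof (rule bounded_subset[OF bounded_cball])
    show "V \<subseteq> cball 0 R"
    proof
      fix x assume "x \<in> V"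
      then have "x \<notin> G" using closure_subset by (auto simp: V_def)
      then show "x \<in> cball 0 R" using far[of x] by (cases "norm x > R") auto
    qed
  qed
  (* The exterior of D is connected and meets G without being contained in it. So it contains a frontier
     point of G, which belongs to the closure of E, and the points of E near it lie in V. *)
  have "V \<noteq> {}"
  proof -
    obtain y where "norm (y :: real^3) = \<bar>R\<bar> + 1" using vector_choose_size[of "\<bar>R\<bar> + 1"] by auto
    then have "y \<in> G" by (intro far) simp
    moreover have "G \<subseteq> - closure D" using GC by auto
    ultimately have "- closure D \<inter> G \<noteq> {}" by auto
    then have "- closure D \<inter> frontier G \<noteq> {}" using connected_Int_frontier[OF conn _ nsub] by blast
    then obtain x where x: "x \<in> - closure D" "x \<in> closure E" using frG by auto
    then obtain z where "z \<in> E" "z \<in> - closure D"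
      using open_Int_closure_eq_empty[of "- closure D" E] by (auto simp: open_Compl)
    then show ?thesis using clGE by (auto simp: V_def)
  qed
  have Vcyl: "V \<subseteq> cylinder U"
  proof
    fix x assume x: "x \<in> V"
    show "x \<in> cylinder U"
    proof (rule ccontr)
      assume n: "x \<notin> cylinder U"
      have "x \<in> outside (closure D \<union> closure E)"
      proof (rule line_in_outside[of "axis 1 1"])
        fix t
        have "x + t *\<^sub>R axis 1 1 \<notin> cylinder U" using n by (simp add: cylinder_def axis_def)
        then show "x + t *\<^sub>R axis 1 1 \<notin> closure D \<union> closure E" using D(2) E(2) by auto
      qed (simp add: axis_eq_0_iff)
      then show False using x closure_subset[of G] by (auto simp: V_def G_def)
    qed
  qed
  have clV: "closure V \<subseteq> - D"
    using open_Int_closure_eq_empty[OF oD(1), of V] closure_subset[of D] by (auto simp: V_def)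
  have bdry: "u x = 0" if x: "x \<in> frontier V" for x
  proof -
    have xV: "x \<in> closure V" "x \<notin> V" using x oV by (auto simp: frontier_def interior_open)
    show ?thesis
    proof (cases "x \<in> closure D")
      case True
      then have "x \<in> frontier D" using clV xV(1) oD(1) by (auto simp: frontier_def interior_open)
      then show ?thesis using u by (simp add: total_field_def)
    next
      case False
      then have xG: "x \<in> closure G" using xV(2) by (auto simp: V_def)
      have "G \<inter> V = {}" using closure_subset[of G] by (auto simp: V_def)
      then have "x \<notin> G" using xV(1) open_Int_closure_eq_empty[OF oG, of V] by auto
      then have "x \<in> frontier G" using xG oG by (auto simp: frontier_def interior_open)
      then have "x \<in> closure E" using frG False by auto
      then have "x \<in> frontier E" using clGE xG oD(2) by (auto simp: frontier_def interior_open)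
      then have "v x = 0" using v by (simp add: total_field_def)
      then show ?thesis using uv[OF xG] by simp
    qed
  qed
  have C2u: "Ck_on 2 (- closure D) u" and Hu: "\<And>x. x \<in> - closure D \<Longrightarrow> laplacian u x + of_real (k\<^sup>2) * u x = 0"
    using u by (auto simp: total_field_def)
  have VD: "V \<subseteq> - closure D" by (auto simp: V_def)
  have C2V: "Ck_on 2 V u" by (rule Ck_on_subset[OF C2u VD])
  have part: "L (u x) \<le> 0" if L: "bounded_linear L" and x: "x \<in> V" for L :: "complex \<Rightarrow> real" and x
  proof (rule Helmholtz_solution_nonpositive[of U "k\<^sup>2" V "\<lambda>x. L (u x)"])
    show "k\<^sup>2 * (LINT x|lborel. (\<phi> x)\<^sup>2) \<le> (LINT x|lborel. (norm (grad \<phi> x))\<^sup>2)"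
      if "Ck_on 1 UNIV \<phi>" "compact K" "K \<subseteq> U" "\<forall>x. x \<notin> K \<longrightarrow> \<phi> x = 0" for \<phi> :: "real^2 \<Rightarrow> real" and K
      by (rule first_dirichlet_eigenvalue_inequality[OF U(2,1) k(2) that(1-3)]) (use that(4) in blast)
    show "Ck_on 2 V (\<lambda>x. L (u x))" by (rule Ck_on_2_bounded_linear(1)[OF L oV C2V])
    show "laplacian (\<lambda>x. L (u x)) x + k\<^sup>2 * L (u x) = 0" if "x \<in> V" for x
    proof -
      have "laplacian (\<lambda>x. L (u x)) x = L (laplacian u x)" by (rule Ck_on_2_bounded_linear(2)[OF L oV C2V that])
      also have "laplacian u x = - ((k\<^sup>2) *\<^sub>R u x)"
        using Hu[of x] that VD by (auto simp: scaleR_conv_of_real add_eq_0_iff)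
      finally show ?thesis by (simp add: linear_neg[OF bounded_linear.linear[OF L]] linear_cmul[OF bounded_linear.linear[OF L]])
    qed
    show "continuous_on (closure V) (\<lambda>x. L (u x))"
      by (rule bounded_linear.continuous_on[OF L continuous_on_subset[OF cu clV]])
    show "L (u x) = 0" if "x \<in> frontier V" for x
      using bdry[OF that] linear_0[OF bounded_linear.linear[OF L]] by simp
  qed (rule oV bV Vcyl x)+
  have u0: "u x = 0" if x: "x \<in> V" for x
  proof -
    have "Re (u x) \<le> 0" "- Re (u x) \<le> 0" "Im (u x) \<le> 0" "- Im (u x) \<le> 0"
      using part[OF bounded_linear_Re x] part[OF bounded_linear_minus[OF bounded_linear_Re] x]
        part[OF bounded_linear_Im x] part[OF bounded_linear_minus[OF bounded_linear_Im] x] by simp_all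
    then show ?thesis by (simp add: complex_eq_iff)
  qed
  have "u x = 0" if "x \<in> - closure D" for x
    by (rule Helmholtz_unique_continuation[OF k(1) _ conn C2u Hu oV \<open>V \<noteq> {}\<close> VD u0 that]) (simp add: open_Compl)
  moreover have "bounded D" using D(1) by (simp add: obstacle_def)
  ultimately show False using total_field_nonzero[OF _ FF, of D] by blast
qed

theorem corollary1p2:
  fixes \<Omega>' :: "(real^2) set" and k :: real and d :: "real^3"
    and D\<^sub>1 D\<^sub>2 :: "(real^3) set" and F\<^sub>1 F\<^sub>2 :: "real^3 \<Rightarrow> complex"
  assumes "bounded \<Omega>'" and "open \<Omega>'" and "connected \<Omega>'"
    and "k > 0" and "k\<^sup>2 \<le> first_dirichlet_eigenvalue \<Omega>'"
    and "d \<in> sphere 0 1"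
    and "obstacle D\<^sub>1" and "closure D\<^sub>1 \<subseteq> cylinder \<Omega>'"
    and "obstacle D\<^sub>2" and "closure D\<^sub>2 \<subseteq> cylinder \<Omega>'"
    and "far_field_pattern D\<^sub>1 d k F\<^sub>1" and "far_field_pattern D\<^sub>2 d k F\<^sub>2"
    and "\<And>\<phi>. \<phi> \<in> sphere 0 1 \<Longrightarrow> F\<^sub>1 \<phi> = F\<^sub>2 \<phi>"
  shows "D\<^sub>1 = D\<^sub>2"
proof -
  obtain u where u: "total_field D\<^sub>1 d k u"
    and Fu: "(\<lambda>x. (u x - plane_wave d k x)
      - exp (\<i> * of_real (k * norm x)) / of_real (norm x) * F\<^sub>1 (sgn x)) \<in> O[at_infinity](\<lambda>x. of_real (1 / (norm x)\<^sup>2))"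
    using assms(11) unfolding far_field_pattern_def by blast
  obtain v where v: "total_field D\<^sub>2 d k v"
    and Fv: "(\<lambda>x. (v x - plane_wave d k x)
      - exp (\<i> * of_real (k * norm x)) / of_real (norm x) * F\<^sub>2 (sgn x)) \<in> O[at_infinity](\<lambda>x. of_real (1 / (norm x)\<^sup>2))"
    using assms(12) unfolding far_field_pattern_def by blast
  define C where "C = closure D\<^sub>1 \<union> closure D\<^sub>2"
  have bC: "bounded C" using assms(7,9) by (auto simp: C_def obstacle_def bounded_closure)
  have cC: "closed C" unfolding C_def by (intro closed_Un closed_closure)
  obtain B where B: "\<And>x. x \<in> C \<Longrightarrow> norm x \<le> B" using bC bounded_iff by metis
  obtain c1 b1 where c1: "c1 > 0" "\<And>x. norm x \<ge> b1 \<Longrightarrow> norm ((u x - plane_wave d k x)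
      - exp (\<i> * of_real (k * norm x)) / of_real (norm x) * F\<^sub>1 (sgn x)) \<le> c1 / (norm x)\<^sup>2"
    using bigo_at_infinityD[OF Fu] by blast
  obtain c2 b2 where c2: "c2 > 0" "\<And>x. norm x \<ge> b2 \<Longrightarrow> norm ((v x - plane_wave d k x)
      - exp (\<i> * of_real (k * norm x)) / of_real (norm x) * F\<^sub>2 (sgn x)) \<le> c2 / (norm x)\<^sup>2"
    using bigo_at_infinityD[OF Fv] by blast
  define R where "R = max (max 1 B) (max b1 b2)"
  have R: "R \<ge> 1" "R \<ge> B" "R \<ge> b1" "R \<ge> b2" by (auto simp: R_def)
  define w where "w = (\<lambda>x. u x - v x)"
  have uH: "Ck_on 2 (- closure D\<^sub>1) u" "\<And>x. x \<in> - closure D\<^sub>1 \<Longrightarrow> laplacian u x + of_real (k\<^sup>2) * u x = 0"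
    and vH: "Ck_on 2 (- closure D\<^sub>2) v" "\<And>x. x \<in> - closure D\<^sub>2 \<Longrightarrow> laplacian v x + of_real (k\<^sup>2) * v x = 0"
    using u v by (auto simp: total_field_def)
  have sub: "- C \<subseteq> - closure D\<^sub>1" "- C \<subseteq> - closure D\<^sub>2" by (auto simp: C_def)
  have oC: "open (- C)" using cC by (simp add: open_Compl)
  note C2 = Ck_on_2_diff[OF oC Ck_on_subset[OF uH(1) sub(1)] Ck_on_subset[OF vH(1) sub(2)]]
  have wC: "Ck_on 2 (- C) w" unfolding w_def by (rule C2(1))
  have wH: "laplacian w x + of_real (k\<^sup>2) * w x = 0" if "x \<in> - C" for x
  proof -
    have "laplacian w x + of_real (k\<^sup>2) * w x = (laplacian u x + of_real (k\<^sup>2) * u x) - (laplacian v x + of_real (k\<^sup>2) * v x)"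
      unfolding w_def C2(2)[OF that] by (simp add: algebra_simps)
    then show ?thesis using uH(2)[of x] vH(2)[of x] that sub by (simp add: C_def)
  qed
  have farC: "x \<in> - C" if "norm x > R" for x using B[of x] R(2) that by force
  have w_far: "w x = 0" if "norm x > R" for x
  proof (rule Rellich[OF assms(4) R(1) _ _ _ that, of w "c1 + c2"])
    show "Ck_on 2 {x. norm x > R} w" by (rule Ck_on_subset[OF wC]) (use farC in auto)
    show "laplacian w x + of_real (k\<^sup>2) * w x = 0" if "norm x > R" for x using wH farC that by blast
    show "norm (w x) \<le> (c1 + c2) / (norm x)\<^sup>2" if x: "norm x > R" for x
    proof -
      have "x \<noteq> 0" using x R(1) by auto
      then have "sgn x \<in> sphere 0 1" by (simp add: norm_sgn)
      then have F: "F\<^sub>1 (sgn x) = F\<^sub>2 (sgn x)" by (rule assms(13))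
      let ?f = "\<lambda>u F. u x - plane_wave d k x - exp (\<i> * of_real (k * norm x)) / of_real (norm x) * F (sgn x)"
      have "w x = ?f u F\<^sub>1 - ?f v F\<^sub>2" by (simp add: w_def F)
      then have "norm (w x) \<le> norm (?f u F\<^sub>1) + norm (?f v F\<^sub>2)" by (simp only: norm_triangle_ineq4)
      also have "\<dots> \<le> c1 / (norm x)\<^sup>2 + c2 / (norm x)\<^sup>2" by (intro add_mono c1(2) c2(2)) (use x R in auto)
      finally show ?thesis by (simp add: add_divide_distrib)
    qed
  qed
  have oG: "open (outside C)" by (rule open_outside[OF cC])
  have GC: "outside C \<subseteq> - C" by (auto simp: outside_def)
  have conn: "connected (outside C)" by (rule connected_outside[OF bC]) simp
  have uv: "u x = v x" if "x \<in> outside C" for x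
  proof -
    let ?U = "{x :: real^3. norm x > R}"
    have oU: "open ?U" by (intro open_Collect_less continuous_intros)
    obtain y :: "real^3" where "norm y = \<bar>R\<bar> + 1" using vector_choose_size[of "\<bar>R\<bar> + 1"] by auto
    then have "y \<in> ?U" by simp
    then have ne: "?U \<noteq> {}" by blast
    have "- cball 0 R \<subseteq> outside C" by (rule outside_subset_convex) (use B R(2) in force)+
    then have US: "?U \<subseteq> outside C" by auto
    have "w x = 0"
      by (rule Helmholtz_unique_continuation[OF assms(4) oG conn Ck_on_subset[OF wC GC] _ oU ne US _ that])
         (use wH GC w_far in auto)
    then show ?thesis by (simp add: w_def)
  qed
  have "- closure D\<^sub>1 \<subseteq> outside (closure D\<^sub>1 \<union> closure D\<^sub>2)"
    by (rule complement_subset_outside[OF assms(1,2,4,5,7,8,9,10) u v Fu]) (use uv in \<open>simp add: C_def\<close>)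
  then have s1: "- closure D\<^sub>1 \<subseteq> - C" using GC by (auto simp: C_def)
  have "- closure D\<^sub>2 \<subseteq> outside (closure D\<^sub>2 \<union> closure D\<^sub>1)"
    by (rule complement_subset_outside[OF assms(1,2,4,5,9,10,7,8) v u Fv]) (use uv in \<open>simp add: C_def Un_commute\<close>)
  then have s2: "- closure D\<^sub>2 \<subseteq> - C" using GC by (auto simp: C_def Un_commute)
  have "closure D\<^sub>1 = closure D\<^sub>2" using s1 s2 by (auto simp: C_def)
  then have "interior (closure D\<^sub>1) = interior (closure D\<^sub>2)" by simp
  then show ?thesis using interior_closure_C2_boundary assms(7,9) by (simp add: obstacle_def)
qed

end
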